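(* Let $\Lambda$ be a $k$-graph, and let $A$ be an abelian group. For each $r\ge0$ there is a short exact sequence $$0\to\operatorname{Ext}(H_{r-1}(\Lambda),A)\xrightarrow{\ \alpha\ }H^r(\Lambda,A)\xrightarrow{\ \beta\ }\operatorname{Hom}(H_r(\Lambda),A)\to0,$$ and the maps $\alpha$ and $\beta$ are natural in $A$ and $\Lambda$.
   Context: Conventions: $0\in\mathbb{N}$ and $\mathbb{N}^0=\{0\}$. A $k$-graph ($k\ge0$) is a nonempty countable small category $\Lambda$ with a functor $d:\Lambda\to\mathbb{N}^k$ (the degree) satisfying the factorisation property: whenever $d(\lambda)=m+n$ there are unique $\mu,\nu\in\Lambda$ with $d(\mu)=m$, $d(\nu)=n$, $\lambda=\mu\nu$. $\Lambda^n=d^{-1}(n)$. $e_1,\dots,e_k$ are the standard generators of $\mathbb{N}^k$, $\mathbf{1}_k=\sum_i e_i$, $\le$ on $\mathbb{N}^k$ is coordinatewise, $|n|=\sum_i n_i$. A $k$-graph morphism is a degree-preserving functor; naturality in $\Lambda$ is with respect to these. Homology: $Q_r(\Lambda)=\{\lambda\in\Lambda: d(\lambda)\le\mathbf{1}_k,\ |d(\lambda)|=r\}$. For $\lambda\in Q_r(\Lambda)$ with $d(\lambda)=e_{i_1}+\dots+e_{i_r}$, $i_1<\dots<i_r$, and $1\le j\le r$, the faces $F_j^0(\lambda),F_j^1(\lambda)\in Q_{r-1}(\Lambda)$ are the unique elements for which there are $\alpha,\beta\in\Lambda^{e_{i_j}}$ with $F_j^0(\lambda)\beta=\lambda=\alpha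 F_j^1(\lambda)$. $C_r(\Lambda)=\mathbb{Z}Q_r(\Lambda)$ is the free abelian group on $Q_r(\Lambda)$; for $r\ge1$, $\partial_r:C_r(\Lambda)\to C_{r-1}(\Lambda)$ is the homomorphism with $\partial_r(\lambda)=\sum_{\ell=0}^1\sum_{i=1}^r(-1)^{i+\ell}F_i^\ell(\lambda)$, and $\partial_0=0$. This is a chain complex and $H_r(\Lambda)=\ker\partial_r/\operatorname{Im}\partial_{r+1}$ (with $H_{-1}(\Lambda)=0$). Cohomology: $C^r(\Lambda,A)$ is the group of functions $f:Q_r(\Lambda)\to A$, identified with $\operatorname{Hom}(C_r(\Lambda),A)$; $\delta^r:C^r(\Lambda,A)\to C^{r+1}(\Lambda,A)$ is $\delta^r(f)(\lambda)=f(\partial_{r+1}(\lambda))$. $H^r(\Lambda,A)=\ker(\delta^r)/\operatorname{Im}(\delta^{r-1})$ (with $\delta^{-1}=0$). $\operatorname{Ext}=\operatorname{Ext}^1_{\mathbb{Z}}$ and $\operatorname{Hom}=\operatorname{Hom}_{\mathbb{Z}}$. *)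

theory Defs
  imports
    "HOL-Algebra.Free_Abelian_Groups"
    "HOL-Library.Function_Algebras"
begin

section \<open>Higher-rank graphs\<close>

text \<open>
  The composite of \<open>\<mu>\<close> and \<open>\<nu>\<close>, written \<open>\<mu>\<nu>\<close> in the text, is \<open>Comp C \<mu> \<nu>\<close>; it is meaningful when
  \<open>Src C \<mu> = Rng C \<nu>\<close>.  The field \<open>Deg\<close> is only used for \<open>k\<close>-graphs.
\<close>

record ('o, 'm) graded_category =
  Obj   :: "'o set"
  Mor   :: "'m set"
  Rng   :: "'m \<Rightarrow> 'o"
  Src   :: "'m \<Rightarrow> 'o"
  Ident :: "'o \<Rightarrow> 'm"
  Comp  :: "'m \<Rightarrow> 'm \<Rightarrow> 'm"
  Deg   :: "'m \<Rightarrow> nat \<Rightarrow> nat"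

locale small_category =
  fixes C :: "('o, 'm) graded_category"
  assumes Rng_in: "\<rho> \<in> Mor C \<Longrightarrow> Rng C \<rho> \<in> Obj C"
    and Src_in: "\<rho> \<in> Mor C \<Longrightarrow> Src C \<rho> \<in> Obj C"
    and Ident_in: "v \<in> Obj C \<Longrightarrow> Ident C v \<in> Mor C"
    and Rng_Ident: "v \<in> Obj C \<Longrightarrow> Rng C (Ident C v) = v"
    and Src_Ident: "v \<in> Obj C \<Longrightarrow> Src C (Ident C v) = v"
    and Comp_in: "\<lbrakk>\<mu> \<in> Mor C; \<nu> \<in> Mor C; Src C \<mu> = Rng C \<nu>\<rbrakk> \<Longrightarrow> Comp C \<mu> \<nu> \<in> Mor C"
    and Rng_Comp: "\<lbrakk>\<mu> \<in> Mor C; \<nu> \<in> Mor C; Src C \<mu> = Rng C \<nu>\<rbrakk> \<Longrightarrow> Rng C (Comp C \<mu> \<nu>) = Rng C \<mu>"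
    and Src_Comp: "\<lbrakk>\<mu> \<in> Mor C; \<nu> \<in> Mor C; Src C \<mu> = Rng C \<nu>\<rbrakk> \<Longrightarrow> Src C (Comp C \<mu> \<nu>) = Src C \<nu>"
    and Comp_assoc:
      "\<lbrakk>\<rho> \<in> Mor C; \<mu> \<in> Mor C; \<nu> \<in> Mor C; Src C \<rho> = Rng C \<mu>; Src C \<mu> = Rng C \<nu>\<rbrakk>
        \<Longrightarrow> Comp C (Comp C \<rho> \<mu>) \<nu> = Comp C \<rho> (Comp C \<mu> \<nu>)"
    and Ident_left: "\<rho> \<in> Mor C \<Longrightarrow> Comp C (Ident C (Rng C \<rho>)) \<rho> = \<rho>"
    and Ident_right: "\<rho> \<in> Mor C \<Longrightarrow> Comp C \<rho> (Ident C (Src C \<rho>)) = \<rho>"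

text \<open>
  Elements of \<open>\<nat>\<^sup>k\<close> are functions \<open>nat \<Rightarrow> nat\<close> that vanish outside the index set \<open>{1..k}\<close>;
  addition, \<open>0\<close> and the order on them are pointwise.
\<close>

definition Nk :: "nat \<Rightarrow> (nat \<Rightarrow> nat) set"
  where "Nk k = {n. \<forall>i. i \<notin> {1..k} \<longrightarrow> n i = 0}"

definition gen :: "nat \<Rightarrow> nat \<Rightarrow> nat"
  where "gen i = (\<lambda>j. if j = i then 1 else 0)"

definition ones :: "nat \<Rightarrow> nat \<Rightarrow> nat"
  where "ones k = (\<Sum>i = 1..k. gen i)"

definition size_Nk :: "nat \<Rightarrow> (nat \<Rightarrow> nat) \<Rightarrow> nat"
  where "size_Nk k n = (\<Sum>i = 1..k. n i)"

locale k_graph = small_category \<Lambda>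
  for k :: nat and \<Lambda> :: "('o, 'm) graded_category" +
  assumes nonempty: "Mor \<Lambda> \<noteq> {}"
    and countable_Mor: "countable (Mor \<Lambda>)"
    and Deg_in: "\<rho> \<in> Mor \<Lambda> \<Longrightarrow> Deg \<Lambda> \<rho> \<in> Nk k"
    and Deg_Ident: "v \<in> Obj \<Lambda> \<Longrightarrow> Deg \<Lambda> (Ident \<Lambda> v) = 0"
    and Deg_Comp: "\<lbrakk>\<mu> \<in> Mor \<Lambda>; \<nu> \<in> Mor \<Lambda>; Src \<Lambda> \<mu> = Rng \<Lambda> \<nu>\<rbrakk>
          \<Longrightarrow> Deg \<Lambda> (Comp \<Lambda> \<mu> \<nu>) = Deg \<Lambda> \<mu> + Deg \<Lambda> \<nu>"
    and factorisation: "\<lbrakk>\<rho> \<in> Mor \<Lambda>; m \<in> Nk k; n \<in> Nk k; Deg \<Lambda> \<rho> = m + n\<rbrakk>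
          \<Longrightarrow> \<exists>!p. fst p \<in> Mor \<Lambda> \<and> snd p \<in> Mor \<Lambda> \<and> Src \<Lambda> (fst p) = Rng \<Lambda> (snd p)
                 \<and> Deg \<Lambda> (fst p) = m \<and> Deg \<Lambda> (snd p) = n \<and> \<rho> = Comp \<Lambda> (fst p) (snd p)"

text \<open>A degree-preserving functor, given by its object map \<open>Fo\<close> and its morphism map \<open>F\<close>.\<close>

locale k_graph_morphism = dom: k_graph k \<Lambda> + cod: k_graph k \<Gamma>
  for k :: nat and \<Lambda> :: "('o, 'm) graded_category" and \<Gamma> :: "('p, 'n) graded_category"
    and Fo :: "'o \<Rightarrow> 'p" and F :: "'m \<Rightarrow> 'n" +
  assumes Fo_in: "v \<in> Obj \<Lambda> \<Longrightarrow> Fo v \<in> Obj \<Gamma>"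
    and F_in: "\<rho> \<in> Mor \<Lambda> \<Longrightarrow> F \<rho> \<in> Mor \<Gamma>"
    and Rng_F: "\<rho> \<in> Mor \<Lambda> \<Longrightarrow> Rng \<Gamma> (F \<rho>) = Fo (Rng \<Lambda> \<rho>)"
    and Src_F: "\<rho> \<in> Mor \<Lambda> \<Longrightarrow> Src \<Gamma> (F \<rho>) = Fo (Src \<Lambda> \<rho>)"
    and F_Ident: "v \<in> Obj \<Lambda> \<Longrightarrow> F (Ident \<Lambda> v) = Ident \<Gamma> (Fo v)"
    and F_Comp: "\<lbrakk>\<mu> \<in> Mor \<Lambda>; \<nu> \<in> Mor \<Lambda>; Src \<Lambda> \<mu> = Rng \<Lambda> \<nu>\<rbrakk>
          \<Longrightarrow> F (Comp \<Lambda> \<mu> \<nu>) = Comp \<Gamma> (F \<mu>) (F \<nu>)"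
    and Deg_F: "\<rho> \<in> Mor \<Lambda> \<Longrightarrow> Deg \<Gamma> (F \<rho>) = Deg \<Lambda> \<rho>"


section \<open>Some constructions with abelian groups\<close>

text \<open>
  The extension of \<open>f\<close>, defined on a set \<open>S\<close>, to a homomorphism \<open>free_Abelian_group S \<rightarrow> A\<close>.
  Abelian groups are written multiplicatively.
\<close>

definition lin_ext :: "('a, 'z) monoid_scheme \<Rightarrow> ('s \<Rightarrow> 'a) \<Rightarrow> ('s \<Rightarrow>\<^sub>0 int) \<Rightarrow> 'a"
  where "lin_ext A f x =
    finprod A (\<lambda>s. f s [^]\<^bsub>A\<^esub> Poly_Mapping.lookup x s) (Poly_Mapping.keys x)"

text \<open>
  The map into the quotient \<open>H Mod N\<close>, defined on the elements (cosets) of another quotient,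
  that is induced by \<open>f\<close>.
\<close>

definition quot_map ::
    "('h, 'z) monoid_scheme \<Rightarrow> 'h set \<Rightarrow> ('g \<Rightarrow> 'h) \<Rightarrow> 'g set \<Rightarrow> 'h set"
  where "quot_map H N f X = the_elem ((\<lambda>x. N #>\<^bsub>H\<^esub> f x) ` X)"

text \<open>
  Homomorphisms are taken to be \<open>undefined\<close> outside the carrier, so that equality of elements of
  \<open>hom_group G A\<close> is equality on \<open>carrier G\<close>.
\<close>

definition hom_group ::
    "('g, 'y) monoid_scheme \<Rightarrow> ('a, 'z) monoid_scheme \<Rightarrow> ('g \<Rightarrow> 'a) monoid"
  where "hom_group G A =
    (product_group (carrier G) (\<lambda>_. A)) \<lparr>carrier := hom G A \<inter> extensional (carrier G)\<rparr>"

definition hom_pre :: "('g, 'y) monoid_scheme \<Rightarrow> ('g \<Rightarrow> 'h) \<Rightarrow> ('h \<Rightarrow> 'a) \<Rightarrow> 'g \<Rightarrow> 'a"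
  where "hom_pre G \<phi> f = (\<lambda>x\<in>carrier G. f (\<phi> x))"

definition hom_post :: "('g, 'y) monoid_scheme \<Rightarrow> ('a \<Rightarrow> 'b) \<Rightarrow> ('g \<Rightarrow> 'a) \<Rightarrow> 'g \<Rightarrow> 'b"
  where "hom_post G \<psi> f = (\<lambda>x\<in>carrier G. \<psi> (f x))"

definition free_map :: "('s \<Rightarrow> 't) \<Rightarrow> ('s \<Rightarrow>\<^sub>0 int) \<Rightarrow> ('t \<Rightarrow>\<^sub>0 int)"
  where "free_map F = frag_extend (\<lambda>s. frag_of (F s))"

text \<open>
  \<open>Ext(G, A)\<close> is computed from the standard free resolution \<open>0 \<rightarrow> K \<rightarrow> \<int>[G] \<rightarrow> G \<rightarrow> 0\<close>, in which
  \<open>\<int>[G]\<close> is free on the underlying set of \<open>G\<close>, the map to \<open>G\<close> sends a generator \<open>[g]\<close> to \<open>g\<close>, and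
  \<open>K\<close>, being a subgroup of a free abelian group, is free.  So \<open>Ext(G, A)\<close> is the cokernel of
  the restriction map \<open>Hom(\<int>[G], A) \<rightarrow> Hom(K, A)\<close>.  The resolution is functorial in \<open>G\<close>.
\<close>

definition res_aug :: "('g, 'y) monoid_scheme \<Rightarrow> ('g \<Rightarrow>\<^sub>0 int) \<Rightarrow> 'g"
  where "res_aug G = lin_ext G (\<lambda>g. g)"

definition res_ker :: "('g, 'y) monoid_scheme \<Rightarrow> ('g \<Rightarrow>\<^sub>0 int) monoid"
  where "res_ker G = (free_Abelian_group (carrier G))
    \<lparr>carrier := kernel (free_Abelian_group (carrier G)) G (res_aug G)\<rparr>"

definition ext_restr ::
    "('g, 'y) monoid_scheme \<Rightarrow> ('a, 'z) monoid_scheme \<Rightarrow> (('g \<Rightarrow>\<^sub>0 int) \<Rightarrow> 'a) set"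
  where "ext_restr G A =
    (\<lambda>f. restrict f (carrier (res_ker G))) ` carrier (hom_group (free_Abelian_group (carrier G)) A)"

definition Ext ::
    "('g, 'y) monoid_scheme \<Rightarrow> ('a, 'z) monoid_scheme \<Rightarrow> (('g \<Rightarrow>\<^sub>0 int) \<Rightarrow> 'a) set monoid"
  where "Ext G A = hom_group (res_ker G) A Mod ext_restr G A"

text \<open>\<open>Ext(\<phi>, A) : Ext(G', A) \<rightarrow> Ext(G, A)\<close> for a homomorphism \<open>\<phi> : G \<rightarrow> G'\<close>\<close>

definition Ext_pre ::
    "('g, 'y) monoid_scheme \<Rightarrow> ('a, 'z) monoid_scheme \<Rightarrow> ('g \<Rightarrow> 'h)
      \<Rightarrow> (('h \<Rightarrow>\<^sub>0 int) \<Rightarrow> 'a) set \<Rightarrow> (('g \<Rightarrow>\<^sub>0 int) \<Rightarrow> 'a) set"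
  where "Ext_pre G A \<phi> =
    quot_map (hom_group (res_ker G) A) (ext_restr G A) (hom_pre (res_ker G) (free_map \<phi>))"

text \<open>\<open>Ext(G, \<psi>) : Ext(G, A) \<rightarrow> Ext(G, B)\<close> for a homomorphism \<open>\<psi> : A \<rightarrow> B\<close>\<close>

definition Ext_post ::
    "('g, 'y) monoid_scheme \<Rightarrow> ('b, 'z) monoid_scheme \<Rightarrow> ('a \<Rightarrow> 'b)
      \<Rightarrow> (('g \<Rightarrow>\<^sub>0 int) \<Rightarrow> 'a) set \<Rightarrow> (('g \<Rightarrow>\<^sub>0 int) \<Rightarrow> 'b) set"
  where "Ext_post G B \<psi> =
    quot_map (hom_group (res_ker G) B) (ext_restr G B) (hom_post (res_ker G) \<psi>)"

text \<open>
  The library's \<open>short_exact_sequence\<close> (in \<open>HOL-Algebra.Exact_Sequence\<close>) forces the three groups to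
  have the same element type, which is not the case here.
\<close>

definition short_exact ::
    "('g, 'x) monoid_scheme \<Rightarrow> ('h, 'y) monoid_scheme \<Rightarrow> ('k, 'z) monoid_scheme
      \<Rightarrow> ('g \<Rightarrow> 'h) \<Rightarrow> ('h \<Rightarrow> 'k) \<Rightarrow> bool"
  where "short_exact G H K f g \<longleftrightarrow>
    comm_group G \<and> comm_group H \<and> comm_group K \<and>
    f \<in> mon G H \<and> g \<in> epi H K \<and> f ` carrier G = kernel H K g"


section \<open>Homology\<close>

text \<open>
  The index \<open>r\<close> is an integer.  For \<open>r < 0\<close> the set \<open>cubes k \<Lambda> r\<close> is empty, so the chain and
  cochain groups are trivial; this yields \<open>H\<^sub>-\<^sub>1 = 0\<close>, \<open>\<partial>\<^sub>0 = 0\<close> and \<open>\<delta>\<^sup>-\<^sup>1 = 0\<close>.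
\<close>

definition cubes :: "nat \<Rightarrow> ('o, 'm) graded_category \<Rightarrow> int \<Rightarrow> 'm set"
  where "cubes k \<Lambda> r =
    {\<rho> \<in> Mor \<Lambda>. Deg \<Lambda> \<rho> \<le> ones k \<and> int (size_Nk k (Deg \<Lambda> \<rho>)) = r}"

text \<open>If \<open>d(\<rho>) = e\<^bsub>i\<^sub>1\<^esub> + \<dots> + e\<^bsub>i\<^sub>r\<^esub>\<close> with \<open>i\<^sub>1 < \<dots> < i\<^sub>r\<close>, then \<open>cube_dir \<Lambda> \<rho> j = i\<^sub>j\<close> for \<open>1 \<le> j \<le> r\<close>.\<close>

definition cube_dir :: "('o, 'm) graded_category \<Rightarrow> 'm \<Rightarrow> nat \<Rightarrow> nat"
  where "cube_dir \<Lambda> \<rho> j = sorted_list_of_set {i. Deg \<Lambda> \<rho> i \<noteq> 0} ! (j - 1)"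

definition face0 :: "nat \<Rightarrow> ('o, 'm) graded_category \<Rightarrow> int \<Rightarrow> nat \<Rightarrow> 'm \<Rightarrow> 'm"
  where "face0 k \<Lambda> r j \<rho> = (THE \<mu>. \<mu> \<in> cubes k \<Lambda> (r - 1) \<and>
    (\<exists>\<beta>\<in>Mor \<Lambda>. Deg \<Lambda> \<beta> = gen (cube_dir \<Lambda> \<rho> j) \<and> Src \<Lambda> \<mu> = Rng \<Lambda> \<beta> \<and> Comp \<Lambda> \<mu> \<beta> = \<rho>))"

definition face1 :: "nat \<Rightarrow> ('o, 'm) graded_category \<Rightarrow> int \<Rightarrow> nat \<Rightarrow> 'm \<Rightarrow> 'm"
  where "face1 k \<Lambda> r j \<rho> = (THE \<mu>. \<mu> \<in> cubes k \<Lambda> (r - 1) \<and>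
    (\<exists>\<alpha>\<in>Mor \<Lambda>. Deg \<Lambda> \<alpha> = gen (cube_dir \<Lambda> \<rho> j) \<and> Src \<Lambda> \<alpha> = Rng \<Lambda> \<mu> \<and> Comp \<Lambda> \<alpha> \<mu> = \<rho>))"

definition face :: "nat \<Rightarrow> ('o, 'm) graded_category \<Rightarrow> int \<Rightarrow> nat \<Rightarrow> nat \<Rightarrow> 'm \<Rightarrow> 'm"
  where "face k \<Lambda> r l j = (if l = 0 then face0 k \<Lambda> r j else face1 k \<Lambda> r j)"

definition chains :: "nat \<Rightarrow> ('o, 'm) graded_category \<Rightarrow> int \<Rightarrow> ('m \<Rightarrow>\<^sub>0 int) monoid"
  where "chains k \<Lambda> r = free_Abelian_group (cubes k \<Lambda> r)"

definition bd :: "nat \<Rightarrow> ('o, 'm) graded_category \<Rightarrow> int \<Rightarrow> ('m \<Rightarrow>\<^sub>0 int) \<Rightarrow> ('m \<Rightarrow>\<^sub>0 int)"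
  where "bd k \<Lambda> r = frag_extend
    (\<lambda>\<rho>. \<Sum>l = 0..1. \<Sum>j = 1..nat r. frag_cmul ((-1) ^ (j + l)) (frag_of (face k \<Lambda> r l j \<rho>)))"

definition cycle_group :: "nat \<Rightarrow> ('o, 'm) graded_category \<Rightarrow> int \<Rightarrow> ('m \<Rightarrow>\<^sub>0 int) monoid"
  where "cycle_group k \<Lambda> r =
    (chains k \<Lambda> r)\<lparr>carrier := kernel (chains k \<Lambda> r) (chains k \<Lambda> (r - 1)) (bd k \<Lambda> r)\<rparr>"

definition boundaries :: "nat \<Rightarrow> ('o, 'm) graded_category \<Rightarrow> int \<Rightarrow> ('m \<Rightarrow>\<^sub>0 int) set"
  where "boundaries k \<Lambda> r = bd k \<Lambda> (r + 1) ` carrier (chains k \<Lambda> (r + 1))"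

definition homology :: "nat \<Rightarrow> ('o, 'm) graded_category \<Rightarrow> int \<Rightarrow> ('m \<Rightarrow>\<^sub>0 int) set monoid"
  where "homology k \<Lambda> r = cycle_group k \<Lambda> r Mod boundaries k \<Lambda> r"

text \<open>\<open>F\<^sub>* : H\<^sub>r(\<Lambda>) \<rightarrow> H\<^sub>r(\<Gamma>)\<close> for a morphism \<open>F : \<Lambda> \<rightarrow> \<Gamma>\<close>\<close>

definition homology_map ::
    "nat \<Rightarrow> ('p, 'n) graded_category \<Rightarrow> int \<Rightarrow> ('m \<Rightarrow> 'n) \<Rightarrow> ('m \<Rightarrow>\<^sub>0 int) set \<Rightarrow> ('n \<Rightarrow>\<^sub>0 int) set"
  where "homology_map k \<Gamma> r F = quot_map (cycle_group k \<Gamma> r) (boundaries k \<Gamma> r) (free_map F)"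


section \<open>Cohomology\<close>

definition cochains ::
    "nat \<Rightarrow> ('o, 'm) graded_category \<Rightarrow> ('a, 'z) monoid_scheme \<Rightarrow> int \<Rightarrow> ('m \<Rightarrow> 'a) monoid"
  where "cochains k \<Lambda> A r = product_group (cubes k \<Lambda> r) (\<lambda>_. A)"

definition cobd ::
    "nat \<Rightarrow> ('o, 'm) graded_category \<Rightarrow> ('a, 'z) monoid_scheme \<Rightarrow> int \<Rightarrow> ('m \<Rightarrow> 'a) \<Rightarrow> 'm \<Rightarrow> 'a"
  where "cobd k \<Lambda> A r f =
    (\<lambda>\<rho>\<in>cubes k \<Lambda> (r + 1). lin_ext A f (bd k \<Lambda> (r + 1) (frag_of \<rho>)))"

definition cocycle_group ::
    "nat \<Rightarrow> ('o, 'm) graded_category \<Rightarrow> ('a, 'z) monoid_scheme \<Rightarrow> int \<Rightarrow> ('m \<Rightarrow> 'a) monoid"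
  where "cocycle_group k \<Lambda> A r = (cochains k \<Lambda> A r)
    \<lparr>carrier := kernel (cochains k \<Lambda> A r) (cochains k \<Lambda> A (r + 1)) (cobd k \<Lambda> A r)\<rparr>"

definition coboundaries ::
    "nat \<Rightarrow> ('o, 'm) graded_category \<Rightarrow> ('a, 'z) monoid_scheme \<Rightarrow> int \<Rightarrow> ('m \<Rightarrow> 'a) set"
  where "coboundaries k \<Lambda> A r = cobd k \<Lambda> A (r - 1) ` carrier (cochains k \<Lambda> A (r - 1))"

definition cohomology ::
    "nat \<Rightarrow> ('o, 'm) graded_category \<Rightarrow> ('a, 'z) monoid_scheme \<Rightarrow> int \<Rightarrow> ('m \<Rightarrow> 'a) set monoid"
  where "cohomology k \<Lambda> A r = cocycle_group k \<Lambda> A r Mod coboundaries k \<Lambda> A r"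

text \<open>\<open>F\<^sup>* : H\<^sup>r(\<Gamma>, A) \<rightarrow> H\<^sup>r(\<Lambda>, A)\<close> for a morphism \<open>F : \<Lambda> \<rightarrow> \<Gamma>\<close>\<close>

definition cohomology_pre ::
    "nat \<Rightarrow> ('o, 'm) graded_category \<Rightarrow> ('a, 'z) monoid_scheme \<Rightarrow> int \<Rightarrow> ('m \<Rightarrow> 'n)
      \<Rightarrow> ('n \<Rightarrow> 'a) set \<Rightarrow> ('m \<Rightarrow> 'a) set"
  where "cohomology_pre k \<Lambda> A r F =
    quot_map (cocycle_group k \<Lambda> A r) (coboundaries k \<Lambda> A r) (\<lambda>f. \<lambda>\<rho>\<in>cubes k \<Lambda> r. f (F \<rho>))"

text \<open>\<open>\<psi>\<^sub>* : H\<^sup>r(\<Lambda>, A) \<rightarrow> H\<^sup>r(\<Lambda>, B)\<close> for a homomorphism \<open>\<psi> : A \<rightarrow> B\<close>\<close>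

definition cohomology_post ::
    "nat \<Rightarrow> ('o, 'm) graded_category \<Rightarrow> ('b, 'z) monoid_scheme \<Rightarrow> int \<Rightarrow> ('a \<Rightarrow> 'b)
      \<Rightarrow> ('m \<Rightarrow> 'a) set \<Rightarrow> ('m \<Rightarrow> 'b) set"
  where "cohomology_post k \<Lambda> B r \<psi> =
    quot_map (cocycle_group k \<Lambda> B r) (coboundaries k \<Lambda> B r) (\<lambda>f. \<lambda>\<rho>\<in>cubes k \<Lambda> r. \<psi> (f \<rho>))"


section \<open>The maps of the universal coefficient sequence\<close>

text \<open>\<open>\<beta>\<close> is evaluation of a cocycle on a cycle: \<open>\<beta>[f]([z]) = f(z)\<close>.\<close>

definition uct_beta ::
    "nat \<Rightarrow> ('o, 'm) graded_category \<Rightarrow> ('a, 'z) monoid_scheme \<Rightarrow> int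
      \<Rightarrow> ('m \<Rightarrow> 'a) set \<Rightarrow> ('m \<Rightarrow>\<^sub>0 int) set \<Rightarrow> 'a"
  where "uct_beta k \<Lambda> A r X =
    (\<lambda>Y\<in>carrier (homology k \<Lambda> r). the_elem ((\<lambda>(f, z). lin_ext A f z) ` (X \<times> Y)))"

text \<open>
  \<open>\<alpha>\<close>: let \<open>0 \<rightarrow> K \<rightarrow> \<int>[H] \<rightarrow> H \<rightarrow> 0\<close> be the standard resolution of \<open>H = H\<^bsub>r-1\<^esub>(\<Lambda>)\<close>.  The quotient map
  from the (free) group of \<open>(r-1)\<close>-cycles to \<open>H\<close> lifts to a homomorphism \<open>\<sigma>\<close> into \<open>\<int>[H]\<close>; this maps
  boundaries into \<open>K\<close>.  The class of \<open>g \<in> Hom(K, A)\<close> is sent to the class of the cocycle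
  \<open>g \<circ> \<sigma> \<circ> \<partial>\<^sub>r\<close>, which does not depend on the choice of the lift.  Up to the comparison isomorphism
  of free resolutions of \<open>H\<close>, this is precomposition with \<open>\<partial>\<^sub>r\<close> on homomorphisms defined on
  boundaries.
\<close>

definition uct_lift ::
    "nat \<Rightarrow> ('o, 'm) graded_category \<Rightarrow> int \<Rightarrow> ('m \<Rightarrow>\<^sub>0 int) \<Rightarrow> (('m \<Rightarrow>\<^sub>0 int) set \<Rightarrow>\<^sub>0 int)"
  where "uct_lift k \<Lambda> r = (SOME \<sigma>.
    \<sigma> \<in> hom (cycle_group k \<Lambda> r) (free_Abelian_group (carrier (homology k \<Lambda> r))) \<and>
    (\<forall>z \<in> carrier (cycle_group k \<Lambda> r).
      res_aug (homology k \<Lambda> r) (\<sigma> z) = boundaries k \<Lambda> r #>\<^bsub>cycle_group k \<Lambda> r\<^esub> z))"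

definition uct_alpha ::
    "nat \<Rightarrow> ('o, 'm) graded_category \<Rightarrow> ('a, 'z) monoid_scheme \<Rightarrow> int
      \<Rightarrow> ((('m \<Rightarrow>\<^sub>0 int) set \<Rightarrow>\<^sub>0 int) \<Rightarrow> 'a) set \<Rightarrow> ('m \<Rightarrow> 'a) set"
  where "uct_alpha k \<Lambda> A r =
    quot_map (cocycle_group k \<Lambda> A r) (coboundaries k \<Lambda> A r)
      (\<lambda>g. \<lambda>\<rho>\<in>cubes k \<Lambda> r. g (uct_lift k \<Lambda> (r - 1) (bd k \<Lambda> r (frag_of \<rho>))))"

end

theory Submission
  imports Defs
begin

text \<open>
  The cubical chain complex of a \<open>k\<close>-graph consists of free abelian groups of countable rank, and the
  universal coefficient sequence is a formal consequence of this.  Two things are needed.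

  First, that it is a complex.  Index the faces of a cube by the directions \<open>i\<close> occurring in its
  degree instead of by their positions.  The factorisation property makes any two face operations
  in different directions commute (\<open>is_face_commute\<close>), while exchanging the order in which two
  directions are removed changes the sign (\<open>dir_pos_swap\<close>).  So the terms of \<open>\<partial>\<partial>\<close> cancel in pairs.

  Secondly, that \<open>\<partial>\<^sub>r : C\<^sub>r \<rightarrow> C\<^sub>r\<^sub>-\<^sub>1\<close> splits as an epimorphism onto its image.  The image is a
  subgroup of a free abelian group, hence free (\<open>subgroup_free_Abelian_group_basis\<close>), hence
  projective (\<open>epi_onto_subgroup_free_Abelian_group_splits\<close>).  If \<open>s\<close> is a section, \<open>c \<mapsto> c - s(\<partial> c)\<close> is a
  retraction of \<open>C\<^sub>r\<close> onto the cycles \<open>Z\<^sub>r\<close>, so every homomorphism \<open>Z\<^sub>r \<rightarrow> A\<close> extends to \<open>C\<^sub>r\<close>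
  (\<open>hom_cycle_group_extends\<close>).  In particular a function \<open>\<rho> \<mapsto> h(\<partial> \<rho>)\<close> is a coboundary as soon as \<open>h\<close> is
  defined on cycles.

  Write \<open>H = H\<^sub>r\<^sub>-\<^sub>1\<close> and let \<open>0 \<rightarrow> K \<rightarrow> \<int>[H] \<rightarrow> H \<rightarrow> 0\<close> be its standard resolution.  The retraction also
  gives the lift \<open>\<sigma> : Z\<^sub>r\<^sub>-\<^sub>1 \<rightarrow> \<int>[H]\<close> of the quotient map, and since \<open>\<int>[H]\<close> is free there is a lift
  \<open>\<tau> : \<int>[H] \<rightarrow> Z\<^sub>r\<^sub>-\<^sub>1\<close> in the other direction.  The two composites differ from the identities by maps
  \<open>1 - \<sigma>\<tau> : \<int>[H] \<rightarrow> K\<close> and \<open>1 - \<tau>\<sigma> : Z\<^sub>r\<^sub>-\<^sub>1 \<rightarrow> B\<^sub>r\<^sub>-\<^sub>1\<close>, and these two maps give exactness on the left and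
  in the middle:

  \<^item> If \<open>g\<sigma>\<partial> = h\<partial>\<close> with \<open>h\<close> defined on \<open>C\<^sub>r\<^sub>-\<^sub>1\<close>, then \<open>h\<tau> + g(1 - \<sigma>\<tau>)\<close> extends \<open>g\<close> from \<open>K\<close> to \<open>\<int>[H]\<close>, so
    the class of \<open>g\<close> in \<open>Ext(H, A)\<close> vanishes.  Hence \<open>\<alpha>\<close> is injective.

  \<^item> A cocycle that vanishes on \<open>Z\<^sub>r\<close> has the form \<open>q\<partial>\<close> with \<open>q\<close> defined on \<open>B\<^sub>r\<^sub>-\<^sub>1\<close>, and
    \<open>q\<partial> = (q\<tau>)\<sigma>\<partial> + q(1 - \<tau>\<sigma>)\<partial>\<close>.  The first summand is \<open>\<alpha>\<close> of the restriction of \<open>q\<tau>\<close> to \<open>K\<close>; the second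
    is a coboundary because \<open>q(1 - \<tau>\<sigma>)\<close> is defined on all cycles.  Hence \<open>ker \<beta> = im \<alpha>\<close>.

  Surjectivity of \<open>\<beta>\<close> is again the extension from cycles to chains.  Naturality is clear on
  representatives except for \<open>\<alpha>\<close> and a morphism \<open>F : \<Lambda> \<rightarrow> \<Gamma>\<close>: there the lifts for \<open>\<Lambda>\<close> and \<open>\<Gamma>\<close> are chosen
  independently, but \<open>\<sigma>\<^sub>\<Gamma> F\<^sub># - \<int>[F\<^sub>*] \<sigma>\<^sub>\<Lambda>\<close> maps cycles into \<open>K\<close>, so the two cocycles differ by a coboundary.
\<close>

section \<open>Homomorphisms on free abelian groups\<close>

lemma keys_plus_subset:
  fixes x y :: "'a \<Rightarrow>\<^sub>0 int"
  shows "Poly_Mapping.keys x \<subseteq> S \<Longrightarrow> Poly_Mapping.keys y \<subseteq> S \<Longrightarrow> Poly_Mapping.keys (x + y) \<subseteq> S"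
  using keys_add[of x y] by blast

lemma keys_minus_subset:
  fixes x y :: "'a \<Rightarrow>\<^sub>0 int"
  shows "Poly_Mapping.keys x \<subseteq> S \<Longrightarrow> Poly_Mapping.keys y \<subseteq> S \<Longrightarrow> Poly_Mapping.keys (x - y) \<subseteq> S"
  using keys_diff[of x y] by blast

lemma subgroup_comm_group:
  assumes G: "comm_group G" and H: "subgroup H G"
  shows "comm_group (G\<lparr>carrier := H\<rparr>)"
proof -
  interpret G: comm_group G by fact
  interpret K: group "G\<lparr>carrier := H\<rparr>" by (rule subgroup.subgroup_is_group[OF H G.group_axioms])
  have "H \<subseteq> carrier G" using H by (rule subgroup.subset)
  then show ?thesis by (intro K.group_comm_groupI) (auto intro: G.m_comm)
qed

lemma hom_frag_cmul:
  assumes "comm_group A" "h \<in> hom (free_Abelian_group S) A" "Poly_Mapping.keys x \<subseteq> S"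
  shows "h (frag_cmul n x) = h x [^]\<^bsub>A\<^esub> n"
proof -
  interpret A: comm_group A by fact
  interpret h: group_hom "free_Abelian_group S" A h
    using assms(2) by (simp add: group_hom_def group_hom_axioms_def A.group_axioms)
  show ?thesis
    using h.hom_int_pow[of x n] assms(3) by simp
qed

text \<open>Every homomorphism out of a free abelian group is the linear extension of its values on the
  generators.  With this one fact, identities between homomorphisms are checked on generators, and
  cochains are treated as homomorphisms on chains.\<close>

lemma hom_free_Abelian_group_eq_lin_ext:
  assumes A: "comm_group A" and h: "h \<in> hom (free_Abelian_group S) A"
    and f: "\<And>s. s \<in> S \<Longrightarrow> f s = h (frag_of s)" and x: "Poly_Mapping.keys x \<subseteq> S"
  shows "lin_ext A f x = h x"
proof -
  interpret A: comm_group A by fact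
  interpret h: group_hom "free_Abelian_group S" A h
    using h by (simp add: group_hom_def group_hom_axioms_def A.group_axioms)
  have *: "Poly_Mapping.keys (\<Sum>s\<in>K. frag_cmul (Poly_Mapping.lookup x s) (frag_of s)) \<subseteq> S \<and>
     h (\<Sum>s\<in>K. frag_cmul (Poly_Mapping.lookup x s) (frag_of s)) =
     finprod A (\<lambda>s. f s [^]\<^bsub>A\<^esub> Poly_Mapping.lookup x s) K" if "finite K" "K \<subseteq> S" for K
    using that
  proof (induction K)
    case empty
    then show ?case using h.hom_one by simp
  next
    case (insert a K)
    let ?t = "frag_cmul (Poly_Mapping.lookup x a) (frag_of a)"
    let ?u = "\<Sum>s\<in>K. frag_cmul (Poly_Mapping.lookup x s) (frag_of s)"
    have fin: "(\<lambda>s. f s [^]\<^bsub>A\<^esub> Poly_Mapping.lookup x s) \<in> insert a K \<rightarrow> carrier A"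
      using insert.prems h.hom_closed by (auto simp: f intro!: A.int_pow_closed)
    have t: "Poly_Mapping.keys ?t \<subseteq> S" using insert.prems keys_cmul by fastforce
    have u: "Poly_Mapping.keys ?u \<subseteq> S" using insert by auto
    have "h (?t + ?u) = h ?t \<otimes>\<^bsub>A\<^esub> h ?u"
      using h.hom_mult[of ?t ?u] t u by simp
    moreover have "h ?t = f a [^]\<^bsub>A\<^esub> Poly_Mapping.lookup x a"
      using insert.prems hom_frag_cmul[OF A h] by (simp add: f)
    ultimately show ?case
      using insert fin t u by (auto simp: dest!: subsetD[OF keys_add])
  qed
  have "x = (\<Sum>s\<in>Poly_Mapping.keys x. frag_cmul (Poly_Mapping.lookup x s) (frag_of s))"
    using frag_expansion[of x] by (simp add: frag_extend_def)
  then show ?thesis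
    unfolding lin_ext_def using *[OF finite_keys x] by simp
qed

lemma lin_ext_hom:
  assumes A: "comm_group A" and f: "\<And>s. s \<in> S \<Longrightarrow> f s \<in> carrier A"
  shows "lin_ext A f \<in> hom (free_Abelian_group S) A"
proof -
  obtain h where h: "h \<in> hom (free_Abelian_group S) A" "\<And>s. s \<in> S \<Longrightarrow> h (frag_of s) = f s"
    using comm_group.free_Abelian_group_universal[OF A, of f S] f by blast
  have eq: "lin_ext A f x = h x" if "Poly_Mapping.keys x \<subseteq> S" for x
    by (rule hom_free_Abelian_group_eq_lin_ext[OF A h(1) _ that]) (simp add: h(2))
  have "h x \<in> carrier A" "h (x + y) = h x \<otimes>\<^bsub>A\<^esub> h y"
    if "Poly_Mapping.keys x \<subseteq> S" "Poly_Mapping.keys y \<subseteq> S" for x y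
    using h(1) that by (auto simp: hom_def)
  then show ?thesis
    by (auto simp: hom_def eq subset_trans[OF keys_add])
qed

lemma lin_ext_frag_of:
  assumes "comm_group A" "f s \<in> carrier A"
  shows "lin_ext A f (frag_of s) = f s"
proof -
  interpret A: comm_group A by fact
  show ?thesis using assms(2) by (simp add: lin_ext_def)
qed

lemma hom_free_Abelian_group_eqI:
  assumes A: "comm_group A"
    and g: "g \<in> hom (free_Abelian_group S) A" and h: "h \<in> hom (free_Abelian_group S) A"
    and eq: "\<And>s. s \<in> S \<Longrightarrow> g (frag_of s) = h (frag_of s)" and x: "Poly_Mapping.keys x \<subseteq> S"
  shows "g x = h x"
  using hom_free_Abelian_group_eq_lin_ext[OF A g, of "\<lambda>s. g (frag_of s)", OF _ x]
    hom_free_Abelian_group_eq_lin_ext[OF A h, of "\<lambda>s. g (frag_of s)", OF _ x] eq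
  by simp

lemma frag_extend_hom:
  assumes "\<And>s. s \<in> S \<Longrightarrow> Poly_Mapping.keys (f s) \<subseteq> T"
  shows "frag_extend f \<in> hom (free_Abelian_group S) (free_Abelian_group T)"
proof (rule homI)
  fix x assume "x \<in> carrier (free_Abelian_group S)"
  then show "frag_extend f x \<in> carrier (free_Abelian_group T)"
    using assms keys_frag_extend[of f x] by fastforce
qed (simp add: frag_extend_add)

lemma hom_mult_pointwise:
  assumes "comm_group A" "f \<in> hom G A" "g \<in> hom G A"
  shows "(\<lambda>x. f x \<otimes>\<^bsub>A\<^esub> g x) \<in> hom G A"
  using comm_group.hom_group_mult assms by blast

lemma hom_inv_pointwise:
  assumes "comm_group A" "f \<in> hom G A"
  shows "(\<lambda>x. inv\<^bsub>A\<^esub> (f x)) \<in> hom G A"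
proof -
  interpret A: comm_group A by fact
  show ?thesis using assms(2) by (auto simp: hom_def Pi_iff A.inv_mult)
qed

lemma lin_ext_closed:
  assumes "comm_group A" "\<And>s. s \<in> S \<Longrightarrow> f s \<in> carrier A" "Poly_Mapping.keys x \<subseteq> S"
  shows "lin_ext A f x \<in> carrier A"
  using hom_in_carrier[OF lin_ext_hom[OF assms(1), of S f] , of x] assms(2,3) by simp

lemma free_map_hom:
  "(\<And>s. s \<in> S \<Longrightarrow> \<phi> s \<in> T) \<Longrightarrow> free_map \<phi> \<in> hom (free_Abelian_group S) (free_Abelian_group T)"
  unfolding free_map_def by (rule frag_extend_hom) simp

lemma free_map_frag_of [simp]: "free_map \<phi> (frag_of s) = frag_of (\<phi> s)"
  by (simp add: free_map_def)

lemma lin_ext_free_map: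
  assumes A: "comm_group A" and f: "\<And>t. t \<in> T \<Longrightarrow> f t \<in> carrier A"
    and \<phi>: "\<And>s. s \<in> S \<Longrightarrow> \<phi> s \<in> T" and x: "Poly_Mapping.keys x \<subseteq> S"
  shows "lin_ext A f (free_map \<phi> x) = lin_ext A (\<lambda>s. f (\<phi> s)) x"
proof -
  have "(lin_ext A f \<circ> free_map \<phi>) \<in> hom (free_Abelian_group S) A"
    using hom_compose[OF free_map_hom[of S \<phi> T] lin_ext_hom[OF A, of T f]] \<phi> f by blast
  from hom_free_Abelian_group_eqI[OF A this lin_ext_hom[OF A, of S "\<lambda>s. f (\<phi> s)"] _ x]
  show ?thesis using f \<phi> by (simp add: lin_ext_frag_of[OF A])
qed

lemma lin_ext_hom_image:
  assumes A: "comm_group A" and B: "comm_group B" and \<psi>: "\<psi> \<in> hom A B"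
    and f: "\<And>s. s \<in> S \<Longrightarrow> f s \<in> carrier A" and x: "Poly_Mapping.keys x \<subseteq> S"
  shows "\<psi> (lin_ext A f x) = lin_ext B (\<lambda>s. \<psi> (f s)) x"
proof -
  have "(\<psi> \<circ> lin_ext A f) \<in> hom (free_Abelian_group S) B"
    using hom_compose[OF lin_ext_hom[OF A, of S f] \<psi>] f by blast
  from hom_free_Abelian_group_eq_lin_ext[OF B this _ x, of "\<lambda>s. \<psi> (f s)"]
  show ?thesis using f by (simp add: lin_ext_frag_of[OF A])
qed

lemma lin_ext_cong:
  assumes "comm_group A" "\<And>s. s \<in> S \<Longrightarrow> f s = g s" "\<And>s. s \<in> S \<Longrightarrow> g s \<in> carrier A"
    and "Poly_Mapping.keys x \<subseteq> S"
  shows "lin_ext A f x = lin_ext A g x"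
  using hom_free_Abelian_group_eq_lin_ext[OF assms(1) lin_ext_hom[OF assms(1), of S g], of f x] assms
  by (simp add: lin_ext_frag_of)

lemma lin_ext_mult:
  assumes A: "comm_group A" and f: "\<And>s. s \<in> S \<Longrightarrow> f s \<in> carrier A" and g: "\<And>s. s \<in> S \<Longrightarrow> g s \<in> carrier A"
    and x: "Poly_Mapping.keys x \<subseteq> S"
  shows "lin_ext A (\<lambda>s. f s \<otimes>\<^bsub>A\<^esub> g s) x = lin_ext A f x \<otimes>\<^bsub>A\<^esub> lin_ext A g x"
  using hom_free_Abelian_group_eq_lin_ext[OF A hom_mult_pointwise[OF A lin_ext_hom[OF A, of S f] lin_ext_hom[OF A, of S g]] _ x, of "\<lambda>s. f s \<otimes>\<^bsub>A\<^esub> g s"] f g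
  by (simp add: lin_ext_frag_of[OF A])

section \<open>Subgroups of free abelian groups of countable rank\<close>

lemma subgroup_free_Abelian_group_iff:
  "subgroup B (free_Abelian_group T) \<longleftrightarrow>
     (\<forall>x\<in>B. Poly_Mapping.keys x \<subseteq> T) \<and> 0 \<in> B \<and> (\<forall>x\<in>B. \<forall>y\<in>B. x + y \<in> B) \<and> (\<forall>x\<in>B. - x \<in> B)"
  (is "_ \<longleftrightarrow> ?R")
proof
  assume B: "subgroup B (free_Abelian_group T)"
  interpret B: subgroup B "free_Abelian_group T" by fact
  have k: "Poly_Mapping.keys x \<subseteq> T" if "x \<in> B" for x
    using subsetD[OF B.subset that] by simp
  have "- x \<in> B" if "x \<in> B" for x
    using B.m_inv_closed[OF that] inv_free_Abelian_group[OF k[OF that]] by simp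
  moreover have "x + y \<in> B" if "x \<in> B" "y \<in> B" for x y
    using B.m_closed[OF that] by simp
  ultimately show ?R using k B.one_closed by simp
next
  assume R: ?R
  have "inv\<^bsub>free_Abelian_group T\<^esub> x \<in> B" if "x \<in> B" for x
    using R that inv_free_Abelian_group[of x T] by simp
  with R show "subgroup B (free_Abelian_group T)"
    by (intro subgroup.intro subsetI) simp_all
qed

lemma frag_cmul_in_subgroup:
  assumes "subgroup B (free_Abelian_group T)" "x \<in> B"
  shows "frag_cmul n x \<in> B"
proof -
  have "x \<in> carrier (free_Abelian_group T)" using assms subgroup.subset by fast
  moreover have "x [^]\<^bsub>free_Abelian_group T\<^esub> n \<in> B"
    using group.subgroup_int_pow_closed[OF group_free_Abelian_group assms] .
  ultimately show ?thesis by simp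
qed

lemma frag_extend_in_subgroup:
  assumes B: "subgroup B (free_Abelian_group T)" and u: "\<And>j. j \<in> Poly_Mapping.keys c \<Longrightarrow> u j \<in> B"
  shows "frag_extend u c \<in> B"
proof -
  have B': "0 \<in> B" "\<And>x y. x \<in> B \<Longrightarrow> y \<in> B \<Longrightarrow> x + y \<in> B"
    using B by (auto simp: subgroup_free_Abelian_group_iff)
  have "(\<Sum>i\<in>K. frag_cmul (Poly_Mapping.lookup c i) (u i)) \<in> B"
    if "finite K" "K \<subseteq> Poly_Mapping.keys c" for K
    using that by (induction K) (auto simp: B' intro!: B'(2) frag_cmul_in_subgroup[OF B] u)
  then show ?thesis by (simp add: frag_extend_def)
qed

text \<open>A nonzero element of least absolute value divides all others, by division with remainder.\<close>

lemma int_ideal_has_generator: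
  fixes I :: "int set"
  assumes "0 \<in> I" and "\<And>a b n. a \<in> I \<Longrightarrow> b \<in> I \<Longrightarrow> a - n * b \<in> I"
  shows "\<exists>d\<in>I. \<forall>a\<in>I. d dvd a"
proof (cases "\<exists>d\<in>I. d \<noteq> 0")
  case False
  then show ?thesis using assms(1) by (intro bexI[of _ 0]) auto
next
  case True
  then obtain d0 where d0: "d0 \<in> I \<and> d0 \<noteq> 0" by blast
  obtain d where d: "d \<in> I" "d \<noteq> 0" and min: "\<And>a. a \<in> I \<Longrightarrow> a \<noteq> 0 \<Longrightarrow> nat \<bar>d\<bar> \<le> nat \<bar>a\<bar>"
    using ex_has_least_nat[of "\<lambda>a. a \<in> I \<and> a \<noteq> 0" d0 "\<lambda>a. nat \<bar>a\<bar>", OF d0] by blast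
  have "d dvd a" if "a \<in> I" for a
  proof -
    have "a mod d \<in> I" using assms(2)[OF that d(1), of "a div d"] by (simp add: minus_div_mult_eq_mod)
    moreover have "\<bar>a mod d\<bar> < \<bar>d\<bar>" using d(2) by (rule abs_mod_less)
    ultimately have "a mod d = 0" using min[of "a mod d"] by (cases "a mod d = 0") auto
    then show ?thesis by auto
  qed
  with d(1) show ?thesis by blast
qed

text \<open>Enumerate \<open>T\<close>.  For each \<open>t\<close>, the coefficients at \<open>t\<close> of the elements of \<open>B\<close> supported on
  the indices up to that of \<open>t\<close> form an ideal of the integers; let \<open>u t\<close> be an element whose
  coefficient generates it.  The elements \<open>u t\<close> with nonzero leading coefficient are a basis of \<open>B\<close>:
  they are independent because their leading positions are distinct, and they generate because a
  multiple of \<open>u t\<close> can always be subtracted to remove a leading term at \<open>t\<close>.\<close>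

theorem subgroup_free_Abelian_group_basis:
  fixes T :: "'a set"
  assumes T: "countable T" and B: "subgroup B (free_Abelian_group T)"
  obtains J :: "'a set" and u where "frag_extend u \<in> iso (free_Abelian_group J) ((free_Abelian_group T)\<lparr>carrier := B\<rparr>)"
proof -
  have keysB: "\<And>x. x \<in> B \<Longrightarrow> Poly_Mapping.keys x \<subseteq> T" and B0: "0 \<in> B"
    and Badd: "\<And>x y. x \<in> B \<Longrightarrow> y \<in> B \<Longrightarrow> x + y \<in> B" and Bmin: "\<And>x. x \<in> B \<Longrightarrow> - x \<in> B"
    using B by (auto simp: subgroup_free_Abelian_group_iff)
  have Bdiff: "x - y \<in> B" if "x \<in> B" "y \<in> B" for x y
    using Badd[OF that(1) Bmin[OF that(2)]] by simp
  define e where "e = to_nat_on T"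
  have e: "inj_on e T" unfolding e_def using T by (rule inj_on_to_nat_on)
  \<comment> \<open>The elements of \<open>B\<close> supported on indices at most \<open>n\<close>.\<close>
  define low where "low n = {x \<in> B. \<forall>s \<in> Poly_Mapping.keys x. e s \<le> n}" for n
  have "\<exists>x \<in> low (e t). \<forall>y \<in> low (e t). Poly_Mapping.lookup x t dvd Poly_Mapping.lookup y t" for t
  proof -
    let ?I = "(\<lambda>x. Poly_Mapping.lookup x t) ` low (e t)"
    have "\<exists>d\<in>?I. \<forall>a\<in>?I. d dvd a"
    proof (rule int_ideal_has_generator)
      show "0 \<in> ?I" using B0 by (intro image_eqI[of _ _ 0]) (auto simp: low_def)
    next
      fix a b n assume "a \<in> ?I" "b \<in> ?I"
      then obtain x y where x: "x \<in> low (e t)" "a = Poly_Mapping.lookup x t"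
        and y: "y \<in> low (e t)" "b = Poly_Mapping.lookup y t" by auto
      have "x - frag_cmul n y \<in> low (e t)"
      proof -
        have "s \<in> Poly_Mapping.keys x \<or> s \<in> Poly_Mapping.keys y"
          if "s \<in> Poly_Mapping.keys (x - frag_cmul n y)" for s
          using that keys_diff[of x "frag_cmul n y"] keys_cmul[of n y] by blast
        then show ?thesis
          using x(1) y(1) Bdiff frag_cmul_in_subgroup[OF B] unfolding low_def by blast
      qed
      moreover have "a - n * b = Poly_Mapping.lookup (x - frag_cmul n y) t"
        by (simp add: x y lookup_minus)
      ultimately show "a - n * b \<in> ?I" by blast
    qed
    then show ?thesis by blast
  qed
  then have "\<exists>u. \<forall>t. u t \<in> low (e t) \<and>
      (\<forall>y \<in> low (e t). Poly_Mapping.lookup (u t) t dvd Poly_Mapping.lookup y t)"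
    unfolding Bex_def by (rule choice[OF allI])
  then obtain u where u: "\<And>t. u t \<in> low (e t)"
    and u_dvd: "\<And>t y. y \<in> low (e t) \<Longrightarrow> Poly_Mapping.lookup (u t) t dvd Poly_Mapping.lookup y t"
    by blast
  have uB: "u t \<in> B" for t using u by (auto simp: low_def)
  \<comment> \<open>If \<open>u t\<close> has coefficient \<open>0\<close> at \<open>t\<close>, no element of \<open>B\<close> has its leading term at \<open>t\<close>.\<close>
  define J where "J = {t \<in> T. Poly_Mapping.lookup (u t) t \<noteq> 0}"
  let ?\<phi> = "frag_extend u"
  let ?B = "(free_Abelian_group T)\<lparr>carrier := B\<rparr>"
  have \<phi>_hom: "?\<phi> \<in> hom (free_Abelian_group J) ?B"
    by (rule homI) (auto simp: frag_extend_add intro: frag_extend_in_subgroup[OF B uB])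
  have ker: "c = 0" if c: "Poly_Mapping.keys c \<subseteq> J" and c0: "?\<phi> c = 0" for c
  proof (rule ccontr)
    assume "c \<noteq> 0"
    then have ne: "e ` Poly_Mapping.keys c \<noteq> {}" by simp
    have "Max (e ` Poly_Mapping.keys c) \<in> e ` Poly_Mapping.keys c" using ne by (intro Max_in) auto
    then obtain t where t: "t \<in> Poly_Mapping.keys c" and tM: "e t = Max (e ` Poly_Mapping.keys c)"
      by auto
    have other: "Poly_Mapping.lookup (u s) t = 0" if "s \<in> Poly_Mapping.keys c" "s \<noteq> t" for s
    proof (rule ccontr)
      assume "Poly_Mapping.lookup (u s) t \<noteq> 0"
      then have "e t \<le> e s" using u[of s] by (auto simp: low_def in_keys_iff)
      moreover have "e s \<le> e t" using that tM by simp
      ultimately show False using e that t c by (auto simp: J_def inj_on_def)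
    qed
    have "Poly_Mapping.lookup (?\<phi> c) t =
        (\<Sum>s\<in>Poly_Mapping.keys c. Poly_Mapping.lookup c s * Poly_Mapping.lookup (u s) t)"
      by (simp add: frag_extend_def lookup_sum)
    also have "\<dots> = (\<Sum>s\<in>{t}. Poly_Mapping.lookup c s * Poly_Mapping.lookup (u s) t)"
      by (rule sum.mono_neutral_right) (use t other in auto)
    also have "\<dots> \<noteq> 0" using t c by (auto simp: J_def in_keys_iff)
    finally show False using c0 by simp
  qed
  have inj: "inj_on ?\<phi> (carrier (free_Abelian_group J))"
  proof (rule inj_onI)
    fix c d assume cd: "c \<in> carrier (free_Abelian_group J)" "d \<in> carrier (free_Abelian_group J)"
      and eq: "?\<phi> c = ?\<phi> d"
    have "Poly_Mapping.keys (c - d) \<subseteq> J"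
      using cd keys_diff[of c d] unfolding carrier_free_Abelian_group_iff by blast
    moreover have "?\<phi> (c - d) = 0" unfolding frag_extend_diff eq by simp
    ultimately have "c - d = 0" by (rule ker)
    then show "c = d" by simp
  qed
  have surj: "\<exists>c. Poly_Mapping.keys c \<subseteq> J \<and> ?\<phi> c = y"
    if "y \<in> B" "\<And>s. s \<in> Poly_Mapping.keys y \<Longrightarrow> e s < n" for y n
    using that
  proof (induction n arbitrary: y)
    case 0
    then have "y = 0" by (simp flip: keys_eq_empty) blast
    then show ?case by (intro exI[of _ 0]) simp
  next
    case (Suc n)
    show ?case
    proof (cases "\<exists>t \<in> Poly_Mapping.keys y. e t = n")
      case False
      then have "e s < n" if "s \<in> Poly_Mapping.keys y" for s
        using Suc.prems(2)[OF that] that by (auto simp: less_Suc_eq)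
      then show ?thesis using Suc.IH[OF Suc.prems(1)] by blast
    next
      case True
      then obtain t where t: "t \<in> Poly_Mapping.keys y" "e t = n" by blast
      have tT: "t \<in> T" using t keysB[OF Suc.prems(1)] by auto
      have "y \<in> low (e t)" using Suc.prems t by (auto simp: low_def less_Suc_eq_le)
      then obtain q where q: "Poly_Mapping.lookup y t = Poly_Mapping.lookup (u t) t * q"
        using u_dvd by (meson dvdE)
      have tJ: "t \<in> J" using q t tT by (auto simp: J_def in_keys_iff)
      let ?z = "y - frag_cmul q (u t)"
      have "?z \<in> B" using Suc.prems uB by (auto intro: Bdiff frag_cmul_in_subgroup[OF B])
      moreover have "e s < n" if s: "s \<in> Poly_Mapping.keys ?z" for s
      proof -
        have sT: "s \<in> T" using s keysB[OF \<open>?z \<in> B\<close>] by auto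
        have "s \<noteq> t" using s q by (auto simp: in_keys_iff lookup_minus)
        then have "e s \<noteq> n" using t sT tT e by (auto simp: inj_on_def)
        moreover have "e s \<le> n"
        proof -
          have "s \<in> Poly_Mapping.keys y \<or> s \<in> Poly_Mapping.keys (u t)"
            using s keys_diff[of y "frag_cmul q (u t)"] keys_cmul[of q "u t"] by blast
          then show ?thesis using Suc.prems(2) u[of t] t(2) by (auto simp: low_def less_Suc_eq_le)
        qed
        ultimately show ?thesis by simp
      qed
      ultimately obtain c where c: "Poly_Mapping.keys c \<subseteq> J" "?\<phi> c = ?z"
        using Suc.IH by blast
      have "Poly_Mapping.keys (c + frag_cmul q (frag_of t)) \<subseteq> J"
        using c(1) tJ keys_add[of c "frag_cmul q (frag_of t)"] keys_cmul[of q "frag_of t"]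
        unfolding keys_frag_of by blast
      moreover have "?\<phi> (c + frag_cmul q (frag_of t)) = y"
        by (simp add: frag_extend_add frag_extend_cmul c)
      ultimately show ?thesis by blast
    qed
  qed
  have "?\<phi> ` carrier (free_Abelian_group J) = B"
  proof
    show "?\<phi> ` carrier (free_Abelian_group J) \<subseteq> B" using frag_extend_in_subgroup[OF B uB] by auto
    show "B \<subseteq> ?\<phi> ` carrier (free_Abelian_group J)"
    proof
      fix y assume y: "y \<in> B"
      have "e s < Suc (Max (e ` Poly_Mapping.keys y))" if "s \<in> Poly_Mapping.keys y" for s
        using that by (simp add: less_Suc_eq_le)
      from surj[OF y this] obtain c where "Poly_Mapping.keys c \<subseteq> J" "?\<phi> c = y" by blast
      then show "y \<in> ?\<phi> ` carrier (free_Abelian_group J)"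
        unfolding image_iff Bex_def carrier_free_Abelian_group_iff by blast
    qed
  qed
  then have "?\<phi> \<in> iso (free_Abelian_group J) ?B"
    using \<phi>_hom inj by (simp add: iso_def bij_betw_def)
  then show thesis by (rule that)
qed

text \<open>Free abelian groups are projective: a section is determined by arbitrary preimages of the
  basis elements.\<close>

theorem epi_onto_subgroup_free_Abelian_group_splits:
  fixes T :: "'t set"
  assumes T: "countable T" and B: "subgroup B (free_Abelian_group T)"
    and G: "comm_group G" and p: "p \<in> epi G ((free_Abelian_group T)\<lparr>carrier := B\<rparr>)"
  obtains s where "s \<in> hom ((free_Abelian_group T)\<lparr>carrier := B\<rparr>) G" "\<And>b. b \<in> B \<Longrightarrow> p (s b) = b"
proof -
  let ?B = "(free_Abelian_group T)\<lparr>carrier := B\<rparr>"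
  obtain J :: "'t set" and u where iso: "frag_extend u \<in> iso (free_Abelian_group J) ?B"
    using subgroup_free_Abelian_group_basis[OF T B] by blast
  let ?\<phi> = "frag_extend u"
  have cB: "comm_group ?B"
    by (rule subgroup_comm_group[OF abelian_free_Abelian_group B])
  have \<phi>: "?\<phi> \<in> hom (free_Abelian_group J) ?B"
    and bij: "bij_betw ?\<phi> (carrier (free_Abelian_group J)) B"
    using iso by (auto simp: iso_def)
  have "u j \<in> B" if "j \<in> J" for j
    using hom_in_carrier[OF \<phi>, of "frag_of j"] that by simp
  then have "\<exists>x \<in> carrier G. p x = u j" if "j \<in> J" for j
    using p that unfolding epi_def by fastforce
  then obtain g where g: "\<And>j. j \<in> J \<Longrightarrow> g j \<in> carrier G" "\<And>j. j \<in> J \<Longrightarrow> p (g j) = u j"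
    by metis
  let ?h = "lin_ext G g"
  have h: "?h \<in> hom (free_Abelian_group J) G" using lin_ext_hom[OF G, of J g] g by blast
  have ph: "p (?h c) = ?\<phi> c" if "Poly_Mapping.keys c \<subseteq> J" for c
  proof -
    have "(p \<circ> ?h) c = ?\<phi> c"
    proof (rule hom_free_Abelian_group_eqI[OF cB _ \<phi> _ that])
      show "p \<circ> ?h \<in> hom (free_Abelian_group J) ?B"
        using p h by (auto simp: epi_def intro: hom_compose)
    qed (simp add: lin_ext_frag_of[OF G] g)
    then show ?thesis by simp
  qed
  define \<psi> where "\<psi> = inv_into (carrier (free_Abelian_group J)) ?\<phi>"
  have \<psi>: "\<psi> \<in> hom ?B (free_Abelian_group J)"
    using group.iso_set_sym[OF group_free_Abelian_group iso] by (simp add: \<psi>_def iso_def)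
  have "?h \<circ> \<psi> \<in> hom ?B G" using hom_compose[OF \<psi> h] .
  moreover have "p ((?h \<circ> \<psi>) b) = b" if "b \<in> B" for b
  proof -
    have "\<psi> b \<in> carrier (free_Abelian_group J)" using hom_in_carrier[OF \<psi>, of b] that by simp
    then show ?thesis
      using ph[of "\<psi> b"] that bij by (simp add: \<psi>_def bij_betw_def f_inv_into_f)
  qed
  ultimately show thesis by (rule that)
qed

section \<open>Quotients, groups of homomorphisms, and Ext\<close>

lemma r_coset_eqI:
  assumes "group G" "subgroup N G" "c \<in> N" "x \<in> carrier G"
  shows "N #>\<^bsub>G\<^esub> (c \<otimes>\<^bsub>G\<^esub> x) = N #>\<^bsub>G\<^esub> x"
  using group.repr_independence[OF assms(1), of "c \<otimes>\<^bsub>G\<^esub> x" N x] assms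
  by (auto simp: r_coset_def)

lemma r_coset_eq_subgroup_iff:
  assumes "group G" "subgroup N G" "x \<in> carrier G"
  shows "N #>\<^bsub>G\<^esub> x = N \<longleftrightarrow> x \<in> N"
  using assms group.coset_join1 group.coset_join2 by (metis subgroup.subset)

lemma the_elem_image_r_coset:
  assumes "group G" "subgroup N G" "x \<in> carrier G" and "\<And>n. n \<in> N \<Longrightarrow> h (n \<otimes>\<^bsub>G\<^esub> x) = h x"
  shows "the_elem (h ` (N #>\<^bsub>G\<^esub> x)) = h x"
proof -
  have "h ` (N #>\<^bsub>G\<^esub> x) = {h x}"
    using assms(4) group.rcos_self[OF assms(1,3,2)] by (auto simp: r_coset_def)
  then show ?thesis by simp
qed

text \<open>The image of a coset under \<open>x \<mapsto> N #> f x\<close> is a singleton because \<open>f\<close> maps \<open>M\<close> into \<open>N\<close>.  All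
  induced maps on homology, cohomology and \<open>Ext\<close> are computed on representatives by this rule.\<close>

lemma quot_map_r_coset:
  assumes G: "group G" and H: "group H" and M: "subgroup M G" and N: "subgroup N H"
    and f: "f \<in> hom G H" and fM: "\<And>m. m \<in> M \<Longrightarrow> f m \<in> N" and x: "x \<in> carrier G"
  shows "quot_map H N f (M #>\<^bsub>G\<^esub> x) = N #>\<^bsub>H\<^esub> f x"
  unfolding quot_map_def
proof (rule the_elem_image_r_coset[OF G M x])
  fix m assume m: "m \<in> M"
  then have "f (m \<otimes>\<^bsub>G\<^esub> x) = f m \<otimes>\<^bsub>H\<^esub> f x"
    using hom_mult[OF f _ x] subgroup.subset[OF M] by blast
  then show "N #>\<^bsub>H\<^esub> f (m \<otimes>\<^bsub>G\<^esub> x) = N #>\<^bsub>H\<^esub> f x"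
    using r_coset_eqI[OF H N fM[OF m] hom_in_carrier[OF f x]] by simp
qed

lemma quot_map_hom:
  assumes G: "comm_group G" and H: "comm_group H" and M: "subgroup M G" and N: "subgroup N H"
    and f: "f \<in> hom G H" and fM: "\<And>m. m \<in> M \<Longrightarrow> f m \<in> N"
  shows "quot_map H N f \<in> hom (G Mod M) (H Mod N)"
proof -
  interpret G: comm_group G by fact
  interpret H: comm_group H by fact
  interpret M: normal M G using G.subgroup_imp_normal[OF M] .
  interpret N: normal N H using H.subgroup_imp_normal[OF N] .
  note q = quot_map_r_coset[OF G.group_axioms H.group_axioms M N f fM]
  show ?thesis
  proof (rule homI)
    fix X assume "X \<in> carrier (G Mod M)"
    then obtain x where x: "x \<in> carrier G" "X = M #>\<^bsub>G\<^esub> x" by (auto simp: carrier_FactGroup)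
    then show "quot_map H N f X \<in> carrier (H Mod N)"
      using hom_in_carrier[OF f x(1)] by (auto simp: q carrier_FactGroup)
  next
    fix X Y assume "X \<in> carrier (G Mod M)" "Y \<in> carrier (G Mod M)"
    then obtain x y where x: "x \<in> carrier G" "X = M #>\<^bsub>G\<^esub> x" and y: "y \<in> carrier G" "Y = M #>\<^bsub>G\<^esub> y"
      by (auto simp: carrier_FactGroup)
    then have "X \<otimes>\<^bsub>G Mod M\<^esub> Y = M #>\<^bsub>G\<^esub> (x \<otimes>\<^bsub>G\<^esub> y)" by (simp add: M.rcos_sum)
    then show "quot_map H N f (X \<otimes>\<^bsub>G Mod M\<^esub> Y) = quot_map H N f X \<otimes>\<^bsub>H Mod N\<^esub> quot_map H N f Y"
      using x y hom_in_carrier[OF f x(1)] hom_in_carrier[OF f y(1)]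
      by (simp add: q N.rcos_sum hom_mult[OF f])
  qed
qed

lemma carrier_hom_group [simp]: "carrier (hom_group G A) = hom G A \<inter> extensional (carrier G)"
  by (simp add: hom_group_def)

lemma mult_hom_group [simp]: "f \<otimes>\<^bsub>hom_group G A\<^esub> g = (\<lambda>x\<in>carrier G. f x \<otimes>\<^bsub>A\<^esub> g x)"
  by (simp add: hom_group_def)

lemma one_hom_group [simp]: "\<one>\<^bsub>hom_group G A\<^esub> = (\<lambda>x\<in>carrier G. \<one>\<^bsub>A\<^esub>)"
  by (simp add: hom_group_def)

lemma restrict_hom:
  assumes "group G" "h \<in> hom G A" shows "restrict h (carrier G) \<in> hom G A"
  using assms by (auto simp: hom_def Pi_iff group.is_monoid monoid.m_closed)

lemma comm_group_hom_group:
  assumes G: "group G" and A: "comm_group A"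
  shows "comm_group (hom_group G A)"
proof -
  interpret A: comm_group A by fact
  interpret G: group G by fact
  have c: "f x \<in> carrier A" if "f \<in> hom G A" "x \<in> carrier G" for f x
    using that by (rule hom_in_carrier)
  show ?thesis
  proof (rule comm_groupI)
    fix f g assume "f \<in> carrier (hom_group G A)" "g \<in> carrier (hom_group G A)"
    then show "f \<otimes>\<^bsub>hom_group G A\<^esub> g \<in> carrier (hom_group G A)"
      using restrict_hom[OF G hom_mult_pointwise[OF A, of f G g]] by simp
  next
    show "\<one>\<^bsub>hom_group G A\<^esub> \<in> carrier (hom_group G A)"
      by (auto simp: hom_def)
  next
    fix f g h
    assume "f \<in> carrier (hom_group G A)" "g \<in> carrier (hom_group G A)" "h \<in> carrier (hom_group G A)"
    then show "f \<otimes>\<^bsub>hom_group G A\<^esub> g \<otimes>\<^bsub>hom_group G A\<^esub> h = f \<otimes>\<^bsub>hom_group G A\<^esub> (g \<otimes>\<^bsub>hom_group G A\<^esub> h)"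
      by (auto simp: c A.m_assoc intro!: restrict_ext)
  next
    fix f g assume "f \<in> carrier (hom_group G A)" "g \<in> carrier (hom_group G A)"
    then show "f \<otimes>\<^bsub>hom_group G A\<^esub> g = g \<otimes>\<^bsub>hom_group G A\<^esub> f"
      by (auto simp: c A.m_comm intro!: restrict_ext)
  next
    fix f assume f: "f \<in> carrier (hom_group G A)"
    then show "\<one>\<^bsub>hom_group G A\<^esub> \<otimes>\<^bsub>hom_group G A\<^esub> f = f"
      by (auto simp: c intro!: extensionalityI[of _ "carrier G"])
    have "restrict (\<lambda>x. inv\<^bsub>A\<^esub> f x) (carrier G) \<in> carrier (hom_group G A)"
      using f restrict_hom[OF G hom_inv_pointwise[OF A, of f G]] by simp
    moreover have "restrict (\<lambda>x. inv\<^bsub>A\<^esub> f x) (carrier G) \<otimes>\<^bsub>hom_group G A\<^esub> f = \<one>\<^bsub>hom_group G A\<^esub>"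
      using f by (auto simp: c A.l_inv intro!: restrict_ext)
    ultimately show "\<exists>g\<in>carrier (hom_group G A). g \<otimes>\<^bsub>hom_group G A\<^esub> f = \<one>\<^bsub>hom_group G A\<^esub>" by blast
  qed
qed

lemma hom_post_hom:
  assumes "group G" "\<psi> \<in> hom A B"
  shows "hom_post G \<psi> \<in> hom (hom_group G A) (hom_group G B)"
proof (rule homI)
  fix f assume "f \<in> carrier (hom_group G A)"
  then show "hom_post G \<psi> f \<in> carrier (hom_group G B)"
    using restrict_hom[OF assms(1) hom_compose[OF _ assms(2), of f]] by (simp add: hom_post_def o_def)
next
  fix f g assume "f \<in> carrier (hom_group G A)" "g \<in> carrier (hom_group G A)"
  then show "hom_post G \<psi> (f \<otimes>\<^bsub>hom_group G A\<^esub> g) = hom_post G \<psi> f \<otimes>\<^bsub>hom_group G B\<^esub> hom_post G \<psi> g"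
    by (auto simp: hom_post_def hom_mult[OF assms(2)] hom_in_carrier intro!: restrict_ext)
qed

lemma hom_pre_hom:
  assumes "group G" "\<phi> \<in> hom G H"
  shows "hom_pre G \<phi> \<in> hom (hom_group H A) (hom_group G A)"
proof (rule homI)
  fix f assume "f \<in> carrier (hom_group H A)"
  then show "hom_pre G \<phi> f \<in> carrier (hom_group G A)"
    using restrict_hom[OF assms(1) hom_compose[OF assms(2), of f A]] by (simp add: hom_pre_def o_def)
next
  fix f g assume "f \<in> carrier (hom_group H A)" "g \<in> carrier (hom_group H A)"
  then show "hom_pre G \<phi> (f \<otimes>\<^bsub>hom_group H A\<^esub> g) = hom_pre G \<phi> f \<otimes>\<^bsub>hom_group G A\<^esub> hom_pre G \<phi> g"
    by (auto simp: hom_pre_def hom_in_carrier[OF assms(2)] intro!: restrict_ext)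
qed

lemma comm_group_product_group:
  assumes "\<And>i. i \<in> I \<Longrightarrow> comm_group (G i)" shows "comm_group (product_group I G)"
proof (rule group.group_comm_groupI)
  show "group (product_group I G)" using assms by (simp add: comm_group_def)
  fix f g assume "f \<in> carrier (product_group I G)" "g \<in> carrier (product_group I G)"
  then show "f \<otimes>\<^bsub>product_group I G\<^esub> g = g \<otimes>\<^bsub>product_group I G\<^esub> f"
    using assms by (auto simp: PiE_iff intro!: restrict_ext comm_monoid.m_comm comm_group.axioms)
qed

lemma res_aug_hom: "comm_group G \<Longrightarrow> res_aug G \<in> hom (free_Abelian_group (carrier G)) G"
  unfolding res_aug_def by (rule lin_ext_hom) auto

lemma res_aug_frag_of: "comm_group G \<Longrightarrow> g \<in> carrier G \<Longrightarrow> res_aug G (frag_of g) = g"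
  unfolding res_aug_def by (simp add: lin_ext_frag_of)

lemma carrier_res_ker:
  "x \<in> carrier (res_ker G) \<longleftrightarrow> Poly_Mapping.keys x \<subseteq> carrier G \<and> res_aug G x = \<one>\<^bsub>G\<^esub>"
  by (simp add: res_ker_def kernel_def)

lemma mult_res_ker [simp]: "x \<otimes>\<^bsub>res_ker G\<^esub> y = x + y"
  by (simp add: res_ker_def)

lemma one_res_ker [simp]: "\<one>\<^bsub>res_ker G\<^esub> = 0"
  by (simp add: res_ker_def)

lemma comm_group_res_ker:
  assumes G: "comm_group G" shows "comm_group (res_ker G)"
proof -
  interpret G: comm_group G by fact
  interpret h: group_hom "free_Abelian_group (carrier G)" G "res_aug G"
    using res_aug_hom[OF G] by (simp add: group_hom_def group_hom_axioms_def G.group_axioms)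
  show ?thesis
    unfolding res_ker_def by (rule subgroup_comm_group[OF abelian_free_Abelian_group h.subgroup_kernel])
qed

lemma res_aug_free_map:
  assumes G: "comm_group G" and H: "comm_group H" and \<phi>: "\<phi> \<in> hom G H"
    and x: "Poly_Mapping.keys x \<subseteq> carrier G"
  shows "res_aug H (free_map \<phi> x) = \<phi> (res_aug G x)"
  unfolding res_aug_def
  using lin_ext_free_map[OF H, of "carrier H" "\<lambda>g. g" "carrier G" \<phi> x]
    lin_ext_hom_image[OF G H \<phi>, of "carrier G" "\<lambda>g. g" x] x hom_in_carrier[OF \<phi>] by simp

lemma hom_res_kerI:
  assumes h: "h \<in> hom M (free_Abelian_group (carrier G))"
    and "\<And>x. x \<in> carrier M \<Longrightarrow> res_aug G (h x) = \<one>\<^bsub>G\<^esub>"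
  shows "h \<in> hom M (res_ker G)"
  using assms by (fastforce simp: hom_def carrier_res_ker)

lemma hom_res_ker_restrict:
  "h \<in> hom (free_Abelian_group (carrier G)) A \<Longrightarrow> h \<in> hom (res_ker G) A"
  by (auto simp: hom_def carrier_res_ker)

lemma free_map_hom_res_ker:
  assumes G: "comm_group G" and H: "comm_group H" and \<phi>: "\<phi> \<in> hom G H"
  shows "free_map \<phi> \<in> hom (res_ker G) (res_ker H)"
proof (rule hom_res_kerI)
  show "free_map \<phi> \<in> hom (res_ker G) (free_Abelian_group (carrier H))"
    using hom_in_carrier[OF \<phi>] by (intro hom_res_ker_restrict free_map_hom)
  show "res_aug H (free_map \<phi> x) = \<one>\<^bsub>H\<^esub>" if "x \<in> carrier (res_ker G)" for x
    using that G H hom_one[OF \<phi>] by (simp add: carrier_res_ker res_aug_free_map[OF G H \<phi>] comm_group_def)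
qed

text \<open>Homomorphisms that need not be normalised to be \<open>undefined\<close> outside the carrier suffice as
  extensions, which spares the restrictions in later constructions.\<close>

lemma in_ext_restr_iff:
  "f \<in> ext_restr G A \<longleftrightarrow>
     (\<exists>h \<in> hom (free_Abelian_group (carrier G)) A. f = restrict h (carrier (res_ker G)))"
  (is "_ \<longleftrightarrow> ?R")
proof
  assume "f \<in> ext_restr G A" then show ?R by (auto simp: ext_restr_def)
next
  assume ?R
  then obtain h where h: "h \<in> hom (free_Abelian_group (carrier G)) A"
    and f: "f = restrict h (carrier (res_ker G))" by blast
  have "f = restrict (restrict h (carrier (free_Abelian_group (carrier G)))) (carrier (res_ker G))"
    unfolding f by (auto simp: carrier_res_ker intro!: restrict_ext)
  then show "f \<in> ext_restr G A"
    unfolding ext_restr_def using restrict_hom[OF group_free_Abelian_group h]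
    by (intro image_eqI[where x = "restrict h (carrier (free_Abelian_group (carrier G)))"]) simp_all
qed

lemma subgroup_ext_restr:
  assumes G: "comm_group G" and A: "comm_group A"
  shows "subgroup (ext_restr G A) (hom_group (res_ker G) A)"
proof -
  interpret A: comm_group A by fact
  interpret K: comm_group "res_ker G" by (rule comm_group_res_ker[OF G])
  interpret F: comm_group "hom_group (free_Abelian_group (carrier G)) A"
    by (rule comm_group_hom_group[OF group_free_Abelian_group A])
  let ?F = "hom_group (free_Abelian_group (carrier G)) A"
  have "(\<lambda>f. restrict f (carrier (res_ker G))) \<in> hom ?F (hom_group (res_ker G) A)"
    by (rule homI) (auto simp: carrier_res_ker hom_res_ker_restrict restrict_hom[OF K.group_axioms]
        intro!: restrict_ext)
  then interpret h: group_hom ?F "hom_group (res_ker G) A" "\<lambda>f. restrict f (carrier (res_ker G))"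
    using comm_group_hom_group[OF K.group_axioms A]
    by (simp add: group_hom_def group_hom_axioms_def F.group_axioms comm_group_def)
  show ?thesis unfolding ext_restr_def by (rule h.img_is_subgroup)
qed

lemma comm_group_Ext:
  assumes G: "comm_group G" and A: "comm_group A" shows "comm_group (Ext G A)"
  unfolding Ext_def
  by (intro comm_group.abelian_FactGroup subgroup_ext_restr comm_group_hom_group assms
      comm_group.axioms(2) comm_group_res_ker)

lemma Ext_cases:
  assumes "X \<in> carrier (Ext G A)"
  obtains g where "g \<in> carrier (hom_group (res_ker G) A)" "X = ext_restr G A #>\<^bsub>hom_group (res_ker G) A\<^esub> g"
  using assms by (auto simp: Ext_def carrier_FactGroup)

lemma Ext_post_r_coset:
  assumes G: "comm_group G" and A: "comm_group A" and B: "comm_group B" and \<psi>: "\<psi> \<in> hom A B"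
    and g: "g \<in> carrier (hom_group (res_ker G) A)"
  shows "Ext_post G B \<psi> (ext_restr G A #>\<^bsub>hom_group (res_ker G) A\<^esub> g) =
         ext_restr G B #>\<^bsub>hom_group (res_ker G) B\<^esub> hom_post (res_ker G) \<psi> g"
proof -
  have K: "group (res_ker G)" using comm_group_res_ker[OF G] by (rule comm_group.axioms)
  show ?thesis
    unfolding Ext_post_def
  proof (rule quot_map_r_coset[OF _ _ _ _ _ _ g])
    fix f assume "f \<in> ext_restr G A"
    then obtain h where h: "h \<in> hom (free_Abelian_group (carrier G)) A"
      and f: "f = restrict h (carrier (res_ker G))" by (auto simp: in_ext_restr_iff)
    have "\<psi> \<circ> h \<in> hom (free_Abelian_group (carrier G)) B" using hom_compose[OF h \<psi>] .
    moreover have "hom_post (res_ker G) \<psi> f = restrict (\<psi> \<circ> h) (carrier (res_ker G))"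
      by (auto simp: hom_post_def f intro!: restrict_ext)
    ultimately show "hom_post (res_ker G) \<psi> f \<in> ext_restr G B" by (auto simp: in_ext_restr_iff)
  qed (simp_all add: comm_group.axioms comm_group_hom_group[OF K] A B subgroup_ext_restr G
      hom_post_hom[OF K \<psi>] del: carrier_hom_group)
qed

lemma Ext_pre_r_coset:
  assumes G: "comm_group G" and H: "comm_group H" and A: "comm_group A" and \<phi>: "\<phi> \<in> hom G H"
    and g: "g \<in> carrier (hom_group (res_ker H) A)"
  shows "Ext_pre G A \<phi> (ext_restr H A #>\<^bsub>hom_group (res_ker H) A\<^esub> g) =
         ext_restr G A #>\<^bsub>hom_group (res_ker G) A\<^esub> hom_pre (res_ker G) (free_map \<phi>) g"
proof -
  have K: "group (res_ker G)" "group (res_ker H)"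
    using comm_group_res_ker[OF G] comm_group_res_ker[OF H] by (auto intro: comm_group.axioms)
  note \<phi>K = free_map_hom_res_ker[OF G H \<phi>]
  show ?thesis
    unfolding Ext_pre_def
  proof (rule quot_map_r_coset[OF _ _ _ _ _ _ g])
    fix f assume "f \<in> ext_restr H A"
    then obtain h where h: "h \<in> hom (free_Abelian_group (carrier H)) A"
      and f: "f = restrict h (carrier (res_ker H))" by (auto simp: in_ext_restr_iff)
    have "h \<circ> free_map \<phi> \<in> hom (free_Abelian_group (carrier G)) A"
      using hom_compose[OF free_map_hom h] hom_in_carrier[OF \<phi>] by blast
    moreover have "hom_pre (res_ker G) (free_map \<phi>) f = restrict (h \<circ> free_map \<phi>) (carrier (res_ker G))"
      using hom_in_carrier[OF \<phi>K] by (auto simp: hom_pre_def f intro!: restrict_ext)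
    ultimately show "hom_pre (res_ker G) (free_map \<phi>) f \<in> ext_restr G A" by (auto simp: in_ext_restr_iff)
  qed (simp_all add: comm_group.axioms comm_group_hom_group K A subgroup_ext_restr G H
      hom_pre_hom[OF K(1) \<phi>K] del: carrier_hom_group)
qed

section \<open>The cubical boundary map\<close>

definition dirs :: "('o, 'm) graded_category \<Rightarrow> 'm \<Rightarrow> nat set"
  where "dirs \<Lambda> \<rho> = {i. Deg \<Lambda> \<rho> i \<noteq> 0}"

text \<open>The faces are treated as a relation between cubes and are indexed by the direction \<open>i\<close> that is
  removed, not by its position among the directions of \<open>\<rho>\<close>.  The position changes when another
  direction is removed, the direction does not, so that only in this form do the faces commute
  without a shift of indices.\<close>

definition is_face :: "('o, 'm) graded_category \<Rightarrow> nat \<Rightarrow> nat \<Rightarrow> 'm \<Rightarrow> 'm \<Rightarrow> bool"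
  where "is_face \<Lambda> l i \<mu> \<rho> \<longleftrightarrow> \<mu> \<in> Mor \<Lambda> \<and> (\<exists>\<gamma>\<in>Mor \<Lambda>. Deg \<Lambda> \<gamma> = gen i \<and>
    (if l = 0 then Src \<Lambda> \<mu> = Rng \<Lambda> \<gamma> \<and> Comp \<Lambda> \<mu> \<gamma> = \<rho> else Src \<Lambda> \<gamma> = Rng \<Lambda> \<mu> \<and> Comp \<Lambda> \<gamma> \<mu> = \<rho>))"

definition dir_face :: "('o, 'm) graded_category \<Rightarrow> nat \<Rightarrow> nat \<Rightarrow> 'm \<Rightarrow> 'm"
  where "dir_face \<Lambda> l i \<rho> = (THE \<mu>. is_face \<Lambda> l i \<mu> \<rho>)"

text \<open>The position of \<open>i\<close> in the increasing enumeration of \<open>D\<close>, counted from \<open>1\<close>.  With the side \<open>l\<close> it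
  determines the sign of the face in direction \<open>i\<close>.\<close>

definition dir_pos :: "nat set \<Rightarrow> nat \<Rightarrow> nat"
  where "dir_pos D i = card {x \<in> D. x \<le> i}"

lemma sum_fun_apply: "(\<Sum>i\<in>I. f i) x = (\<Sum>i\<in>I. f i x)"
  by (induction I rule: infinite_finite_induct) (auto simp: plus_fun_def zero_fun_def)

lemma ones_apply: "ones k i = (if i \<in> {1..k} then 1 else 0)"
  by (simp add: ones_def sum_fun_apply gen_def)

lemma (in k_graph) dirs_subset: "\<rho> \<in> Mor \<Lambda> \<Longrightarrow> dirs \<Lambda> \<rho> \<subseteq> {1..k}"
  using Deg_in[of \<rho>] by (auto simp: Nk_def dirs_def)

lemma (in k_graph) finite_dirs: "\<rho> \<in> Mor \<Lambda> \<Longrightarrow> finite (dirs \<Lambda> \<rho>)"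
  using dirs_subset finite_subset by blast

lemma (in k_graph) in_cubes_iff:
  "\<rho> \<in> cubes k \<Lambda> r \<longleftrightarrow> \<rho> \<in> Mor \<Lambda> \<and> (\<forall>i. Deg \<Lambda> \<rho> i \<le> 1) \<and> int (card (dirs \<Lambda> \<rho>)) = r"
proof -
  have "Deg \<Lambda> \<rho> \<le> ones k \<longleftrightarrow> (\<forall>i. Deg \<Lambda> \<rho> i \<le> 1)" if "\<rho> \<in> Mor \<Lambda>"
  proof -
    have "Deg \<Lambda> \<rho> i = 0" if "i \<notin> {1..k}" for i
      using dirs_subset[OF \<open>\<rho> \<in> Mor \<Lambda>\<close>] that unfolding dirs_def by blast
    then have "Deg \<Lambda> \<rho> i \<le> ones k i \<longleftrightarrow> Deg \<Lambda> \<rho> i \<le> 1" for i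
      by (simp add: ones_apply)
    then show ?thesis by (simp add: le_fun_def)
  qed
  moreover have "size_Nk k (Deg \<Lambda> \<rho>) = card (dirs \<Lambda> \<rho>)"
    if "\<rho> \<in> Mor \<Lambda>" "\<forall>i. Deg \<Lambda> \<rho> i \<le> 1"
  proof -
    have "size_Nk k (Deg \<Lambda> \<rho>) = (\<Sum>i\<in>dirs \<Lambda> \<rho>. Deg \<Lambda> \<rho> i)"
      unfolding size_Nk_def using dirs_subset[OF that(1)]
      by (intro sum.mono_neutral_right) (auto simp: dirs_def)
    also have "\<dots> = (\<Sum>i\<in>dirs \<Lambda> \<rho>. 1)"
    proof (rule sum.cong[OF refl])
      fix i assume "i \<in> dirs \<Lambda> \<rho>"
      then show "Deg \<Lambda> \<rho> i = 1" using spec[OF that(2), of i] by (simp add: dirs_def)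
    qed
    finally show ?thesis by simp
  qed
  ultimately show ?thesis by (auto simp: cubes_def)
qed

lemma (in k_graph) is_face_Deg:
  assumes "is_face \<Lambda> l i \<mu> \<rho>" shows "Deg \<Lambda> \<rho> = Deg \<Lambda> \<mu> + gen i"
  using assms by (auto simp: is_face_def Deg_Comp add.commute split: if_splits)

lemma (in k_graph) is_face_Mor: "is_face \<Lambda> l i \<mu> \<rho> \<Longrightarrow> \<rho> \<in> Mor \<Lambda>"
  by (auto simp: is_face_def Comp_in split: if_splits)

text \<open>The degree of a face is forced by that of \<open>\<rho>\<close>, so the uniqueness part of the factorisation
  property applies.\<close>

lemma (in k_graph) is_face_unique:
  assumes \<mu>: "is_face \<Lambda> l i \<mu> \<rho>" and \<nu>: "is_face \<Lambda> l i \<nu> \<rho>"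
  shows "\<mu> = \<nu>"
proof -
  have D: "Deg \<Lambda> \<nu> = Deg \<Lambda> \<mu>"
    using is_face_Deg[OF \<mu>] is_face_Deg[OF \<nu>] by (metis add_right_cancel)
  have N: "Deg \<Lambda> \<mu> \<in> Nk k" "gen i \<in> Nk k"
    using \<mu> Deg_in by (auto simp: is_face_def) (metis Deg_in)+
  show ?thesis
  proof (cases "l = 0")
    case True
    obtain \<gamma> where \<gamma>: "\<gamma> \<in> Mor \<Lambda>" "Deg \<Lambda> \<gamma> = gen i" "Src \<Lambda> \<mu> = Rng \<Lambda> \<gamma>" "Comp \<Lambda> \<mu> \<gamma> = \<rho>" "\<mu> \<in> Mor \<Lambda>"
      using \<mu> True by (auto simp: is_face_def)
    obtain \<delta> where \<delta>: "\<delta> \<in> Mor \<Lambda>" "Deg \<Lambda> \<delta> = gen i" "Src \<Lambda> \<nu> = Rng \<Lambda> \<delta>" "Comp \<Lambda> \<nu> \<delta> = \<rho>" "\<nu> \<in> Mor \<Lambda>"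
      using \<nu> True by (auto simp: is_face_def)
    have "(\<mu>, \<gamma>) = (\<nu>, \<delta>)"
      by (rule ex1E[OF factorisation[OF is_face_Mor[OF \<mu>] N is_face_Deg[OF \<mu>]]])
        (use \<gamma> \<delta> D in \<open>metis fst_conv snd_conv\<close>)
    then show ?thesis by simp
  next
    case False
    obtain \<gamma> where \<gamma>: "\<gamma> \<in> Mor \<Lambda>" "Deg \<Lambda> \<gamma> = gen i" "Src \<Lambda> \<gamma> = Rng \<Lambda> \<mu>" "Comp \<Lambda> \<gamma> \<mu> = \<rho>" "\<mu> \<in> Mor \<Lambda>"
      using \<mu> False by (auto simp: is_face_def)
    obtain \<delta> where \<delta>: "\<delta> \<in> Mor \<Lambda>" "Deg \<Lambda> \<delta> = gen i" "Src \<Lambda> \<delta> = Rng \<Lambda> \<nu>" "Comp \<Lambda> \<delta> \<nu> = \<rho>" "\<nu> \<in> Mor \<Lambda>"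
      using \<nu> False by (auto simp: is_face_def)
    have "Deg \<Lambda> \<rho> = gen i + Deg \<Lambda> \<mu>" using is_face_Deg[OF \<mu>] by (simp add: add.commute)
    then have "(\<gamma>, \<mu>) = (\<delta>, \<nu>)"
      by (rule ex1E[OF factorisation[OF is_face_Mor[OF \<mu>] N(2,1)]])
        (use \<gamma> \<delta> D in \<open>metis fst_conv snd_conv\<close>)
    then show ?thesis by simp
  qed
qed

lemma (in k_graph) is_face_exists:
  assumes \<rho>: "\<rho> \<in> Mor \<Lambda>" and i: "i \<in> dirs \<Lambda> \<rho>"
  shows "\<exists>\<mu>. is_face \<Lambda> l i \<mu> \<rho>"
proof -
  define m where "m = (\<lambda>j. Deg \<Lambda> \<rho> j - gen i j)"
  have N: "m \<in> Nk k" "gen i \<in> Nk k"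
    using Deg_in[OF \<rho>] dirs_subset[OF \<rho>] i by (auto simp: Nk_def m_def gen_def)
  have D: "Deg \<Lambda> \<rho> = m + gen i"
    using i by (auto simp: m_def gen_def dirs_def fun_eq_iff)
  show ?thesis
  proof (cases "l = 0")
    case True
    from ex1_implies_ex[OF factorisation[OF \<rho> N D]] show ?thesis
      using True by (auto simp: is_face_def)
  next
    case False
    have "Deg \<Lambda> \<rho> = gen i + m" using D by (simp add: add.commute)
    from ex1_implies_ex[OF factorisation[OF \<rho> N(2,1) this]] show ?thesis
      using False by (auto simp: is_face_def)
  qed
qed

lemma (in k_graph) is_face_dir_face:
  assumes "\<rho> \<in> Mor \<Lambda>" and "i \<in> dirs \<Lambda> \<rho>"
  shows "is_face \<Lambda> l i (dir_face \<Lambda> l i \<rho>) \<rho>"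
  unfolding dir_face_def using is_face_exists[OF assms] is_face_unique by (metis (no_types, lifting) theI)

lemma (in k_graph) dir_face_eqI: "is_face \<Lambda> l i \<mu> \<rho> \<Longrightarrow> dir_face \<Lambda> l i \<rho> = \<mu>"
  unfolding dir_face_def using is_face_unique by blast

lemma (in k_graph) is_face_cubes:
  assumes \<rho>: "\<rho> \<in> cubes k \<Lambda> r" and \<mu>: "is_face \<Lambda> l i \<mu> \<rho>"
  shows "\<mu> \<in> cubes k \<Lambda> (r - 1)" and "i \<in> dirs \<Lambda> \<rho>" and "dirs \<Lambda> \<mu> = dirs \<Lambda> \<rho> - {i}"
proof -
  have D: "Deg \<Lambda> \<rho> j = Deg \<Lambda> \<mu> j + gen i j" for j using is_face_Deg[OF \<mu>] by simp
  have le: "Deg \<Lambda> \<rho> j \<le> 1" for j using \<rho> by (simp add: in_cubes_iff)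
  show i: "i \<in> dirs \<Lambda> \<rho>" by (simp add: dirs_def D gen_def)
  have "Deg \<Lambda> \<mu> i = 0" using D[of i] le[of i] by (simp add: gen_def)
  then show eq: "dirs \<Lambda> \<mu> = dirs \<Lambda> \<rho> - {i}" by (auto simp: dirs_def D gen_def)
  have "Deg \<Lambda> \<mu> j \<le> 1" for j using D[of j] le[of j] by simp
  moreover have "int (card (dirs \<Lambda> \<mu>)) = r - 1"
    using \<rho> i finite_dirs[of \<rho>] card_Suc_Diff1[of "dirs \<Lambda> \<rho>" i] by (simp add: eq in_cubes_iff)
  ultimately show "\<mu> \<in> cubes k \<Lambda> (r - 1)" using \<mu> by (simp add: in_cubes_iff is_face_def)
qed

lemma (in k_graph) dir_face_in_cubes:
  assumes "\<rho> \<in> cubes k \<Lambda> r" "i \<in> dirs \<Lambda> \<rho>"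
  shows "dir_face \<Lambda> l i \<rho> \<in> cubes k \<Lambda> (r - 1)" and "dirs \<Lambda> (dir_face \<Lambda> l i \<rho>) = dirs \<Lambda> \<rho> - {i}"
  using is_face_cubes[OF assms(1) is_face_dir_face] assms by (auto simp: in_cubes_iff)

lemma (in k_graph) swap_factors:
  assumes "\<gamma> \<in> Mor \<Lambda>" "\<delta> \<in> Mor \<Lambda>" "Src \<Lambda> \<gamma> = Rng \<Lambda> \<delta>"
  obtains \<delta>' \<gamma>' where "\<delta>' \<in> Mor \<Lambda>" "\<gamma>' \<in> Mor \<Lambda>" "Src \<Lambda> \<delta>' = Rng \<Lambda> \<gamma>'"
    "Deg \<Lambda> \<delta>' = Deg \<Lambda> \<delta>" "Deg \<Lambda> \<gamma>' = Deg \<Lambda> \<gamma>" "Comp \<Lambda> \<gamma> \<delta> = Comp \<Lambda> \<delta>' \<gamma>'"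
    "Rng \<Lambda> \<delta>' = Rng \<Lambda> \<gamma>" "Src \<Lambda> \<gamma>' = Src \<Lambda> \<delta>"
proof -
  have c: "Comp \<Lambda> \<gamma> \<delta> \<in> Mor \<Lambda>" using assms by (rule Comp_in)
  have "Deg \<Lambda> (Comp \<Lambda> \<gamma> \<delta>) = Deg \<Lambda> \<delta> + Deg \<Lambda> \<gamma>" using assms by (simp add: Deg_Comp add.commute)
  from ex1_implies_ex[OF factorisation[OF c Deg_in[OF assms(2)] Deg_in[OF assms(1)] this]]
  obtain \<delta>' \<gamma>' where 1: "\<delta>' \<in> Mor \<Lambda>" "\<gamma>' \<in> Mor \<Lambda>" "Src \<Lambda> \<delta>' = Rng \<Lambda> \<gamma>'"
    "Deg \<Lambda> \<delta>' = Deg \<Lambda> \<delta>" "Deg \<Lambda> \<gamma>' = Deg \<Lambda> \<gamma>" "Comp \<Lambda> \<gamma> \<delta> = Comp \<Lambda> \<delta>' \<gamma>'" by auto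
  have "Rng \<Lambda> \<delta>' = Rng \<Lambda> \<gamma>" using Rng_Comp[OF 1(1-3)] Rng_Comp[OF assms] 1(6) by simp
  moreover have "Src \<Lambda> \<gamma>' = Src \<Lambda> \<delta>" using Src_Comp[OF 1(1-3)] Src_Comp[OF assms] 1(6) by simp
  ultimately show thesis using that 1 by blast
qed

text \<open>Two faces on opposite sides commute by associativity.  For two faces on the same side, the
  two edges that are split off form a path \<open>\<gamma>\<delta>\<close>, which is refactored with the degrees in the other
  order.\<close>

lemma (in k_graph) is_face_commute:
  assumes \<mu>: "is_face \<Lambda> l i \<mu> \<rho>" and \<nu>: "is_face \<Lambda> l' i' \<nu> \<mu>"
  obtains \<mu>' where "is_face \<Lambda> l' i' \<mu>' \<rho>" "is_face \<Lambda> l i \<nu> \<mu>'"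
proof -
  obtain \<gamma> where \<gamma>: "\<gamma> \<in> Mor \<Lambda>" "Deg \<Lambda> \<gamma> = gen i" "\<mu> \<in> Mor \<Lambda>"
    and \<gamma>0: "l = 0 \<Longrightarrow> Src \<Lambda> \<mu> = Rng \<Lambda> \<gamma> \<and> Comp \<Lambda> \<mu> \<gamma> = \<rho>"
    and \<gamma>1: "l \<noteq> 0 \<Longrightarrow> Src \<Lambda> \<gamma> = Rng \<Lambda> \<mu> \<and> Comp \<Lambda> \<gamma> \<mu> = \<rho>"
    using \<mu> unfolding is_face_def by metis
  obtain \<delta> where \<delta>: "\<delta> \<in> Mor \<Lambda>" "Deg \<Lambda> \<delta> = gen i'" "\<nu> \<in> Mor \<Lambda>"
    and \<delta>0: "l' = 0 \<Longrightarrow> Src \<Lambda> \<nu> = Rng \<Lambda> \<delta> \<and> Comp \<Lambda> \<nu> \<delta> = \<mu>"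
    and \<delta>1: "l' \<noteq> 0 \<Longrightarrow> Src \<Lambda> \<delta> = Rng \<Lambda> \<nu> \<and> Comp \<Lambda> \<delta> \<nu> = \<mu>"
    using \<nu> unfolding is_face_def by metis
  consider "l = 0" "l' = 0" | "l = 0" "l' \<noteq> 0" | "l \<noteq> 0" "l' = 0" | "l \<noteq> 0" "l' \<noteq> 0" by blast
  then show thesis
  proof cases
    case 1
    have S: "Src \<Lambda> \<nu> = Rng \<Lambda> \<delta>" "Src \<Lambda> \<delta> = Rng \<Lambda> \<gamma>" and \<rho>: "\<rho> = Comp \<Lambda> \<nu> (Comp \<Lambda> \<delta> \<gamma>)"
      using 1 \<gamma>0 \<delta>0 \<gamma> \<delta> Src_Comp[of \<nu> \<delta>] Comp_assoc[of \<nu> \<delta> \<gamma>] by auto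
    obtain \<gamma>' \<delta>' where r: "\<gamma>' \<in> Mor \<Lambda>" "\<delta>' \<in> Mor \<Lambda>" "Src \<Lambda> \<gamma>' = Rng \<Lambda> \<delta>'"
        "Deg \<Lambda> \<gamma>' = Deg \<Lambda> \<gamma>" "Deg \<Lambda> \<delta>' = Deg \<Lambda> \<delta>" "Comp \<Lambda> \<delta> \<gamma> = Comp \<Lambda> \<gamma>' \<delta>'"
        "Rng \<Lambda> \<gamma>' = Rng \<Lambda> \<delta>" "Src \<Lambda> \<delta>' = Src \<Lambda> \<gamma>"
      by (rule swap_factors[OF \<delta>(1) \<gamma>(1) S(2)])
    have S': "Src \<Lambda> \<nu> = Rng \<Lambda> \<gamma>'" using S r by simp
    have "is_face \<Lambda> l' i' (Comp \<Lambda> \<nu> \<gamma>') \<rho>" "is_face \<Lambda> l i \<nu> (Comp \<Lambda> \<nu> \<gamma>')"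
      unfolding is_face_def using 1 r \<gamma> \<delta> S' Comp_in[OF \<delta>(3) r(1) S'] Src_Comp[OF \<delta>(3) r(1) S']
        Comp_assoc[OF \<delta>(3) r(1,2) S' r(3)] \<rho> by auto
    then show ?thesis by (rule that)
  next
    case 2
    have S: "Src \<Lambda> \<delta> = Rng \<Lambda> \<nu>" "Src \<Lambda> \<nu> = Rng \<Lambda> \<gamma>" and \<rho>: "\<rho> = Comp \<Lambda> \<delta> (Comp \<Lambda> \<nu> \<gamma>)"
      using 2 \<gamma>0 \<delta>1 \<gamma> \<delta> Src_Comp[of \<delta> \<nu>] Comp_assoc[of \<delta> \<nu> \<gamma>] by auto
    have "is_face \<Lambda> l' i' (Comp \<Lambda> \<nu> \<gamma>) \<rho>" "is_face \<Lambda> l i \<nu> (Comp \<Lambda> \<nu> \<gamma>)"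
      unfolding is_face_def using 2 \<gamma> \<delta> S \<rho> Comp_in[OF \<delta>(3) \<gamma>(1) S(2)] Rng_Comp[OF \<delta>(3) \<gamma>(1) S(2)]
      by auto
    then show ?thesis by (rule that)
  next
    case 3
    have S: "Src \<Lambda> \<gamma> = Rng \<Lambda> \<nu>" "Src \<Lambda> \<nu> = Rng \<Lambda> \<delta>" and \<rho>: "\<rho> = Comp \<Lambda> (Comp \<Lambda> \<gamma> \<nu>) \<delta>"
      using 3 \<gamma>1 \<delta>0 \<gamma> \<delta> Rng_Comp[of \<nu> \<delta>] Comp_assoc[of \<gamma> \<nu> \<delta>] by auto
    have "is_face \<Lambda> l' i' (Comp \<Lambda> \<gamma> \<nu>) \<rho>" "is_face \<Lambda> l i \<nu> (Comp \<Lambda> \<gamma> \<nu>)"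
      unfolding is_face_def using 3 \<gamma> \<delta> S \<rho> Comp_in[OF \<gamma>(1) \<delta>(3) S(1)] Src_Comp[OF \<gamma>(1) \<delta>(3) S(1)]
      by auto
    then show ?thesis by (rule that)
  next
    case 4
    have S: "Src \<Lambda> \<gamma> = Rng \<Lambda> \<delta>" "Src \<Lambda> \<delta> = Rng \<Lambda> \<nu>" and \<rho>: "\<rho> = Comp \<Lambda> (Comp \<Lambda> \<gamma> \<delta>) \<nu>"
      using 4 \<gamma>1 \<delta>1 \<gamma> \<delta> Rng_Comp[of \<delta> \<nu>] Comp_assoc[of \<gamma> \<delta> \<nu>] by auto
    obtain \<delta>' \<gamma>' where r: "\<delta>' \<in> Mor \<Lambda>" "\<gamma>' \<in> Mor \<Lambda>" "Src \<Lambda> \<delta>' = Rng \<Lambda> \<gamma>'"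
        "Deg \<Lambda> \<delta>' = Deg \<Lambda> \<delta>" "Deg \<Lambda> \<gamma>' = Deg \<Lambda> \<gamma>" "Comp \<Lambda> \<gamma> \<delta> = Comp \<Lambda> \<delta>' \<gamma>'"
        "Rng \<Lambda> \<delta>' = Rng \<Lambda> \<gamma>" "Src \<Lambda> \<gamma>' = Src \<Lambda> \<delta>"
      by (rule swap_factors[OF \<gamma>(1) \<delta>(1) S(1)])
    have S': "Src \<Lambda> \<gamma>' = Rng \<Lambda> \<nu>" using S r by simp
    have "is_face \<Lambda> l' i' (Comp \<Lambda> \<gamma>' \<nu>) \<rho>" "is_face \<Lambda> l i \<nu> (Comp \<Lambda> \<gamma>' \<nu>)"
      unfolding is_face_def using 4 r \<gamma> \<delta> S' Comp_in[OF r(2) \<delta>(3) S'] Rng_Comp[OF r(2) \<delta>(3) S']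
        Comp_assoc[OF r(1,2) \<delta>(3) r(3) S'] \<rho> by auto
    then show ?thesis by (rule that)
  qed
qed

lemma (in k_graph) dir_face_commute:
  assumes "\<rho> \<in> Mor \<Lambda>" "i \<in> dirs \<Lambda> \<rho>" "i' \<in> dirs \<Lambda> (dir_face \<Lambda> l i \<rho>)"
  shows "dir_face \<Lambda> l' i' (dir_face \<Lambda> l i \<rho>) = dir_face \<Lambda> l i (dir_face \<Lambda> l' i' \<rho>)"
proof -
  have 1: "is_face \<Lambda> l i (dir_face \<Lambda> l i \<rho>) \<rho>" using assms by (intro is_face_dir_face)
  have 2: "is_face \<Lambda> l' i' (dir_face \<Lambda> l' i' (dir_face \<Lambda> l i \<rho>)) (dir_face \<Lambda> l i \<rho>)"
    using 1 assms by (intro is_face_dir_face) (auto simp: is_face_def)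
  obtain \<mu>' where "is_face \<Lambda> l' i' \<mu>' \<rho>" "is_face \<Lambda> l i (dir_face \<Lambda> l' i' (dir_face \<Lambda> l i \<rho>)) \<mu>'"
    by (rule is_face_commute[OF 1 2])
  then show ?thesis by (simp add: dir_face_eqI)
qed

lemma (in k_graph) face_eq_dir_face:
  assumes \<rho>: "\<rho> \<in> cubes k \<Lambda> r"
  shows "face k \<Lambda> r l j \<rho> = dir_face \<Lambda> l (cube_dir \<Lambda> \<rho> j) \<rho>"
proof -
  have "is_face \<Lambda> l i \<mu> \<rho> \<longleftrightarrow> \<mu> \<in> cubes k \<Lambda> (r - 1) \<and> (\<exists>\<gamma>\<in>Mor \<Lambda>. Deg \<Lambda> \<gamma> = gen i \<and>
      (if l = 0 then Src \<Lambda> \<mu> = Rng \<Lambda> \<gamma> \<and> Comp \<Lambda> \<mu> \<gamma> = \<rho> else Src \<Lambda> \<gamma> = Rng \<Lambda> \<mu> \<and> Comp \<Lambda> \<gamma> \<mu> = \<rho>))"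
    for \<mu> i
    using is_face_cubes(1)[OF \<rho>, of l i \<mu>] unfolding is_face_def in_cubes_iff by blast
  then show ?thesis
    unfolding face_def face0_def face1_def dir_face_def by simp
qed

lemma bij_betw_cube_dir:
  assumes "finite (dirs \<Lambda> \<rho>)"
  shows "bij_betw (cube_dir \<Lambda> \<rho>) {1..card (dirs \<Lambda> \<rho>)} (dirs \<Lambda> \<rho>)"
proof -
  let ?xs = "sorted_list_of_set (dirs \<Lambda> \<rho>)"
  have "bij_betw ((!) ?xs) {..<card (dirs \<Lambda> \<rho>)} (dirs \<Lambda> \<rho>)"
    using assms by (intro bij_betw_nth) auto
  moreover have "bij_betw (\<lambda>j. j - 1) {1..card (dirs \<Lambda> \<rho>)} {..<card (dirs \<Lambda> \<rho>)}"
    by (rule bij_betw_byWitness[of _ Suc]) auto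
  ultimately show ?thesis
    unfolding cube_dir_def dirs_def[symmetric] using bij_betw_trans by (fastforce simp: o_def)
qed

lemma dir_pos_cube_dir:
  assumes fin: "finite (dirs \<Lambda> \<rho>)" and j: "j \<in> {1..card (dirs \<Lambda> \<rho>)}"
  shows "dir_pos (dirs \<Lambda> \<rho>) (cube_dir \<Lambda> \<rho> j) = j"
proof -
  let ?D = "dirs \<Lambda> \<rho>" let ?xs = "sorted_list_of_set ?D"
  have xs: "set ?xs = ?D" "distinct ?xs" "sorted ?xs" "length ?xs = card ?D" using fin by auto
  have jl: "j - 1 < length ?xs" unfolding xs(4) using j by auto
  have "{x \<in> ?D. x \<le> ?xs ! (j - 1)} = (!) ?xs ` {..<j}"
  proof (intro equalityI subsetI)
    fix x assume x: "x \<in> {x \<in> ?D. x \<le> ?xs ! (j - 1)}"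
    then have "x \<in> set ?xs" using xs(1) by simp
    then obtain a where a: "a < length ?xs" "x = ?xs ! a" by (auto simp: in_set_conv_nth)
    have "a < j"
    proof (rule ccontr)
      assume "\<not> a < j"
      then have "?xs ! (j - 1) \<le> ?xs ! a" using sorted_nth_mono[OF xs(3), of "j - 1" a] a by simp
      with x a have "?xs ! (j - 1) = ?xs ! a" by simp
      then have "j - 1 = a" using nth_eq_iff_index_eq[OF xs(2) jl a(1)] by blast
      then show False using j \<open>\<not> a < j\<close> by auto
    qed
    then show "x \<in> (!) ?xs ` {..<j}" using a by blast
  next
    fix x assume "x \<in> (!) ?xs ` {..<j}"
    then obtain a where a: "a < j" "x = ?xs ! a" by auto
    then have "a < length ?xs" using j xs(4) by auto
    moreover have "?xs ! a \<le> ?xs ! (j - 1)" using sorted_nth_mono[OF xs(3) _ jl, of a] a by simp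
    ultimately show "x \<in> {x \<in> ?D. x \<le> ?xs ! (j - 1)}" using a xs(1) nth_mem[of a ?xs] by simp
  qed
  moreover have "inj_on ((!) ?xs) {..<j}" using j xs by (intro inj_on_nth) auto
  ultimately show ?thesis
    unfolding dir_pos_def cube_dir_def dirs_def[symmetric] by (simp add: card_image)
qed

text \<open>Indexed by directions, the summands that remain after removing a direction are not renumbered.\<close>

lemma (in k_graph) bd_frag_of:
  assumes \<rho>: "\<rho> \<in> cubes k \<Lambda> r"
  shows "bd k \<Lambda> r (frag_of \<rho>) =
    (\<Sum>(l, i) \<in> {0..1} \<times> dirs \<Lambda> \<rho>.
       frag_cmul ((-1) ^ (dir_pos (dirs \<Lambda> \<rho>) i + l)) (frag_of (dir_face \<Lambda> l i \<rho>)))"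
proof -
  have fin: "finite (dirs \<Lambda> \<rho>)" and r: "nat r = card (dirs \<Lambda> \<rho>)"
    using \<rho> finite_dirs by (auto simp: in_cubes_iff)
  have "bd k \<Lambda> r (frag_of \<rho>) = (\<Sum>l = 0..1. \<Sum>i \<in> dirs \<Lambda> \<rho>.
       frag_cmul ((-1) ^ (dir_pos (dirs \<Lambda> \<rho>) i + l)) (frag_of (dir_face \<Lambda> l i \<rho>)))"
    unfolding bd_def frag_extend_of r
  proof (rule sum.cong[OF refl])
    fix l :: nat
    show "(\<Sum>j = 1..card (dirs \<Lambda> \<rho>). frag_cmul ((-1) ^ (j + l)) (frag_of (face k \<Lambda> r l j \<rho>))) =
      (\<Sum>i \<in> dirs \<Lambda> \<rho>. frag_cmul ((-1) ^ (dir_pos (dirs \<Lambda> \<rho>) i + l)) (frag_of (dir_face \<Lambda> l i \<rho>)))"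
      unfolding sum.reindex_bij_betw[OF bij_betw_cube_dir[OF fin], symmetric]
      using bij_betw_apply[OF bij_betw_cube_dir[OF fin]]
      by (intro sum.cong) (simp_all add: dir_pos_cube_dir[OF fin] face_eq_dir_face[OF \<rho>])
  qed
  then show ?thesis by (simp only: sum.cartesian_product)
qed

lemma (in k_graph) bd_hom: "bd k \<Lambda> r \<in> hom (chains k \<Lambda> r) (chains k \<Lambda> (r - 1))"
proof -
  have "Poly_Mapping.keys (bd k \<Lambda> r (frag_of \<rho>)) \<subseteq> cubes k \<Lambda> (r - 1)" if \<rho>: "\<rho> \<in> cubes k \<Lambda> r" for \<rho>
  proof -
    have "bd k \<Lambda> r (frag_of \<rho>) \<in> carrier (free_Abelian_group (cubes k \<Lambda> (r - 1)))"
      unfolding bd_frag_of[OF \<rho>]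
      using dir_face_in_cubes(1)[OF \<rho>] keys_cmul
      by (intro sum_closed_free_Abelian_group) (auto simp: keys_frag_of split: prod.splits)
    then show ?thesis by simp
  qed
  then show ?thesis
    unfolding chains_def by (subst bd_def, intro frag_extend_hom) (simp add: bd_def)
qed

text \<open>Removing the smaller direction shifts the position of the larger one, but not conversely.  This
  is the source of all cancellations in \<open>\<partial>\<partial>\<close>.\<close>

lemma dir_pos_swap:
  assumes "finite D" "i \<in> D" "i' \<in> D" "i < i'"
  shows "dir_pos D i + dir_pos (D - {i}) i' + 1 = dir_pos D i' + dir_pos (D - {i'}) i"
proof -
  have "{x \<in> D - {i}. x \<le> i'} = {x \<in> D. x \<le> i'} - {i}" by blast
  moreover have "{x \<in> D - {i'}. x \<le> i} = {x \<in> D. x \<le> i}"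
    using assms(4) leD by blast
  moreover have "Suc (card ({x \<in> D. x \<le> i'} - {i})) = card {x \<in> D. x \<le> i'}"
    using assms by (intro card_Suc_Diff1) simp_all
  ultimately show ?thesis unfolding dir_pos_def by simp
qed

text \<open>The sum equals its own negative, and the coefficients are integers.\<close>

lemma antisymmetric_sum_eq_0:
  fixes g :: "'b \<Rightarrow> 'b \<Rightarrow> ('a \<Rightarrow>\<^sub>0 int)"
  assumes sym: "\<And>p q. (p, q) \<in> W \<Longrightarrow> (q, p) \<in> W" and anti: "\<And>p q. (p, q) \<in> W \<Longrightarrow> g q p = - g p q"
  shows "(\<Sum>(p, q)\<in>W. g p q) = 0"
proof -
  have "(\<Sum>(p, q)\<in>W. g p q) = (\<Sum>(p, q)\<in>W. g q p)"
    by (rule sum.reindex_bij_witness[of _ prod.swap prod.swap]) (auto intro: sym)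
  also have "\<dots> = (\<Sum>(p, q)\<in>W. - g p q)" by (rule sum.cong) (auto intro: anti)
  also have "\<dots> = - (\<Sum>(p, q)\<in>W. g p q)" by (simp add: sum_negf case_prod_unfold)
  finally have eq: "(\<Sum>(p, q)\<in>W. g p q) = - (\<Sum>(p, q)\<in>W. g p q)" .
  show ?thesis
  proof (rule poly_mapping_eqI)
    fix x show "Poly_Mapping.lookup (\<Sum>(p, q)\<in>W. g p q) x = Poly_Mapping.lookup 0 x"
      using arg_cong[OF eq, of "\<lambda>c. Poly_Mapping.lookup c x"] by simp
  qed
qed

text \<open>The terms are indexed by two pairs \<open>(l, i)\<close> with different directions.  Exchanging the pairs
  gives the same iterated face with the opposite sign.\<close>

lemma (in k_graph) bd_bd_frag_of:
  assumes \<rho>: "\<rho> \<in> cubes k \<Lambda> r"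
  shows "bd k \<Lambda> (r - 1) (bd k \<Lambda> r (frag_of \<rho>)) = 0"
proof -
  let ?D = "dirs \<Lambda> \<rho>"
  have fin: "finite ?D" and M: "\<rho> \<in> Mor \<Lambda>" using \<rho> finite_dirs by (auto simp: in_cubes_iff)
  \<comment> \<open>The term of \<open>\<partial>\<partial>\<rho>\<close> that removes first the direction of \<open>p\<close>, then that of \<open>q\<close>.\<close>
  define g where "g p q = frag_cmul
     ((-1) ^ (dir_pos ?D (snd p) + fst p) * (-1) ^ (dir_pos (?D - {snd p}) (snd q) + fst q))
     (frag_of (dir_face \<Lambda> (fst q) (snd q) (dir_face \<Lambda> (fst p) (snd p) \<rho>)))"
    for p q :: "nat \<times> nat"
  let ?I = "{0..1::nat} \<times> ?D"
  have "bd k \<Lambda> (r - 1) (bd k \<Lambda> r (frag_of \<rho>)) =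
      (\<Sum>p \<in> ?I. frag_cmul ((-1) ^ (dir_pos ?D (snd p) + fst p))
         (bd k \<Lambda> (r - 1) (frag_of (dir_face \<Lambda> (fst p) (snd p) \<rho>))))"
    unfolding bd_frag_of[OF \<rho>] using fin
    by (subst bd_def, subst frag_extend_sum) (auto simp: frag_extend_cmul o_def case_prod_unfold bd_def)
  also have "\<dots> = (\<Sum>p \<in> ?I. \<Sum>q \<in> {0..1} \<times> (?D - {snd p}). g p q)"
  proof (rule sum.cong[OF refl])
    fix p assume "p \<in> ?I"
    then have p: "snd p \<in> ?D" by auto
    show "frag_cmul ((-1) ^ (dir_pos ?D (snd p) + fst p))
         (bd k \<Lambda> (r - 1) (frag_of (dir_face \<Lambda> (fst p) (snd p) \<rho>))) =
        (\<Sum>q \<in> {0..1} \<times> (?D - {snd p}). g p q)"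
      unfolding bd_frag_of[OF dir_face_in_cubes(1)[OF \<rho> p]] dir_face_in_cubes(2)[OF \<rho> p] frag_cmul_sum
      by (intro sum.cong) (auto simp: g_def)
  qed
  also have "\<dots> = (\<Sum>(p, q) \<in> (SIGMA p:?I. {0..1} \<times> (?D - {snd p})). g p q)"
    using fin by (intro sum.Sigma) auto
  also have "\<dots> = 0"
  proof (rule antisymmetric_sum_eq_0)
    fix p q :: "nat \<times> nat" assume pq: "(p, q) \<in> (SIGMA p:?I. {0..1} \<times> (?D - {snd p}))"
    then show "(q, p) \<in> (SIGMA p:?I. {0..1} \<times> (?D - {snd p}))" by auto
    have d: "snd p \<in> ?D" "snd q \<in> ?D" "snd q \<noteq> snd p" using pq by auto
    have f: "dir_face \<Lambda> (fst q) (snd q) (dir_face \<Lambda> (fst p) (snd p) \<rho>) =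
        dir_face \<Lambda> (fst p) (snd p) (dir_face \<Lambda> (fst q) (snd q) \<rho>)"
      using d dir_face_in_cubes(2)[OF \<rho> d(1)] by (intro dir_face_commute[OF M]) auto
    have "(-1) ^ (dir_pos ?D (snd q) + dir_pos (?D - {snd q}) (snd p)) =
        - ((-1) ^ (dir_pos ?D (snd p) + dir_pos (?D - {snd p}) (snd q)) :: int)"
    proof (cases "snd p < snd q")
      case True
      from dir_pos_swap[OF fin d(1,2) this, symmetric] show ?thesis by simp
    next
      case False
      then have "snd q < snd p" using d(3) by simp
      from dir_pos_swap[OF fin d(2,1) this, symmetric] show ?thesis by simp
    qed
    then show "g q p = - g p q" by (simp add: g_def f power_add mult_ac)
  qed
  finally show ?thesis .
qed

lemma (in k_graph) bd_bd:
  assumes "Poly_Mapping.keys c \<subseteq> cubes k \<Lambda> r"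
  shows "bd k \<Lambda> (r - 1) (bd k \<Lambda> r c) = 0"
proof -
  have "(bd k \<Lambda> (r - 1) \<circ> bd k \<Lambda> r) c = (\<lambda>_. 0) c"
  proof (rule hom_free_Abelian_group_eqI[OF abelian_free_Abelian_group _ _ _ assms])
    show "bd k \<Lambda> (r - 1) \<circ> bd k \<Lambda> r \<in> hom (free_Abelian_group (cubes k \<Lambda> r)) (free_Abelian_group (cubes k \<Lambda> (r - 1 - 1)))"
      using hom_compose[OF bd_hom[of r] bd_hom[of "r - 1"]] by (simp add: chains_def)
  qed (auto simp: hom_def bd_bd_frag_of)
  then show ?thesis by simp
qed

lemma (in k_graph_morphism) is_face_image:
  "is_face \<Lambda> l i \<mu> \<rho> \<Longrightarrow> is_face \<Gamma> l i (F \<mu>) (F \<rho>)"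
proof -
  assume "is_face \<Lambda> l i \<mu> \<rho>"
  then obtain \<gamma> where \<mu>: "\<mu> \<in> Mor \<Lambda>" and \<gamma>: "\<gamma> \<in> Mor \<Lambda>" "Deg \<Lambda> \<gamma> = gen i"
    and c: "if l = 0 then Src \<Lambda> \<mu> = Rng \<Lambda> \<gamma> \<and> Comp \<Lambda> \<mu> \<gamma> = \<rho> else Src \<Lambda> \<gamma> = Rng \<Lambda> \<mu> \<and> Comp \<Lambda> \<gamma> \<mu> = \<rho>"
    unfolding is_face_def by blast
  have "Deg \<Gamma> (F \<gamma>) = gen i" using \<gamma> by (simp add: Deg_F)
  moreover have "if l = 0 then Src \<Gamma> (F \<mu>) = Rng \<Gamma> (F \<gamma>) \<and> Comp \<Gamma> (F \<mu>) (F \<gamma>) = F \<rho>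
      else Src \<Gamma> (F \<gamma>) = Rng \<Gamma> (F \<mu>) \<and> Comp \<Gamma> (F \<gamma>) (F \<mu>) = F \<rho>"
    using c F_Comp[OF \<mu> \<gamma>(1)] F_Comp[OF \<gamma>(1) \<mu>] by (cases "l = 0") (auto simp: Rng_F Src_F \<mu> \<gamma>)
  ultimately show ?thesis unfolding is_face_def using F_in[OF \<mu>] F_in[OF \<gamma>(1)] by blast
qed

lemma (in k_graph_morphism) dirs_image: "\<rho> \<in> Mor \<Lambda> \<Longrightarrow> dirs \<Gamma> (F \<rho>) = dirs \<Lambda> \<rho>"
  by (simp add: dirs_def Deg_F)

lemma (in k_graph_morphism) cubes_image: "\<rho> \<in> cubes k \<Lambda> r \<Longrightarrow> F \<rho> \<in> cubes k \<Gamma> r"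
  by (simp add: cubes_def F_in Deg_F)

lemma (in k_graph_morphism) bd_free_map:
  assumes c: "Poly_Mapping.keys c \<subseteq> cubes k \<Lambda> r"
  shows "bd k \<Gamma> r (free_map F c) = free_map F (bd k \<Lambda> r c)"
proof -
  have hF: "free_map F \<in> hom (chains k \<Lambda> r) (chains k \<Gamma> r)" for r
    unfolding chains_def using cubes_image by (rule free_map_hom)
  have "(bd k \<Gamma> r \<circ> free_map F) c = (free_map F \<circ> bd k \<Lambda> r) c"
  proof (rule hom_free_Abelian_group_eqI[OF abelian_free_Abelian_group _ _ _ c])
    show "bd k \<Gamma> r \<circ> free_map F \<in> hom (free_Abelian_group (cubes k \<Lambda> r)) (free_Abelian_group (cubes k \<Gamma> (r - 1)))"
      using hom_compose[OF hF cod.bd_hom] by (simp add: chains_def)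
    show "free_map F \<circ> bd k \<Lambda> r \<in> hom (free_Abelian_group (cubes k \<Lambda> r)) (free_Abelian_group (cubes k \<Gamma> (r - 1)))"
      using hom_compose[OF dom.bd_hom hF] by (simp add: chains_def)
  next
    fix \<rho> assume \<rho>: "\<rho> \<in> cubes k \<Lambda> r"
    then have M: "\<rho> \<in> Mor \<Lambda>" by (simp add: dom.in_cubes_iff)
    have f: "dir_face \<Gamma> l i (F \<rho>) = F (dir_face \<Lambda> l i \<rho>)" if "i \<in> dirs \<Lambda> \<rho>" for l i
      using is_face_image[OF dom.is_face_dir_face[OF M that]] by (rule cod.dir_face_eqI)
    have "free_map F (bd k \<Lambda> r (frag_of \<rho>)) = bd k \<Gamma> r (frag_of (F \<rho>))"
      unfolding dom.bd_frag_of[OF \<rho>] cod.bd_frag_of[OF cubes_image[OF \<rho>]] dirs_image[OF M]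
      using dom.finite_dirs[OF M]
      by (subst free_map_def, subst frag_extend_sum)
        (auto simp: frag_extend_cmul f intro!: sum.cong)
    then show "(bd k \<Gamma> r \<circ> free_map F) (frag_of \<rho>) = (free_map F \<circ> bd k \<Lambda> r) (frag_of \<rho>)" by simp
  qed
  then show ?thesis by simp
qed

section \<open>Cycles, boundaries and homology classes\<close>

lemma in_chains_iff [simp]: "c \<in> carrier (chains k \<Lambda> r) \<longleftrightarrow> Poly_Mapping.keys c \<subseteq> cubes k \<Lambda> r"
  by (simp add: chains_def)

lemma mult_chains [simp]: "x \<otimes>\<^bsub>chains k \<Lambda> r\<^esub> y = x + y"
  by (simp add: chains_def)

lemma one_chains [simp]: "\<one>\<^bsub>chains k \<Lambda> r\<^esub> = 0"
  by (simp add: chains_def)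

lemma comm_group_chains: "comm_group (chains k \<Lambda> r)"
  by (simp add: chains_def abelian_free_Abelian_group)

lemma group_chains: "group (chains k \<Lambda> r)"
  using comm_group_chains by (rule comm_group.axioms)

lemma in_cycle_group_iff:
  "z \<in> carrier (cycle_group k \<Lambda> r) \<longleftrightarrow> Poly_Mapping.keys z \<subseteq> cubes k \<Lambda> r \<and> bd k \<Lambda> r z = 0"
  by (simp add: cycle_group_def kernel_def)

lemma mult_cycle_group [simp]: "x \<otimes>\<^bsub>cycle_group k \<Lambda> r\<^esub> y = x + y"
  by (simp add: cycle_group_def)

lemma one_cycle_group [simp]: "\<one>\<^bsub>cycle_group k \<Lambda> r\<^esub> = 0"
  by (simp add: cycle_group_def)

lemma boundaries_pred: "boundaries k \<Lambda> (r - 1) = bd k \<Lambda> r ` carrier (chains k \<Lambda> r)"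
  by (simp add: boundaries_def)

lemma hom_chains_restrict: "h \<in> hom (chains k \<Lambda> r) A \<Longrightarrow> h \<in> hom (cycle_group k \<Lambda> r) A"
  by (rule homI) (simp_all add: in_cycle_group_iff hom_in_carrier[of h "chains k \<Lambda> r" A]
      hom_mult[of h "chains k \<Lambda> r" A, simplified])

context k_graph
begin

lemma bd_in_chains: "Poly_Mapping.keys c \<subseteq> cubes k \<Lambda> r \<Longrightarrow> Poly_Mapping.keys (bd k \<Lambda> r c) \<subseteq> cubes k \<Lambda> (r - 1)"
  using hom_in_carrier[OF bd_hom[of r], of c] by simp

lemma bd_add: "bd k \<Lambda> r (x + y) = bd k \<Lambda> r x + bd k \<Lambda> r y"
  by (simp add: bd_def frag_extend_add)

lemma bd_diff: "bd k \<Lambda> r (x - y) = bd k \<Lambda> r x - bd k \<Lambda> r y"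
  by (simp add: bd_def frag_extend_diff)

lemma bd_in_cycle_group: "Poly_Mapping.keys c \<subseteq> cubes k \<Lambda> r \<Longrightarrow> bd k \<Lambda> r c \<in> carrier (cycle_group k \<Lambda> (r - 1))"
  by (simp add: in_cycle_group_iff bd_in_chains bd_bd)

lemma bd_group_hom: "group_hom (chains k \<Lambda> r) (chains k \<Lambda> (r - 1)) (bd k \<Lambda> r)"
  by (simp add: group_hom_def group_hom_axioms_def bd_hom group_chains)

lemma comm_group_cycle_group: "comm_group (cycle_group k \<Lambda> r)"
  unfolding cycle_group_def
  by (rule subgroup_comm_group[OF comm_group_chains group_hom.subgroup_kernel[OF bd_group_hom]])

lemma group_cycle_group: "group (cycle_group k \<Lambda> r)"
  using comm_group_cycle_group by (rule comm_group.axioms)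

lemma bd_hom_cycle_group: "bd k \<Lambda> r \<in> hom (chains k \<Lambda> r) (cycle_group k \<Lambda> (r - 1))"
  by (rule homI) (simp_all add: bd_in_cycle_group bd_add)

lemma subgroup_boundaries: "subgroup (boundaries k \<Lambda> r) (cycle_group k \<Lambda> r)"
proof -
  have "group_hom (chains k \<Lambda> (r + 1)) (cycle_group k \<Lambda> r) (bd k \<Lambda> (r + 1))"
    using bd_hom_cycle_group[of "r + 1"]
    by (simp add: group_hom_def group_hom_axioms_def group_chains group_cycle_group)
  then show ?thesis unfolding boundaries_def by (rule group_hom.img_is_subgroup)
qed

lemma boundaries_subset: "b \<in> boundaries k \<Lambda> r \<Longrightarrow> b \<in> carrier (cycle_group k \<Lambda> r)"
  using subgroup.subset[OF subgroup_boundaries] by blast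

lemma comm_group_homology: "comm_group (homology k \<Lambda> r)"
  unfolding homology_def by (rule comm_group.abelian_FactGroup[OF comm_group_cycle_group subgroup_boundaries])

lemma group_homology: "group (homology k \<Lambda> r)"
  using comm_group_homology by (rule comm_group.axioms)

abbreviation hclass :: "int \<Rightarrow> ('m \<Rightarrow>\<^sub>0 int) \<Rightarrow> ('m \<Rightarrow>\<^sub>0 int) set"
  where "hclass r z \<equiv> boundaries k \<Lambda> r #>\<^bsub>cycle_group k \<Lambda> r\<^esub> z"

lemma hclass_hom: "hclass r \<in> hom (cycle_group k \<Lambda> r) (homology k \<Lambda> r)"
  unfolding homology_def
  by (intro normal.r_coset_hom_Mod comm_group.subgroup_imp_normal comm_group_cycle_group subgroup_boundaries)

lemma homology_cases:
  assumes "Y \<in> carrier (homology k \<Lambda> r)"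
  obtains z where "z \<in> carrier (cycle_group k \<Lambda> r)" "Y = hclass r z"
  using assms by (auto simp: homology_def carrier_FactGroup)

lemma hclass_eq_one_iff:
  "z \<in> carrier (cycle_group k \<Lambda> r) \<Longrightarrow> hclass r z = \<one>\<^bsub>homology k \<Lambda> r\<^esub> \<longleftrightarrow> z \<in> boundaries k \<Lambda> r"
  by (simp add: homology_def r_coset_eq_subgroup_iff[OF group_cycle_group subgroup_boundaries])

lemma countable_cubes: "countable (cubes k \<Lambda> r)"
  using countable_Mor by (rule countable_subset[rotated]) (auto simp: cubes_def)

text \<open>The boundaries are a subgroup of a free abelian group on a countable set, so the boundary map
  splits as a map onto them.\<close>

lemma bd_section:
  obtains s where "\<And>x y. x \<in> boundaries k \<Lambda> (r - 1) \<Longrightarrow> y \<in> boundaries k \<Lambda> (r - 1) \<Longrightarrow> s (x + y) = s x + s y"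
    and "\<And>b. b \<in> boundaries k \<Lambda> (r - 1) \<Longrightarrow> Poly_Mapping.keys (s b) \<subseteq> cubes k \<Lambda> r"
    and "\<And>b. b \<in> boundaries k \<Lambda> (r - 1) \<Longrightarrow> bd k \<Lambda> r (s b) = b"
proof -
  let ?B = "boundaries k \<Lambda> (r - 1)"
  have B: "subgroup ?B (free_Abelian_group (cubes k \<Lambda> (r - 1)))"
    using group_hom.img_is_subgroup[OF bd_group_hom[of r]] by (simp add: boundaries_pred chains_def)
  have "bd k \<Lambda> r \<in> epi (chains k \<Lambda> r) ((free_Abelian_group (cubes k \<Lambda> (r - 1)))\<lparr>carrier := ?B\<rparr>)"
    by (simp add: epi_def boundaries_pred hom_def bd_add)
  from epi_onto_subgroup_free_Abelian_group_splits[OF countable_cubes B comm_group_chains this]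
  obtain s where s: "s \<in> hom ((free_Abelian_group (cubes k \<Lambda> (r - 1)))\<lparr>carrier := ?B\<rparr>) (chains k \<Lambda> r)"
    and sb: "\<And>b. b \<in> ?B \<Longrightarrow> bd k \<Lambda> r (s b) = b" by blast
  show thesis
  proof (rule that[of s])
    show "s (x + y) = s x + s y" if "x \<in> ?B" "y \<in> ?B" for x y
      using hom_mult[OF s, of x y] that by simp
    show "Poly_Mapping.keys (s b) \<subseteq> cubes k \<Lambda> r" if "b \<in> ?B" for b
      using hom_in_carrier[OF s, of b] that by simp
  qed (rule sb)
qed

text \<open>Subtracting \<open>s(\<partial> c)\<close>, where \<open>s\<close> is a section of \<open>\<partial>\<close>, turns a chain into a cycle and leaves
  cycles unchanged.\<close>

lemma cycle_retraction:
  obtains ret where "ret \<in> hom (chains k \<Lambda> r) (cycle_group k \<Lambda> r)"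
    and "\<And>z. z \<in> carrier (cycle_group k \<Lambda> r) \<Longrightarrow> ret z = z"
proof -
  obtain s where add: "\<And>x y. x \<in> boundaries k \<Lambda> (r - 1) \<Longrightarrow> y \<in> boundaries k \<Lambda> (r - 1) \<Longrightarrow> s (x + y) = s x + s y"
    and sC: "\<And>b. b \<in> boundaries k \<Lambda> (r - 1) \<Longrightarrow> Poly_Mapping.keys (s b) \<subseteq> cubes k \<Lambda> r"
    and sb: "\<And>b. b \<in> boundaries k \<Lambda> (r - 1) \<Longrightarrow> bd k \<Lambda> r (s b) = b"
    using bd_section[of r] by blast
  have b: "bd k \<Lambda> r c \<in> boundaries k \<Lambda> (r - 1)" if "Poly_Mapping.keys c \<subseteq> cubes k \<Lambda> r" for c
    using that unfolding boundaries_pred by (intro imageI) simp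
  show thesis
  proof (rule that[of "\<lambda>c. c - s (bd k \<Lambda> r c)"])
    show "(\<lambda>c. c - s (bd k \<Lambda> r c)) \<in> hom (chains k \<Lambda> r) (cycle_group k \<Lambda> r)"
    proof (rule homI)
      fix c assume "c \<in> carrier (chains k \<Lambda> r)"
      then have c: "Poly_Mapping.keys c \<subseteq> cubes k \<Lambda> r" by simp
      then show "c - s (bd k \<Lambda> r c) \<in> carrier (cycle_group k \<Lambda> r)"
        using sC[OF b[OF c]] by (simp add: in_cycle_group_iff keys_minus_subset bd_diff sb[OF b[OF c]])
    qed (simp add: bd_add add b)
  next
    fix z assume z: "z \<in> carrier (cycle_group k \<Lambda> r)"
    have 0: "0 \<in> boundaries k \<Lambda> (r - 1)"
      using subgroup.one_closed[OF subgroup_boundaries[of "r - 1"]] by simp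
    have "s 0 = 0" using add[OF 0 0] by simp
    then show "z - s (bd k \<Lambda> r z) = z" using z by (simp add: in_cycle_group_iff)
  qed
qed

lemma hom_cycle_group_extends:
  assumes "h \<in> hom (cycle_group k \<Lambda> r) A"
  obtains h' where "h' \<in> hom (chains k \<Lambda> r) A" "\<And>z. z \<in> carrier (cycle_group k \<Lambda> r) \<Longrightarrow> h' z = h z"
proof -
  obtain ret where ret: "ret \<in> hom (chains k \<Lambda> r) (cycle_group k \<Lambda> r)"
    and "\<And>z. z \<in> carrier (cycle_group k \<Lambda> r) \<Longrightarrow> ret z = z" using cycle_retraction[of r] by blast
  then show thesis using that[OF hom_compose[OF ret assms]] by simp
qed

text \<open>A lift of the quotient map exists: on the generators of the chain group send \<open>\<rho>\<close> to the generator
  \<open>[h]\<close> of \<open>\<int>[H]\<close>, where \<open>h\<close> is the homology class of the retraction of \<open>\<rho>\<close> to the cycles.  Then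
  restrict this homomorphism to the cycles.\<close>

lemma uct_lift_spec:
  shows uct_lift_hom: "uct_lift k \<Lambda> r \<in> hom (cycle_group k \<Lambda> r) (free_Abelian_group (carrier (homology k \<Lambda> r)))"
    and res_aug_uct_lift: "z \<in> carrier (cycle_group k \<Lambda> r) \<Longrightarrow>
      res_aug (homology k \<Lambda> r) (uct_lift k \<Lambda> r z) = hclass r z"
proof -
  let ?H = "homology k \<Lambda> r"
  obtain ret where ret: "ret \<in> hom (chains k \<Lambda> r) (cycle_group k \<Lambda> r)"
    and retz: "\<And>z. z \<in> carrier (cycle_group k \<Lambda> r) \<Longrightarrow> ret z = z" using cycle_retraction[of r] by blast
  have hr: "hclass r \<circ> ret \<in> hom (chains k \<Lambda> r) ?H" using hom_compose[OF ret hclass_hom] .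
  define \<sigma> where "\<sigma> = free_map (\<lambda>\<rho>. hclass r (ret (frag_of \<rho>)))"
  have H: "hclass r (ret (frag_of \<rho>)) \<in> carrier ?H" if "\<rho> \<in> cubes k \<Lambda> r" for \<rho>
    using hom_in_carrier[OF hr, of "frag_of \<rho>"] that by simp
  then have \<sigma>: "\<sigma> \<in> hom (chains k \<Lambda> r) (free_Abelian_group (carrier ?H))"
    unfolding \<sigma>_def chains_def by (rule free_map_hom)
  have aug: "res_aug ?H (\<sigma> c) = hclass r (ret c)" if c: "Poly_Mapping.keys c \<subseteq> cubes k \<Lambda> r" for c
  proof -
    have "(res_aug ?H \<circ> \<sigma>) c = (hclass r \<circ> ret) c"
    proof (rule hom_free_Abelian_group_eqI[OF comm_group_homology _ _ _ c])
      show "res_aug ?H \<circ> \<sigma> \<in> hom (free_Abelian_group (cubes k \<Lambda> r)) ?H"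
        using hom_compose[OF \<sigma> res_aug_hom[OF comm_group_homology]] by (simp add: chains_def)
      show "hclass r \<circ> ret \<in> hom (free_Abelian_group (cubes k \<Lambda> r)) ?H"
        using hr by (simp add: chains_def)
    qed (simp add: \<sigma>_def res_aug_frag_of[OF comm_group_homology] H)
    then show ?thesis by simp
  qed
  let ?P = "\<lambda>\<sigma>. \<sigma> \<in> hom (cycle_group k \<Lambda> r) (free_Abelian_group (carrier ?H)) \<and>
    (\<forall>z \<in> carrier (cycle_group k \<Lambda> r). res_aug ?H (\<sigma> z) = hclass r z)"
  have "?P \<sigma>"
    using hom_chains_restrict[OF \<sigma>] aug retz by (simp add: in_cycle_group_iff)
  then have "?P (uct_lift k \<Lambda> r)" unfolding uct_lift_def by (rule someI[of ?P])
  then show "uct_lift k \<Lambda> r \<in> hom (cycle_group k \<Lambda> r) (free_Abelian_group (carrier ?H))"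
    and "z \<in> carrier (cycle_group k \<Lambda> r) \<Longrightarrow> res_aug ?H (uct_lift k \<Lambda> r z) = hclass r z" by auto
qed

text \<open>In the direction opposite to \<open>uct_lift\<close>, a lift exists just because \<open>\<int>[H]\<close> is free: choose a
  representing cycle for every homology class.\<close>

lemma homology_lift:
  obtains \<tau> where "\<tau> \<in> hom (free_Abelian_group (carrier (homology k \<Lambda> r))) (cycle_group k \<Lambda> r)"
    and "\<And>x. Poly_Mapping.keys x \<subseteq> carrier (homology k \<Lambda> r) \<Longrightarrow> hclass r (\<tau> x) = res_aug (homology k \<Lambda> r) x"
proof -
  let ?H = "homology k \<Lambda> r" and ?Z = "cycle_group k \<Lambda> r"
  interpret Z: comm_group ?Z by (rule comm_group_cycle_group)
  have "\<forall>Y \<in> carrier ?H. \<exists>z. z \<in> carrier ?Z \<and> hclass r z = Y"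
    using homology_cases by blast
  then obtain t where t: "\<And>Y. Y \<in> carrier ?H \<Longrightarrow> t Y \<in> carrier ?Z \<and> hclass r (t Y) = Y" by metis
  have "t ` carrier ?H \<subseteq> carrier ?Z" using t by blast
  then obtain \<tau> where \<tau>: "\<tau> \<in> hom (free_Abelian_group (carrier ?H)) ?Z"
    and \<tau>t: "\<And>Y. Y \<in> carrier ?H \<Longrightarrow> \<tau> (frag_of Y) = t Y"
    using Z.free_Abelian_group_universal[of t "carrier ?H"] by blast
  have "(hclass r \<circ> \<tau>) x = res_aug ?H x" if x: "Poly_Mapping.keys x \<subseteq> carrier ?H" for x
    by (rule hom_free_Abelian_group_eqI[OF comm_group_homology hom_compose[OF \<tau> hclass_hom]
          res_aug_hom[OF comm_group_homology] _ x])
      (simp add: res_aug_frag_of[OF comm_group_homology] \<tau>t t)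
  then show thesis using that[OF \<tau>] by simp
qed

end

section \<open>Cocycles and coboundaries\<close>

lemma comm_group_cochains: "comm_group A \<Longrightarrow> comm_group (cochains k \<Lambda> A r)"
  unfolding cochains_def by (rule comm_group_product_group)

lemma group_cochains: "comm_group A \<Longrightarrow> group (cochains k \<Lambda> A r)"
  using comm_group_cochains by (rule comm_group.axioms)

lemma mult_cocycle_group [simp]:
  "f \<otimes>\<^bsub>cocycle_group k \<Lambda> A r\<^esub> g = (\<lambda>\<rho>\<in>cubes k \<Lambda> r. f \<rho> \<otimes>\<^bsub>A\<^esub> g \<rho>)"
  by (simp add: cocycle_group_def cochains_def)

lemma one_cocycle_group [simp]:
  "\<one>\<^bsub>cocycle_group k \<Lambda> A r\<^esub> = (\<lambda>\<rho>\<in>cubes k \<Lambda> r. \<one>\<^bsub>A\<^esub>)"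
  by (simp add: cocycle_group_def cochains_def)

context k_graph
begin

lemma bd_frag_of_in_chains: "\<rho> \<in> cubes k \<Lambda> (r + 1) \<Longrightarrow> Poly_Mapping.keys (bd k \<Lambda> (r + 1) (frag_of \<rho>)) \<subseteq> cubes k \<Lambda> r"
  using bd_in_chains[of "frag_of \<rho>" "r + 1"] by simp

lemma cobd_hom:
  assumes A: "comm_group A" shows "cobd k \<Lambda> A r \<in> hom (cochains k \<Lambda> A r) (cochains k \<Lambda> A (r + 1))"
proof (rule homI)
  fix f assume "f \<in> carrier (cochains k \<Lambda> A r)"
  then have f: "\<And>\<rho>. \<rho> \<in> cubes k \<Lambda> r \<Longrightarrow> f \<rho> \<in> carrier A" by (auto simp: cochains_def)
  then show "cobd k \<Lambda> A r f \<in> carrier (cochains k \<Lambda> A (r + 1))"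
    using lin_ext_closed[OF A f bd_frag_of_in_chains] by (simp add: cochains_def cobd_def)
next
  fix f g assume "f \<in> carrier (cochains k \<Lambda> A r)" "g \<in> carrier (cochains k \<Lambda> A r)"
  then have f: "\<And>\<rho>. \<rho> \<in> cubes k \<Lambda> r \<Longrightarrow> f \<rho> \<in> carrier A" and g: "\<And>\<rho>. \<rho> \<in> cubes k \<Lambda> r \<Longrightarrow> g \<rho> \<in> carrier A"
    by (auto simp: cochains_def)
  interpret A: comm_group A by fact
  have "lin_ext A (\<lambda>\<rho>\<in>cubes k \<Lambda> r. f \<rho> \<otimes>\<^bsub>A\<^esub> g \<rho>) c = lin_ext A f c \<otimes>\<^bsub>A\<^esub> lin_ext A g c"
    if "Poly_Mapping.keys c \<subseteq> cubes k \<Lambda> r" for c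
    using lin_ext_mult[OF A f g that] lin_ext_cong[OF A, of "cubes k \<Lambda> r" "\<lambda>\<rho>\<in>cubes k \<Lambda> r. f \<rho> \<otimes>\<^bsub>A\<^esub> g \<rho>" "\<lambda>\<rho>. f \<rho> \<otimes>\<^bsub>A\<^esub> g \<rho>", OF _ _ that] f g
    by simp
  then show "cobd k \<Lambda> A r (f \<otimes>\<^bsub>cochains k \<Lambda> A r\<^esub> g) =
      cobd k \<Lambda> A r f \<otimes>\<^bsub>cochains k \<Lambda> A (r + 1)\<^esub> cobd k \<Lambda> A r g"
    using bd_frag_of_in_chains by (auto simp: cochains_def cobd_def intro!: restrict_ext)
qed

lemma cobd_group_hom:
  assumes A: "comm_group A"
  shows "group_hom (cochains k \<Lambda> A r) (cochains k \<Lambda> A (r + 1)) (cobd k \<Lambda> A r)"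
  by (simp add: group_hom_def group_hom_axioms_def cobd_hom[OF A] group_cochains[OF A])

lemma comm_group_cocycle_group:
  assumes A: "comm_group A" shows "comm_group (cocycle_group k \<Lambda> A r)"
  unfolding cocycle_group_def
  by (rule subgroup_comm_group[OF comm_group_cochains[OF A] group_hom.subgroup_kernel[OF cobd_group_hom[OF A]]])

lemma lin_ext_bd:
  assumes A: "comm_group A" and f: "\<And>\<rho>. \<rho> \<in> cubes k \<Lambda> (r - 1) \<Longrightarrow> f \<rho> \<in> carrier A"
    and g: "\<And>\<rho>. \<rho> \<in> cubes k \<Lambda> r \<Longrightarrow> g \<rho> = lin_ext A f (bd k \<Lambda> r (frag_of \<rho>))"
    and c: "Poly_Mapping.keys c \<subseteq> cubes k \<Lambda> r"
  shows "lin_ext A g c = lin_ext A f (bd k \<Lambda> r c)"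
proof -
  have "lin_ext A f \<circ> bd k \<Lambda> r \<in> hom (free_Abelian_group (cubes k \<Lambda> r)) A"
    using hom_compose[OF bd_hom[of r, unfolded chains_def] lin_ext_hom[OF A, of "cubes k \<Lambda> (r - 1)" f]] f
    by blast
  from hom_free_Abelian_group_eq_lin_ext[OF A this _ c, of g] g show ?thesis by simp
qed

text \<open>Being a cocycle is tested on boundaries of generators; by linearity this amounts to vanishing
  on all boundaries.\<close>

lemma in_cocycle_group_iff:
  assumes A: "comm_group A"
  shows "f \<in> carrier (cocycle_group k \<Lambda> A r) \<longleftrightarrow>
    f \<in> cubes k \<Lambda> r \<rightarrow>\<^sub>E carrier A \<and> (\<forall>b \<in> boundaries k \<Lambda> r. lin_ext A f b = \<one>\<^bsub>A\<^esub>)"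
proof -
  have "cobd k \<Lambda> A r f = (\<lambda>\<rho>\<in>cubes k \<Lambda> (r + 1). \<one>\<^bsub>A\<^esub>) \<longleftrightarrow> (\<forall>b \<in> boundaries k \<Lambda> r. lin_ext A f b = \<one>\<^bsub>A\<^esub>)"
    (is "?L \<longleftrightarrow> ?R") if f: "f \<in> cubes k \<Lambda> r \<rightarrow>\<^sub>E carrier A"
  proof
    interpret A: comm_group A by fact
    assume L: ?L
    have g: "\<one>\<^bsub>A\<^esub> = lin_ext A f (bd k \<Lambda> (r + 1) (frag_of \<rho>))" if "\<rho> \<in> cubes k \<Lambda> (r + 1)" for \<rho>
      using fun_cong[OF L, of \<rho>] that by (simp add: cobd_def)
    show ?R
    proof
      fix b assume "b \<in> boundaries k \<Lambda> r"
      then obtain c where c: "Poly_Mapping.keys c \<subseteq> cubes k \<Lambda> (r + 1)" "b = bd k \<Lambda> (r + 1) c"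
        by (auto simp: boundaries_def)
      have "lin_ext A (\<lambda>_. \<one>\<^bsub>A\<^esub>) c = lin_ext A f (bd k \<Lambda> (r + 1) c)"
        using f g by (intro lin_ext_bd[OF A _ _ c(1)]) auto
      then show "lin_ext A f b = \<one>\<^bsub>A\<^esub>" using c(2) by (simp add: lin_ext_def)
    qed
  next
    assume R: ?R
    have "bd k \<Lambda> (r + 1) (frag_of \<rho>) \<in> boundaries k \<Lambda> r" if "\<rho> \<in> cubes k \<Lambda> (r + 1)" for \<rho>
      using that unfolding boundaries_def by (intro imageI) simp
    with R show ?L by (auto simp: cobd_def intro!: restrict_ext)
  qed
  then show ?thesis by (auto simp: cocycle_group_def kernel_def cochains_def)
qed

lemma in_coboundaries_iff:
  assumes A: "comm_group A"
  shows "f \<in> coboundaries k \<Lambda> A r \<longleftrightarrow>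
    (\<exists>h \<in> hom (chains k \<Lambda> (r - 1)) A. f = (\<lambda>\<rho>\<in>cubes k \<Lambda> r. h (bd k \<Lambda> r (frag_of \<rho>))))"
proof
  assume "f \<in> coboundaries k \<Lambda> A r"
  then obtain g where g: "g \<in> cubes k \<Lambda> (r - 1) \<rightarrow>\<^sub>E carrier A" "f = cobd k \<Lambda> A (r - 1) g"
    by (auto simp: coboundaries_def cochains_def)
  then have "lin_ext A g \<in> hom (chains k \<Lambda> (r - 1)) A"
    unfolding chains_def by (intro lin_ext_hom[OF A]) auto
  moreover have "f = (\<lambda>\<rho>\<in>cubes k \<Lambda> r. lin_ext A g (bd k \<Lambda> r (frag_of \<rho>)))"
    using g(2) by (simp add: cobd_def)
  ultimately show "\<exists>h \<in> hom (chains k \<Lambda> (r - 1)) A. f = (\<lambda>\<rho>\<in>cubes k \<Lambda> r. h (bd k \<Lambda> r (frag_of \<rho>)))"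
    by blast
next
  assume "\<exists>h \<in> hom (chains k \<Lambda> (r - 1)) A. f = (\<lambda>\<rho>\<in>cubes k \<Lambda> r. h (bd k \<Lambda> r (frag_of \<rho>)))"
  then obtain h where h: "h \<in> hom (chains k \<Lambda> (r - 1)) A"
    and f: "f = (\<lambda>\<rho>\<in>cubes k \<Lambda> r. h (bd k \<Lambda> r (frag_of \<rho>)))" by blast
  define g where "g = (\<lambda>\<rho>\<in>cubes k \<Lambda> (r - 1). h (frag_of \<rho>))"
  have "lin_ext A g c = h c" if "Poly_Mapping.keys c \<subseteq> cubes k \<Lambda> (r - 1)" for c
    using h that by (intro hom_free_Abelian_group_eq_lin_ext[OF A]) (auto simp: chains_def g_def)
  then have "f = cobd k \<Lambda> A (r - 1) g"
    using bd_in_chains[of "frag_of _" r] by (auto simp: f cobd_def intro!: restrict_ext)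
  moreover have "g \<in> carrier (cochains k \<Lambda> A (r - 1))"
    using hom_in_carrier[OF h] by (simp add: g_def cochains_def)
  ultimately show "f \<in> coboundaries k \<Lambda> A r" unfolding coboundaries_def by blast
qed

lemma lin_ext_coboundary:
  assumes A: "comm_group A" and h: "h \<in> hom (chains k \<Lambda> (r - 1)) A"
    and c: "Poly_Mapping.keys c \<subseteq> cubes k \<Lambda> r"
  shows "lin_ext A (\<lambda>\<rho>\<in>cubes k \<Lambda> r. h (bd k \<Lambda> r (frag_of \<rho>))) c = h (bd k \<Lambda> r c)"
proof -
  have "h \<circ> bd k \<Lambda> r \<in> hom (free_Abelian_group (cubes k \<Lambda> r)) A"
    using hom_compose[OF bd_hom h] by (simp add: chains_def)
  from hom_free_Abelian_group_eq_lin_ext[OF A this _ c] show ?thesis by simp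
qed

text \<open>Although \<open>h\<close> is only defined on cycles, it extends to all chains, and the extension gives the same
  cochain because \<open>\<partial>\<close> takes values in cycles.\<close>

lemma coboundary_of_hom_cycle_group:
  assumes A: "comm_group A" and h: "h \<in> hom (cycle_group k \<Lambda> (r - 1)) A"
  shows "(\<lambda>\<rho>\<in>cubes k \<Lambda> r. h (bd k \<Lambda> r (frag_of \<rho>))) \<in> coboundaries k \<Lambda> A r"
proof -
  obtain h' where h': "h' \<in> hom (chains k \<Lambda> (r - 1)) A"
    and eq: "\<And>z. z \<in> carrier (cycle_group k \<Lambda> (r - 1)) \<Longrightarrow> h' z = h z"
    using hom_cycle_group_extends[OF h] by blast
  have "(\<lambda>\<rho>\<in>cubes k \<Lambda> r. h (bd k \<Lambda> r (frag_of \<rho>))) = (\<lambda>\<rho>\<in>cubes k \<Lambda> r. h' (bd k \<Lambda> r (frag_of \<rho>)))"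
    by (rule restrict_ext) (simp add: eq bd_in_cycle_group)
  then show ?thesis using h' by (auto simp: in_coboundaries_iff[OF A])
qed

lemma subgroup_coboundaries:
  assumes A: "comm_group A" shows "subgroup (coboundaries k \<Lambda> A r) (cocycle_group k \<Lambda> A r)"
proof -
  have sub: "coboundaries k \<Lambda> A r \<subseteq> carrier (cocycle_group k \<Lambda> A r)"
  proof
    fix f assume "f \<in> coboundaries k \<Lambda> A r"
    then obtain h where h: "h \<in> hom (chains k \<Lambda> (r - 1)) A"
      and f: "f = (\<lambda>\<rho>\<in>cubes k \<Lambda> r. h (bd k \<Lambda> r (frag_of \<rho>)))" by (auto simp: in_coboundaries_iff[OF A])
    have "lin_ext A f b = \<one>\<^bsub>A\<^esub>" if b: "b \<in> boundaries k \<Lambda> r" for b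
    proof -
      have "lin_ext A f b = h (bd k \<Lambda> r b)" "bd k \<Lambda> r b = 0"
        using boundaries_subset[OF b] lin_ext_coboundary[OF A h] by (simp_all add: f in_cycle_group_iff)
      then show ?thesis
        using hom_one[OF h group_chains comm_group.axioms(2)[OF A]] by simp
    qed
    moreover have "f \<in> cubes k \<Lambda> r \<rightarrow>\<^sub>E carrier A"
      using hom_in_carrier[OF h] bd_in_chains[of "frag_of _" r] by (simp add: f)
    ultimately show "f \<in> carrier (cocycle_group k \<Lambda> A r)" by (simp add: in_cocycle_group_iff[OF A])
  qed
  have "subgroup (coboundaries k \<Lambda> A r) (cochains k \<Lambda> A r)"
    using group_hom.img_is_subgroup[OF cobd_group_hom[OF A, of "r - 1"]] by (simp add: coboundaries_def)
  then show ?thesis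
    using group.subgroup_incl[of "cochains k \<Lambda> A r" "coboundaries k \<Lambda> A r" "carrier (cocycle_group k \<Lambda> A r)"]
      sub group_hom.subgroup_kernel[OF cobd_group_hom[OF A, of r]] 
    by (simp add: cocycle_group_def group_cochains[OF A])
qed

lemma comm_group_cohomology:
  assumes A: "comm_group A" shows "comm_group (cohomology k \<Lambda> A r)"
  unfolding cohomology_def
  by (rule comm_group.abelian_FactGroup[OF comm_group_cocycle_group[OF A] subgroup_coboundaries[OF A]])

end

section \<open>The map from Ext to cohomology\<close>

context k_graph
begin

text \<open>A cocycle representing the image under \<open>\<alpha>\<close> of the class of \<open>g\<close>.\<close>

definition alpha_cocycle :: "('a, 'z) monoid_scheme \<Rightarrow> int \<Rightarrow> ((('m \<Rightarrow>\<^sub>0 int) set \<Rightarrow>\<^sub>0 int) \<Rightarrow> 'a) \<Rightarrow> 'm \<Rightarrow> 'a"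
  where "alpha_cocycle A r g = (\<lambda>\<rho>\<in>cubes k \<Lambda> r. g (uct_lift k \<Lambda> (r - 1) (bd k \<Lambda> r (frag_of \<rho>))))"

text \<open>The lift of a boundary represents the class zero in homology.\<close>

lemma uct_lift_in_res_ker:
  assumes "b \<in> boundaries k \<Lambda> r"
  shows "uct_lift k \<Lambda> r b \<in> carrier (res_ker (homology k \<Lambda> r))"
proof -
  have b: "b \<in> carrier (cycle_group k \<Lambda> r)" using assms by (rule boundaries_subset)
  show ?thesis
    using hom_in_carrier[OF uct_lift_hom b] res_aug_uct_lift[OF b] hclass_eq_one_iff[OF b] assms
    by (simp add: carrier_res_ker)
qed

lemma bd_in_boundaries: "Poly_Mapping.keys c \<subseteq> cubes k \<Lambda> r \<Longrightarrow> bd k \<Lambda> r c \<in> boundaries k \<Lambda> (r - 1)"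
  unfolding boundaries_pred by (rule imageI) simp

lemma uct_lift_bd_hom:
  "(\<lambda>c. uct_lift k \<Lambda> (r - 1) (bd k \<Lambda> r c)) \<in> hom (chains k \<Lambda> r) (res_ker (homology k \<Lambda> (r - 1)))"
proof (rule homI)
  fix c assume "c \<in> carrier (chains k \<Lambda> r)"
  then show "uct_lift k \<Lambda> (r - 1) (bd k \<Lambda> r c) \<in> carrier (res_ker (homology k \<Lambda> (r - 1)))"
    by (intro uct_lift_in_res_ker bd_in_boundaries) simp
next
  fix c d assume "c \<in> carrier (chains k \<Lambda> r)" "d \<in> carrier (chains k \<Lambda> r)"
  then show "uct_lift k \<Lambda> (r - 1) (bd k \<Lambda> r (c \<otimes>\<^bsub>chains k \<Lambda> r\<^esub> d)) =
      uct_lift k \<Lambda> (r - 1) (bd k \<Lambda> r c) \<otimes>\<^bsub>res_ker (homology k \<Lambda> (r - 1))\<^esub> uct_lift k \<Lambda> (r - 1) (bd k \<Lambda> r d)"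
    using hom_mult[OF uct_lift_hom, of "bd k \<Lambda> r c" "r - 1" "bd k \<Lambda> r d"]
    by (simp add: bd_in_cycle_group bd_add)
qed

lemma group_res_ker_homology: "group (res_ker (homology k \<Lambda> r))"
  using comm_group_res_ker[OF comm_group_homology] by (rule comm_group.axioms)

lemma lin_ext_alpha_cocycle:
  assumes A: "comm_group A" and g: "g \<in> hom (res_ker (homology k \<Lambda> (r - 1))) A"
    and c: "Poly_Mapping.keys c \<subseteq> cubes k \<Lambda> r"
  shows "lin_ext A (alpha_cocycle A r g) c = g (uct_lift k \<Lambda> (r - 1) (bd k \<Lambda> r c))"
proof -
  have "g \<circ> (\<lambda>c. uct_lift k \<Lambda> (r - 1) (bd k \<Lambda> r c)) \<in> hom (free_Abelian_group (cubes k \<Lambda> r)) A"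
    using hom_compose[OF uct_lift_bd_hom g] by (simp add: chains_def)
  from hom_free_Abelian_group_eq_lin_ext[OF A this _ c, of "alpha_cocycle A r g"]
  show ?thesis by (simp add: alpha_cocycle_def)
qed

lemma lin_ext_alpha_cocycle_cycle:
  assumes A: "comm_group A" and g: "g \<in> hom (res_ker (homology k \<Lambda> (r - 1))) A"
    and z: "z \<in> carrier (cycle_group k \<Lambda> r)"
  shows "lin_ext A (alpha_cocycle A r g) z = \<one>\<^bsub>A\<^esub>"
proof -
  have "uct_lift k \<Lambda> (r - 1) 0 = 0"
    using hom_one[OF uct_lift_hom group_cycle_group group_free_Abelian_group, of "r - 1"] by simp
  moreover have "g 0 = \<one>\<^bsub>A\<^esub>"
    using hom_one[OF g group_res_ker_homology comm_group.axioms(2)[OF A]] by simp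
  ultimately show ?thesis using z lin_ext_alpha_cocycle[OF A g] by (simp add: in_cycle_group_iff)
qed

lemma alpha_cocycle_hom:
  assumes A: "comm_group A"
  shows "alpha_cocycle A r \<in> hom (hom_group (res_ker (homology k \<Lambda> (r - 1))) A) (cocycle_group k \<Lambda> A r)"
proof (rule homI)
  fix g assume "g \<in> carrier (hom_group (res_ker (homology k \<Lambda> (r - 1))) A)"
  then have g: "g \<in> hom (res_ker (homology k \<Lambda> (r - 1))) A" by simp
  have "alpha_cocycle A r g \<in> cubes k \<Lambda> r \<rightarrow>\<^sub>E carrier A"
    using hom_in_carrier[OF g uct_lift_in_res_ker[OF bd_in_boundaries]] by (simp add: alpha_cocycle_def)
  moreover have "\<forall>b \<in> boundaries k \<Lambda> r. lin_ext A (alpha_cocycle A r g) b = \<one>\<^bsub>A\<^esub>"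
    using lin_ext_alpha_cocycle_cycle[OF A g boundaries_subset] by blast
  ultimately show "alpha_cocycle A r g \<in> carrier (cocycle_group k \<Lambda> A r)"
    by (simp add: in_cocycle_group_iff[OF A])
next
  fix f g
  show "alpha_cocycle A r (f \<otimes>\<^bsub>hom_group (res_ker (homology k \<Lambda> (r - 1))) A\<^esub> g) =
      alpha_cocycle A r f \<otimes>\<^bsub>cocycle_group k \<Lambda> A r\<^esub> alpha_cocycle A r g"
    unfolding mult_cocycle_group mult_hom_group alpha_cocycle_def
    by (rule restrict_ext) (simp add: uct_lift_in_res_ker[OF bd_in_boundaries])
qed

text \<open>If \<open>g\<close> extends to \<open>\<int>[H]\<close>, then \<open>g \<circ> \<sigma>\<close> is defined on all cycles and not only on boundaries.  So
  \<open>\<alpha>\<close> is well defined on \<open>Ext\<close>.\<close>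

lemma alpha_cocycle_ext_restr:
  assumes A: "comm_group A" and f: "f \<in> ext_restr (homology k \<Lambda> (r - 1)) A"
  shows "alpha_cocycle A r f \<in> coboundaries k \<Lambda> A r"
proof -
  obtain h where h: "h \<in> hom (free_Abelian_group (carrier (homology k \<Lambda> (r - 1)))) A"
    and f: "f = restrict h (carrier (res_ker (homology k \<Lambda> (r - 1))))"
    using f by (auto simp: in_ext_restr_iff)
  have "alpha_cocycle A r f = (\<lambda>\<rho>\<in>cubes k \<Lambda> r. (h \<circ> uct_lift k \<Lambda> (r - 1)) (bd k \<Lambda> r (frag_of \<rho>)))"
    unfolding alpha_cocycle_def f
    by (rule restrict_ext) (simp add: uct_lift_in_res_ker[OF bd_in_boundaries])
  then show ?thesis
    using coboundary_of_hom_cycle_group[OF A hom_compose[OF uct_lift_hom h]] by simp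
qed

lemma uct_alpha_eq: "uct_alpha k \<Lambda> A r = quot_map (cocycle_group k \<Lambda> A r) (coboundaries k \<Lambda> A r) (alpha_cocycle A r)"
  by (simp add: uct_alpha_def alpha_cocycle_def[abs_def])

lemma uct_alpha_r_coset:
  assumes A: "comm_group A" and g: "g \<in> carrier (hom_group (res_ker (homology k \<Lambda> (r - 1))) A)"
  shows "uct_alpha k \<Lambda> A r (ext_restr (homology k \<Lambda> (r - 1)) A #>\<^bsub>hom_group (res_ker (homology k \<Lambda> (r - 1))) A\<^esub> g) =
    coboundaries k \<Lambda> A r #>\<^bsub>cocycle_group k \<Lambda> A r\<^esub> alpha_cocycle A r g"
  unfolding uct_alpha_eq
  by (rule quot_map_r_coset[OF comm_group.axioms(2)[OF comm_group_hom_group[OF group_res_ker_homology A]]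
        comm_group.axioms(2)[OF comm_group_cocycle_group[OF A]]
        subgroup_ext_restr[OF comm_group_homology A] subgroup_coboundaries[OF A] alpha_cocycle_hom[OF A]
        alpha_cocycle_ext_restr[OF A] g])

lemma uct_alpha_hom:
  assumes A: "comm_group A"
  shows "uct_alpha k \<Lambda> A r \<in> hom (Ext (homology k \<Lambda> (r - 1)) A) (cohomology k \<Lambda> A r)"
  unfolding uct_alpha_eq Ext_def cohomology_def
  by (rule quot_map_hom[OF comm_group_hom_group[OF group_res_ker_homology A]
        comm_group_cocycle_group[OF A]
        subgroup_ext_restr[OF comm_group_homology A] subgroup_coboundaries[OF A] alpha_cocycle_hom[OF A]
        alpha_cocycle_ext_restr[OF A]])

lemma cohomology_cases:
  assumes "X \<in> carrier (cohomology k \<Lambda> A r)"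
  obtains f where "f \<in> carrier (cocycle_group k \<Lambda> A r)" "X = coboundaries k \<Lambda> A r #>\<^bsub>cocycle_group k \<Lambda> A r\<^esub> f"
  using assms by (auto simp: cohomology_def carrier_FactGroup)

text \<open>Injectivity of \<open>\<alpha>\<close>: if \<open>g\<sigma>\<partial> = h\<partial>\<close>, the extension of \<open>g\<close> to \<open>\<int>[H]\<close> is \<open>x \<mapsto> h(\<tau> x) + g(x - \<sigma>(\<tau> x))\<close>.
  On \<open>K\<close> the element \<open>\<tau> x\<close> is a boundary, so that \<open>h(\<tau> x) = g(\<sigma>(\<tau> x))\<close> there.\<close>

lemma ext_restr_if_alpha_cocycle_coboundary:
  assumes A: "comm_group A" and g: "g \<in> carrier (hom_group (res_ker (homology k \<Lambda> (r - 1))) A)"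
    and cob: "alpha_cocycle A r g \<in> coboundaries k \<Lambda> A r"
  shows "g \<in> ext_restr (homology k \<Lambda> (r - 1)) A"
proof -
  let ?H = "homology k \<Lambda> (r - 1)" and ?Z = "cycle_group k \<Lambda> (r - 1)" and ?\<sigma> = "uct_lift k \<Lambda> (r - 1)"
  interpret A: comm_group A by fact
  have g': "g \<in> hom (res_ker ?H) A" "g \<in> extensional (carrier (res_ker ?H))" using g by simp_all
  obtain h where h: "h \<in> hom (chains k \<Lambda> (r - 1)) A"
    and eq: "alpha_cocycle A r g = (\<lambda>\<rho>\<in>cubes k \<Lambda> r. h (bd k \<Lambda> r (frag_of \<rho>)))"
    using cob by (auto simp: in_coboundaries_iff[OF A])
  have gh: "g (?\<sigma> b) = h b" if b: "b \<in> boundaries k \<Lambda> (r - 1)" for b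
  proof -
    obtain c where c: "Poly_Mapping.keys c \<subseteq> cubes k \<Lambda> r" "b = bd k \<Lambda> r c"
      using b by (auto simp: boundaries_pred)
    then show ?thesis
      using lin_ext_alpha_cocycle[OF A g'(1) c(1)] lin_ext_coboundary[OF A h c(1)] by (simp add: eq)
  qed
  obtain \<tau> where \<tau>: "\<tau> \<in> hom (free_Abelian_group (carrier ?H)) ?Z"
    and \<tau>_aug: "\<And>x. Poly_Mapping.keys x \<subseteq> carrier ?H \<Longrightarrow> hclass (r - 1) (\<tau> x) = res_aug ?H x"
    using homology_lift[of "r - 1"] by blast
  have \<tau>Z: "\<tau> x \<in> carrier ?Z" if "Poly_Mapping.keys x \<subseteq> carrier ?H" for x
    using hom_in_carrier[OF \<tau>, of x] that by simp
  have \<tau>_add: "\<tau> (x + y) = \<tau> x + \<tau> y" if "Poly_Mapping.keys x \<subseteq> carrier ?H" "Poly_Mapping.keys y \<subseteq> carrier ?H" for x y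
    using hom_mult[OF \<tau>, of x y] that by simp
  have \<sigma>Z: "Poly_Mapping.keys (?\<sigma> z) \<subseteq> carrier ?H" if "z \<in> carrier ?Z" for z
    using hom_in_carrier[OF uct_lift_hom that] by simp
  have \<sigma>_add: "?\<sigma> (x + y) = ?\<sigma> x + ?\<sigma> y" if "x \<in> carrier ?Z" "y \<in> carrier ?Z" for x y
    using hom_mult[OF uct_lift_hom that] by simp
  \<comment> \<open>\<open>\<kappa> = 1 - \<sigma>\<tau>\<close> maps \<open>\<int>[H]\<close> into \<open>K\<close>, since \<open>x\<close> and \<open>\<sigma>(\<tau> x)\<close> have the same image in \<open>H\<close>.\<close>
  define \<kappa> where "\<kappa> x = x - ?\<sigma> (\<tau> x)" for x
  have \<kappa>: "\<kappa> \<in> hom (free_Abelian_group (carrier ?H)) (res_ker ?H)"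
  proof (rule hom_res_kerI)
    show "\<kappa> \<in> hom (free_Abelian_group (carrier ?H)) (free_Abelian_group (carrier ?H))"
      by (rule homI) (simp_all add: \<kappa>_def keys_minus_subset \<sigma>Z \<tau>Z \<tau>_add \<sigma>_add)
    fix x assume "x \<in> carrier (free_Abelian_group (carrier ?H))"
    then have x: "Poly_Mapping.keys x \<subseteq> carrier ?H" by simp
    have s: "Poly_Mapping.keys (?\<sigma> (\<tau> x)) \<subseteq> carrier ?H" by (intro \<sigma>Z \<tau>Z x)
    have "res_aug ?H x = res_aug ?H (\<kappa> x) \<otimes>\<^bsub>?H\<^esub> res_aug ?H (?\<sigma> (\<tau> x))"
      using hom_mult[OF res_aug_hom[OF comm_group_homology], of "\<kappa> x" "r - 1" "?\<sigma> (\<tau> x)"] x s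
      by (simp add: \<kappa>_def keys_minus_subset)
    moreover have "res_aug ?H (?\<sigma> (\<tau> x)) = res_aug ?H x"
      by (simp add: res_aug_uct_lift \<tau>Z \<tau>_aug x)
    ultimately show "res_aug ?H (\<kappa> x) = \<one>\<^bsub>?H\<^esub>"
      using group.r_cancel_one'[OF group_homology] hom_in_carrier[OF res_aug_hom[OF comm_group_homology]] x s
      by (simp add: \<kappa>_def keys_minus_subset)
  qed
  define e where "e x = h (\<tau> x) \<otimes>\<^bsub>A\<^esub> g (\<kappa> x)" for x
  have "h \<circ> \<tau> \<in> hom (free_Abelian_group (carrier ?H)) A"
    using hom_compose[OF \<tau> hom_chains_restrict[OF h]] .
  from hom_mult_pointwise[OF A this hom_compose[OF \<kappa> g'(1)]]
  have e: "e \<in> hom (free_Abelian_group (carrier ?H)) A" by (simp add: e_def[abs_def])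
  have "e x = g x" if x: "x \<in> carrier (res_ker ?H)" for x
  proof -
    have k: "Poly_Mapping.keys x \<subseteq> carrier ?H" using x by (simp add: carrier_res_ker)
    have b: "\<tau> x \<in> boundaries k \<Lambda> (r - 1)"
      using x \<tau>_aug[OF k] hclass_eq_one_iff[OF \<tau>Z[OF k]] by (simp add: carrier_res_ker)
    have \<kappa>x: "\<kappa> x \<in> carrier (res_ker ?H)" using hom_in_carrier[OF \<kappa>] k by simp
    have "g (?\<sigma> (\<tau> x)) \<otimes>\<^bsub>A\<^esub> g (\<kappa> x) = g (?\<sigma> (\<tau> x) + \<kappa> x)"
      using hom_mult[OF g'(1) uct_lift_in_res_ker[OF b] \<kappa>x] by simp
    then show ?thesis by (simp add: e_def gh[OF b, symmetric]) (simp add: \<kappa>_def)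
  qed
  then have "g = restrict e (carrier (res_ker ?H))"
    using g'(2) by (intro extensionalityI[of _ "carrier (res_ker ?H)"]) simp_all
  then show ?thesis using e by (auto simp: in_ext_restr_iff)
qed

lemma uct_alpha_mon:
  assumes A: "comm_group A"
  shows "uct_alpha k \<Lambda> A r \<in> mon (Ext (homology k \<Lambda> (r - 1)) A) (cohomology k \<Lambda> A r)"
proof -
  let ?H = "homology k \<Lambda> (r - 1)"
  have "X = \<one>\<^bsub>Ext ?H A\<^esub>"
    if X: "X \<in> carrier (Ext ?H A)" and one: "uct_alpha k \<Lambda> A r X = \<one>\<^bsub>cohomology k \<Lambda> A r\<^esub>" for X
  proof -
    obtain g where g: "g \<in> carrier (hom_group (res_ker ?H) A)"
      and Xg: "X = ext_restr ?H A #>\<^bsub>hom_group (res_ker ?H) A\<^esub> g" by (rule Ext_cases[OF X])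
    have "alpha_cocycle A r g \<in> coboundaries k \<Lambda> A r"
      using one uct_alpha_r_coset[OF A g] r_coset_eq_subgroup_iff[OF
          comm_group.axioms(2)[OF comm_group_cocycle_group[OF A]] subgroup_coboundaries[OF A]
          hom_in_carrier[OF alpha_cocycle_hom[OF A] g]]
      by (simp add: Xg cohomology_def)
    then have "g \<in> ext_restr ?H A" by (rule ext_restr_if_alpha_cocycle_coboundary[OF A g])
    then show ?thesis
      using r_coset_eq_subgroup_iff[OF comm_group.axioms(2)[OF comm_group_hom_group[OF group_res_ker_homology A]]
          subgroup_ext_restr[OF comm_group_homology A] g]
      by (simp add: Xg Ext_def)
  qed
  then show ?thesis
    unfolding mon_iff_hom_one[OF comm_group.axioms(2)[OF comm_group_Ext[OF comm_group_homology A]]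
        comm_group.axioms(2)[OF comm_group_cohomology[OF A]]]
    using uct_alpha_hom[OF A] by (intro conjI allI impI) simp_all
qed

section \<open>Evaluation of cocycles on cycles\<close>

text \<open>The value \<open>f(z)\<close> depends only on the classes: coboundaries vanish on cycles, and cocycles vanish
  on boundaries.\<close>

lemma uct_beta_r_coset:
  assumes A: "comm_group A" and f: "f \<in> carrier (cocycle_group k \<Lambda> A r)"
    and z: "z \<in> carrier (cycle_group k \<Lambda> r)"
  shows "uct_beta k \<Lambda> A r (coboundaries k \<Lambda> A r #>\<^bsub>cocycle_group k \<Lambda> A r\<^esub> f) (hclass r z) = lin_ext A f z"
proof -
  interpret A: comm_group A by fact
  let ?X = "coboundaries k \<Lambda> A r #>\<^bsub>cocycle_group k \<Lambda> A r\<^esub> f" and ?Y = "hclass r z"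
  have fA: "f \<rho> \<in> carrier A" if "\<rho> \<in> cubes k \<Lambda> r" for \<rho>
    using f that by (auto simp: in_cocycle_group_iff[OF A])
  have zC: "Poly_Mapping.keys z \<subseteq> cubes k \<Lambda> r" using z by (simp add: in_cycle_group_iff)
  have const: "lin_ext A f' z' = lin_ext A f z" if fz: "f' \<in> ?X" "z' \<in> ?Y" for f' z'
  proof -
    obtain n where n: "n \<in> coboundaries k \<Lambda> A r" and f': "f' = n \<otimes>\<^bsub>cocycle_group k \<Lambda> A r\<^esub> f"
      using fz(1) by (auto simp: r_coset_def)
    obtain b where b: "b \<in> boundaries k \<Lambda> r" and z': "z' = b + z"
      using fz(2) by (auto simp: r_coset_def)
    obtain h where h: "h \<in> hom (chains k \<Lambda> (r - 1)) A"
      and nh: "n = (\<lambda>\<rho>\<in>cubes k \<Lambda> r. h (bd k \<Lambda> r (frag_of \<rho>)))"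
      using n by (auto simp: in_coboundaries_iff[OF A])
    have nA: "n \<rho> \<in> carrier A" if "\<rho> \<in> cubes k \<Lambda> r" for \<rho>
      using hom_in_carrier[OF h] bd_in_chains[of "frag_of \<rho>" r] that by (simp add: nh)
    have bC: "Poly_Mapping.keys b \<subseteq> cubes k \<Lambda> r" and bdb: "bd k \<Lambda> r b = 0"
      using boundaries_subset[OF b] by (simp_all add: in_cycle_group_iff)
    have z'C: "Poly_Mapping.keys z' \<subseteq> cubes k \<Lambda> r" unfolding z' by (rule keys_plus_subset[OF bC zC])
    have "bd k \<Lambda> r z' = 0" using z bdb by (simp add: z' bd_add in_cycle_group_iff)
    then have n1: "lin_ext A n z' = \<one>\<^bsub>A\<^esub>"
      using lin_ext_coboundary[OF A h z'C] hom_one[OF h group_chains A.group_axioms] by (simp add: nh)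
    have "lin_ext A f' z' = lin_ext A (\<lambda>\<rho>. n \<rho> \<otimes>\<^bsub>A\<^esub> f \<rho>) z'"
      by (rule lin_ext_cong[OF A _ _ z'C]) (simp_all add: f' fA nA)
    also have "\<dots> = lin_ext A n z' \<otimes>\<^bsub>A\<^esub> lin_ext A f z'" by (rule lin_ext_mult[OF A nA fA z'C])
    also have "\<dots> = lin_ext A f z'" using n1 lin_ext_closed[OF A fA z'C] by simp
    also have "\<dots> = lin_ext A f b \<otimes>\<^bsub>A\<^esub> lin_ext A f z"
      using hom_mult[OF lin_ext_hom[OF A, of "cubes k \<Lambda> r" f], of b z] fA bC zC by (simp add: z')
    also have "\<dots> = lin_ext A f z"
      using f b lin_ext_closed[OF A fA zC] by (simp add: in_cocycle_group_iff[OF A])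
    finally show ?thesis .
  qed
  have "f \<in> ?X"
    by (rule group.rcos_self[OF comm_group.axioms(2)[OF comm_group_cocycle_group[OF A]] f subgroup_coboundaries[OF A]])
  moreover have "z \<in> ?Y" by (rule group.rcos_self[OF group_cycle_group z subgroup_boundaries])
  ultimately have "(f, z) \<in> ?X \<times> ?Y" by (rule SigmaI)
  then have ne: "?X \<times> ?Y \<noteq> {}" by blast
  have "the_elem ((\<lambda>(f, z). lin_ext A f z) ` (?X \<times> ?Y)) = (\<lambda>(f, z). lin_ext A f z) (f, z)"
  proof (rule the_elem_image_unique[OF ne])
    fix p assume "p \<in> ?X \<times> ?Y"
    then have "fst p \<in> ?X" "snd p \<in> ?Y" by (simp_all only: mem_Times_iff)
    from const[OF this] show "(\<lambda>(f, z). lin_ext A f z) p = (\<lambda>(f, z). lin_ext A f z) (f, z)"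
      by (simp add: case_prod_unfold)
  qed
  then show ?thesis
    using hom_in_carrier[OF hclass_hom z] by (simp add: uct_beta_def)
qed

lemma uct_beta_in_hom_group:
  assumes A: "comm_group A" and f: "f \<in> carrier (cocycle_group k \<Lambda> A r)"
  shows "uct_beta k \<Lambda> A r (coboundaries k \<Lambda> A r #>\<^bsub>cocycle_group k \<Lambda> A r\<^esub> f) \<in> carrier (hom_group (homology k \<Lambda> r) A)"
proof -
  let ?b = "uct_beta k \<Lambda> A r (coboundaries k \<Lambda> A r #>\<^bsub>cocycle_group k \<Lambda> A r\<^esub> f)"
  interpret A: comm_group A by fact
  have fA: "f \<rho> \<in> carrier A" if "\<rho> \<in> cubes k \<Lambda> r" for \<rho>
    using f that by (auto simp: in_cocycle_group_iff[OF A])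
  have "?b \<in> hom (homology k \<Lambda> r) A"
  proof (rule homI)
    fix Y assume "Y \<in> carrier (homology k \<Lambda> r)"
    then obtain z where z: "z \<in> carrier (cycle_group k \<Lambda> r)" "Y = hclass r z" by (rule homology_cases)
    then show "?b Y \<in> carrier A"
      using lin_ext_closed[OF A, of "cubes k \<Lambda> r" f z] fA uct_beta_r_coset[OF A f z(1)]
      by (simp add: in_cycle_group_iff)
  next
    fix Y Y' assume "Y \<in> carrier (homology k \<Lambda> r)" "Y' \<in> carrier (homology k \<Lambda> r)"
    then obtain z z' where z: "z \<in> carrier (cycle_group k \<Lambda> r)" "Y = hclass r z"
      and z': "z' \<in> carrier (cycle_group k \<Lambda> r)" "Y' = hclass r z'" by (meson homology_cases)
    have "z + z' \<in> carrier (cycle_group k \<Lambda> r)"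
      using z z' by (simp add: in_cycle_group_iff keys_plus_subset bd_add)
    moreover have "Y \<otimes>\<^bsub>homology k \<Lambda> r\<^esub> Y' = hclass r (z + z')"
      using hom_mult[OF hclass_hom z(1) z'(1)] by (simp add: z z')
    moreover have "lin_ext A f (z + z') = lin_ext A f z \<otimes>\<^bsub>A\<^esub> lin_ext A f z'"
      using hom_mult[OF lin_ext_hom[OF A, of "cubes k \<Lambda> r" f], of z z'] fA z z' by (simp add: in_cycle_group_iff)
    ultimately show "?b (Y \<otimes>\<^bsub>homology k \<Lambda> r\<^esub> Y') = ?b Y \<otimes>\<^bsub>A\<^esub> ?b Y'"
      using uct_beta_r_coset[OF A f] z z' by simp
  qed
  then show ?thesis by (simp add: uct_beta_def)
qed

lemma uct_beta_hom:
  assumes A: "comm_group A"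
  shows "uct_beta k \<Lambda> A r \<in> hom (cohomology k \<Lambda> A r) (hom_group (homology k \<Lambda> r) A)"
proof (rule homI)
  fix X assume "X \<in> carrier (cohomology k \<Lambda> A r)"
  then show "uct_beta k \<Lambda> A r X \<in> carrier (hom_group (homology k \<Lambda> r) A)"
    using uct_beta_in_hom_group[OF A] by (metis cohomology_cases)
next
  interpret A: comm_group A by fact
  interpret Z: comm_group "cocycle_group k \<Lambda> A r" by (rule comm_group_cocycle_group[OF A])
  interpret N: normal "coboundaries k \<Lambda> A r" "cocycle_group k \<Lambda> A r"
    by (rule Z.subgroup_imp_normal[OF subgroup_coboundaries[OF A]])
  fix X X' assume "X \<in> carrier (cohomology k \<Lambda> A r)" "X' \<in> carrier (cohomology k \<Lambda> A r)"
  then obtain f f' where f: "f \<in> carrier (cocycle_group k \<Lambda> A r)" "X = coboundaries k \<Lambda> A r #>\<^bsub>cocycle_group k \<Lambda> A r\<^esub> f"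
    and f': "f' \<in> carrier (cocycle_group k \<Lambda> A r)" "X' = coboundaries k \<Lambda> A r #>\<^bsub>cocycle_group k \<Lambda> A r\<^esub> f'"
    by (meson cohomology_cases)
  have XX: "X \<otimes>\<^bsub>cohomology k \<Lambda> A r\<^esub> X' = coboundaries k \<Lambda> A r #>\<^bsub>cocycle_group k \<Lambda> A r\<^esub> (f \<otimes>\<^bsub>cocycle_group k \<Lambda> A r\<^esub> f')"
    using N.rcos_sum[OF f(1) f'(1)] by (simp add: cohomology_def f f')
  have fA: "f \<rho> \<in> carrier A" "f' \<rho> \<in> carrier A" if "\<rho> \<in> cubes k \<Lambda> r" for \<rho>
    using f(1) f'(1) that by (auto simp: in_cocycle_group_iff[OF A])
  show "uct_beta k \<Lambda> A r (X \<otimes>\<^bsub>cohomology k \<Lambda> A r\<^esub> X') =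
      uct_beta k \<Lambda> A r X \<otimes>\<^bsub>hom_group (homology k \<Lambda> r) A\<^esub> uct_beta k \<Lambda> A r X'"
    unfolding XX
  proof (rule extensionalityI[of _ "carrier (homology k \<Lambda> r)"])
    fix Y assume Y: "Y \<in> carrier (homology k \<Lambda> r)"
    then obtain z where z: "z \<in> carrier (cycle_group k \<Lambda> r)" "Y = hclass r z" by (rule homology_cases)
    then have zC: "Poly_Mapping.keys z \<subseteq> cubes k \<Lambda> r" by (simp add: in_cycle_group_iff)
    have "lin_ext A (f \<otimes>\<^bsub>cocycle_group k \<Lambda> A r\<^esub> f') z = lin_ext A (\<lambda>\<rho>. f \<rho> \<otimes>\<^bsub>A\<^esub> f' \<rho>) z"
      by (rule lin_ext_cong[OF A _ _ zC]) (simp_all add: fA)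
    also have "\<dots> = lin_ext A f z \<otimes>\<^bsub>A\<^esub> lin_ext A f' z" by (rule lin_ext_mult[OF A fA zC])
    finally show "uct_beta k \<Lambda> A r (coboundaries k \<Lambda> A r #>\<^bsub>cocycle_group k \<Lambda> A r\<^esub> (f \<otimes>\<^bsub>cocycle_group k \<Lambda> A r\<^esub> f')) Y =
      (uct_beta k \<Lambda> A r X \<otimes>\<^bsub>hom_group (homology k \<Lambda> r) A\<^esub> uct_beta k \<Lambda> A r X') Y"
      unfolding mult_hom_group restrict_apply'[OF Y] unfolding f(2) f'(2) z(2) uct_beta_r_coset[OF A Z.m_closed[OF f(1) f'(1)] z(1)]
        uct_beta_r_coset[OF A f(1) z(1)] uct_beta_r_coset[OF A f'(1) z(1)] .
  qed (simp_all add: uct_beta_def)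
qed

lemma cocycle_of_hom:
  assumes A: "comm_group A" and h: "h \<in> hom (chains k \<Lambda> r) A"
    and b: "\<And>b. b \<in> boundaries k \<Lambda> r \<Longrightarrow> h b = \<one>\<^bsub>A\<^esub>"
  shows "(\<lambda>\<rho>\<in>cubes k \<Lambda> r. h (frag_of \<rho>)) \<in> carrier (cocycle_group k \<Lambda> A r)"
    and "Poly_Mapping.keys c \<subseteq> cubes k \<Lambda> r \<Longrightarrow> lin_ext A (\<lambda>\<rho>\<in>cubes k \<Lambda> r. h (frag_of \<rho>)) c = h c"
proof -
  have eq: "lin_ext A (\<lambda>\<rho>\<in>cubes k \<Lambda> r. h (frag_of \<rho>)) c = h c" if "Poly_Mapping.keys c \<subseteq> cubes k \<Lambda> r" for c
    by (rule hom_free_Abelian_group_eq_lin_ext[OF A h[unfolded chains_def] _ that]) simp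
  then show "Poly_Mapping.keys c \<subseteq> cubes k \<Lambda> r \<Longrightarrow> lin_ext A (\<lambda>\<rho>\<in>cubes k \<Lambda> r. h (frag_of \<rho>)) c = h c" .
  have "\<forall>b \<in> boundaries k \<Lambda> r. lin_ext A (\<lambda>\<rho>\<in>cubes k \<Lambda> r. h (frag_of \<rho>)) b = \<one>\<^bsub>A\<^esub>"
    using boundaries_subset b eq by (simp add: in_cycle_group_iff)
  moreover have "(\<lambda>\<rho>\<in>cubes k \<Lambda> r. h (frag_of \<rho>)) \<in> cubes k \<Lambda> r \<rightarrow>\<^sub>E carrier A"
    using hom_in_carrier[OF h] by simp
  ultimately show "(\<lambda>\<rho>\<in>cubes k \<Lambda> r. h (frag_of \<rho>)) \<in> carrier (cocycle_group k \<Lambda> A r)"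
    by (simp add: in_cocycle_group_iff[OF A])
qed

text \<open>A homomorphism on homology, pulled back to the cycles, extends to the chains; the extension
  vanishes on boundaries and is therefore a cocycle.\<close>

lemma uct_beta_epi:
  assumes A: "comm_group A"
  shows "uct_beta k \<Lambda> A r \<in> epi (cohomology k \<Lambda> A r) (hom_group (homology k \<Lambda> r) A)"
proof -
  let ?H = "homology k \<Lambda> r"
  have "\<phi> \<in> uct_beta k \<Lambda> A r ` carrier (cohomology k \<Lambda> A r)" if "\<phi> \<in> carrier (hom_group ?H A)" for \<phi>
  proof -
    have \<phi>: "\<phi> \<in> hom ?H A" "\<phi> \<in> extensional (carrier ?H)" using that by simp_all
    obtain h where h: "h \<in> hom (chains k \<Lambda> r) A"
      and hz: "\<And>z. z \<in> carrier (cycle_group k \<Lambda> r) \<Longrightarrow> h z = (\<phi> \<circ> hclass r) z"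
      using hom_cycle_group_extends[OF hom_compose[OF hclass_hom \<phi>(1)]] by blast
    let ?f = "\<lambda>\<rho>\<in>cubes k \<Lambda> r. h (frag_of \<rho>)"
    have "h b = \<one>\<^bsub>A\<^esub>" if b: "b \<in> boundaries k \<Lambda> r" for b
      using hz[OF boundaries_subset[OF b]] hclass_eq_one_iff[OF boundaries_subset[OF b]] b
        hom_one[OF \<phi>(1) group_homology comm_group.axioms(2)[OF A]] by simp
    note f = cocycle_of_hom[OF A h this]
    have "uct_beta k \<Lambda> A r (coboundaries k \<Lambda> A r #>\<^bsub>cocycle_group k \<Lambda> A r\<^esub> ?f) = \<phi>"
    proof (rule extensionalityI[of _ "carrier ?H"])
      fix Y assume "Y \<in> carrier ?H"
      then obtain z where z: "z \<in> carrier (cycle_group k \<Lambda> r)" "Y = hclass r z" by (rule homology_cases)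
      then show "uct_beta k \<Lambda> A r (coboundaries k \<Lambda> A r #>\<^bsub>cocycle_group k \<Lambda> A r\<^esub> ?f) Y = \<phi> Y"
        using uct_beta_r_coset[OF A f(1) z(1)] f(2)[of z] hz[OF z(1)] by (simp add: in_cycle_group_iff)
    qed (simp_all add: uct_beta_def \<phi>(2))
    moreover have "coboundaries k \<Lambda> A r #>\<^bsub>cocycle_group k \<Lambda> A r\<^esub> ?f \<in> carrier (cohomology k \<Lambda> A r)"
      using f(1) by (simp add: cohomology_def carrier_FactGroup)
    ultimately show ?thesis by blast
  qed
  then show ?thesis using uct_beta_hom[OF A] by (simp add: epi_iff_subset subset_iff)
qed

section \<open>Exactness in the middle\<close>

text \<open>Such an \<open>f\<close> factors as \<open>q \<circ> \<partial>\<close> with \<open>q\<close> defined on boundaries.  Applied to \<open>b = (b - \<tau>(\<sigma> b)) + \<tau>(\<sigma> b)\<close>,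
  the first part of \<open>q\<close> extends from boundaries to all cycles, because \<open>z - \<tau>(\<sigma> z)\<close> is a boundary for
  every cycle \<open>z\<close>, and gives a coboundary; the second part is the cocycle of \<open>g = q \<circ> \<tau>\<close> on \<open>K\<close>.\<close>

lemma cocycle_vanishing_on_cycles_decomposes:
  assumes A: "comm_group A" and f: "f \<in> carrier (cocycle_group k \<Lambda> A r)"
    and f1: "\<And>z. z \<in> carrier (cycle_group k \<Lambda> r) \<Longrightarrow> lin_ext A f z = \<one>\<^bsub>A\<^esub>"
  obtains g n where "g \<in> carrier (hom_group (res_ker (homology k \<Lambda> (r - 1))) A)"
    and "n \<in> coboundaries k \<Lambda> A r" and "f = n \<otimes>\<^bsub>cocycle_group k \<Lambda> A r\<^esub> alpha_cocycle A r g"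
proof -
  let ?H = "homology k \<Lambda> (r - 1)" and ?Z = "cycle_group k \<Lambda> (r - 1)" and ?\<sigma> = "uct_lift k \<Lambda> (r - 1)"
  let ?B = "boundaries k \<Lambda> (r - 1)"
  interpret A: comm_group A by fact
  have fA: "f \<rho> \<in> carrier A" if "\<rho> \<in> cubes k \<Lambda> r" for \<rho>
    using f that by (auto simp: in_cocycle_group_iff[OF A])
  have fadd: "lin_ext A f (x + y) = lin_ext A f x \<otimes>\<^bsub>A\<^esub> lin_ext A f y"
    if "Poly_Mapping.keys x \<subseteq> cubes k \<Lambda> r" "Poly_Mapping.keys y \<subseteq> cubes k \<Lambda> r" for x y
    using hom_mult[OF lin_ext_hom[OF A, of "cubes k \<Lambda> r" f], of x y] fA that by simp
  obtain s where s_add: "\<And>x y. x \<in> ?B \<Longrightarrow> y \<in> ?B \<Longrightarrow> s (x + y) = s x + s y"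
    and sC: "\<And>b. b \<in> ?B \<Longrightarrow> Poly_Mapping.keys (s b) \<subseteq> cubes k \<Lambda> r"
    and sb: "\<And>b. b \<in> ?B \<Longrightarrow> bd k \<Lambda> r (s b) = b" using bd_section[of r] by blast
  \<comment> \<open>As \<open>f\<close> vanishes on cycles, \<open>f c\<close> depends only on \<open>\<partial> c\<close>; \<open>q\<close> is this function of \<open>\<partial> c\<close>.\<close>
  define q where "q b = lin_ext A f (s b)" for b
  have qA: "q b \<in> carrier A" if "b \<in> ?B" for b
    unfolding q_def using lin_ext_closed[OF A fA sC[OF that]] .
  have q_add: "q (x + y) = q x \<otimes>\<^bsub>A\<^esub> q y" if "x \<in> ?B" "y \<in> ?B" for x y
    using that by (simp add: q_def s_add fadd sC)
  have fq: "lin_ext A f c = q (bd k \<Lambda> r c)" if c: "Poly_Mapping.keys c \<subseteq> cubes k \<Lambda> r" for c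
  proof -
    let ?b = "bd k \<Lambda> r c"
    have b: "?b \<in> ?B" by (rule bd_in_boundaries[OF c])
    have z: "c - s ?b \<in> carrier (cycle_group k \<Lambda> r)"
      using c sC[OF b] by (simp add: in_cycle_group_iff keys_minus_subset bd_diff sb[OF b])
    have "lin_ext A f (c - s ?b + s ?b) = lin_ext A f (c - s ?b) \<otimes>\<^bsub>A\<^esub> q ?b"
      using z sC[OF b] unfolding q_def by (intro fadd) (simp_all add: in_cycle_group_iff)
    then show ?thesis using f1[OF z] qA[OF b] by simp
  qed
  obtain \<tau> where \<tau>: "\<tau> \<in> hom (free_Abelian_group (carrier ?H)) ?Z"
    and \<tau>_aug: "\<And>x. Poly_Mapping.keys x \<subseteq> carrier ?H \<Longrightarrow> hclass (r - 1) (\<tau> x) = res_aug ?H x"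
    using homology_lift[of "r - 1"] by blast
  have \<tau>Z: "\<tau> x \<in> carrier ?Z" if "Poly_Mapping.keys x \<subseteq> carrier ?H" for x
    using hom_in_carrier[OF \<tau>, of x] that by simp
  have \<tau>_add: "\<tau> (x + y) = \<tau> x + \<tau> y" if "Poly_Mapping.keys x \<subseteq> carrier ?H" "Poly_Mapping.keys y \<subseteq> carrier ?H" for x y
    using hom_mult[OF \<tau>, of x y] that by simp
  have \<sigma>Z: "Poly_Mapping.keys (?\<sigma> z) \<subseteq> carrier ?H" if "z \<in> carrier ?Z" for z
    using hom_in_carrier[OF uct_lift_hom that] by simp
  have \<sigma>_add: "?\<sigma> (x + y) = ?\<sigma> x + ?\<sigma> y" if "x \<in> carrier ?Z" "y \<in> carrier ?Z" for x y
    using hom_mult[OF uct_lift_hom that] by simp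
  have \<tau>B: "\<tau> x \<in> ?B" if "x \<in> carrier (res_ker ?H)" for x
    using that \<tau>_aug[of x] hclass_eq_one_iff[OF \<tau>Z, of x] by (simp add: carrier_res_ker)
  define g where "g = (\<lambda>x\<in>carrier (res_ker ?H). q (\<tau> x))"
  have "(\<lambda>x. q (\<tau> x)) \<in> hom (res_ker ?H) A"
    by (rule homI) (simp_all add: qA \<tau>B q_add[symmetric] \<tau>_add carrier_res_ker)
  then have g: "g \<in> carrier (hom_group (res_ker ?H) A)"
    using restrict_hom[OF group_res_ker_homology] by (simp add: g_def)
  \<comment> \<open>\<open>e = 1 - \<tau>\<sigma>\<close> maps cycles to boundaries, since \<open>z\<close> and \<open>\<tau>(\<sigma> z)\<close> are homologous.\<close>
  define e where "e z = z - \<tau> (?\<sigma> z)" for z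
  have eB: "e z \<in> ?B" if z: "z \<in> carrier ?Z" for z
  proof -
    have t: "\<tau> (?\<sigma> z) \<in> carrier ?Z" by (intro \<tau>Z \<sigma>Z z)
    have ez: "e z \<in> carrier ?Z" using z t by (simp add: e_def in_cycle_group_iff keys_minus_subset bd_diff)
    have "hclass (r - 1) z = hclass (r - 1) (e z) \<otimes>\<^bsub>?H\<^esub> hclass (r - 1) (\<tau> (?\<sigma> z))"
      using hom_mult[OF hclass_hom ez t] by (simp add: e_def)
    moreover have "hclass (r - 1) (\<tau> (?\<sigma> z)) = hclass (r - 1) z"
      by (simp add: \<tau>_aug \<sigma>Z z res_aug_uct_lift)
    ultimately have "hclass (r - 1) (e z) = \<one>\<^bsub>?H\<^esub>"
      using group.r_cancel_one'[OF group_homology hom_in_carrier[OF hclass_hom z] hom_in_carrier[OF hclass_hom ez]]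
      by simp
    then show ?thesis using hclass_eq_one_iff[OF ez] by simp
  qed
  have e_add: "e (x + y) = e x + e y" if "x \<in> carrier ?Z" "y \<in> carrier ?Z" for x y
    using that by (simp add: e_def \<tau>_add \<sigma>_add \<sigma>Z)
  have qe: "(\<lambda>z. q (e z)) \<in> hom ?Z A"
    by (rule homI) (simp_all add: qA eB q_add[symmetric] e_add)
  define n where "n = (\<lambda>\<rho>\<in>cubes k \<Lambda> r. q (e (bd k \<Lambda> r (frag_of \<rho>))))"
  have n: "n \<in> coboundaries k \<Lambda> A r"
    unfolding n_def by (rule coboundary_of_hom_cycle_group[OF A qe])
  have "f = n \<otimes>\<^bsub>cocycle_group k \<Lambda> A r\<^esub> alpha_cocycle A r g"
  proof (rule extensionalityI[of _ "cubes k \<Lambda> r"])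
    show "f \<in> extensional (cubes k \<Lambda> r)" using f by (simp add: in_cocycle_group_iff[OF A] PiE_def)
    fix \<rho> assume \<rho>: "\<rho> \<in> cubes k \<Lambda> r"
    let ?b = "bd k \<Lambda> r (frag_of \<rho>)"
    have b: "?b \<in> ?B" using \<rho> by (intro bd_in_boundaries) simp
    have t: "\<tau> (?\<sigma> ?b) \<in> ?B" by (intro \<tau>B uct_lift_in_res_ker b)
    have "f \<rho> = q ?b" using fq[of "frag_of \<rho>"] \<rho> fA[OF \<rho>] lin_ext_frag_of[OF A, of f \<rho>] by simp
    also have "\<dots> = q (e ?b + \<tau> (?\<sigma> ?b))" by (simp add: e_def)
    also have "\<dots> = q (e ?b) \<otimes>\<^bsub>A\<^esub> q (\<tau> (?\<sigma> ?b))" by (rule q_add[OF eB[OF boundaries_subset[OF b]] t])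
    also have "\<dots> = (n \<otimes>\<^bsub>cocycle_group k \<Lambda> A r\<^esub> alpha_cocycle A r g) \<rho>"
      using \<rho> uct_lift_in_res_ker[OF b] by (simp add: n_def alpha_cocycle_def g_def)
    finally show "f \<rho> = (n \<otimes>\<^bsub>cocycle_group k \<Lambda> A r\<^esub> alpha_cocycle A r g) \<rho>" .
  qed simp
  then show thesis by (rule that[OF g n])
qed

lemma uct_exact_middle:
  assumes A: "comm_group A"
  shows "uct_alpha k \<Lambda> A r ` carrier (Ext (homology k \<Lambda> (r - 1)) A) =
    kernel (cohomology k \<Lambda> A r) (hom_group (homology k \<Lambda> r) A) (uct_beta k \<Lambda> A r)"
proof
  let ?H = "homology k \<Lambda> (r - 1)"
  show "uct_alpha k \<Lambda> A r ` carrier (Ext ?H A) \<subseteq>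
      kernel (cohomology k \<Lambda> A r) (hom_group (homology k \<Lambda> r) A) (uct_beta k \<Lambda> A r)"
  proof
    fix X assume "X \<in> uct_alpha k \<Lambda> A r ` carrier (Ext ?H A)"
    then obtain W where W: "W \<in> carrier (Ext ?H A)" and X: "X = uct_alpha k \<Lambda> A r W" by blast
    obtain g where g: "g \<in> carrier (hom_group (res_ker ?H) A)"
      and Wg: "W = ext_restr ?H A #>\<^bsub>hom_group (res_ker ?H) A\<^esub> g" by (rule Ext_cases[OF W])
    note a = hom_in_carrier[OF alpha_cocycle_hom[OF A] g]
    have Xa: "X = coboundaries k \<Lambda> A r #>\<^bsub>cocycle_group k \<Lambda> A r\<^esub> alpha_cocycle A r g"
      unfolding X Wg by (rule uct_alpha_r_coset[OF A g])
    have "uct_beta k \<Lambda> A r X = \<one>\<^bsub>hom_group (homology k \<Lambda> r) A\<^esub>"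
    proof (rule extensionalityI[of _ "carrier (homology k \<Lambda> r)"])
      fix Y assume Y: "Y \<in> carrier (homology k \<Lambda> r)"
      then obtain z where z: "z \<in> carrier (cycle_group k \<Lambda> r)" "Y = hclass r z" by (rule homology_cases)
      then show "uct_beta k \<Lambda> A r X Y = \<one>\<^bsub>hom_group (homology k \<Lambda> r) A\<^esub> Y"
        using uct_beta_r_coset[OF A a z(1)] lin_ext_alpha_cocycle_cycle[OF A _ z(1), of g] g Y
        by (simp add: Xa)
    qed (simp_all add: uct_beta_def)
    moreover have "X \<in> carrier (cohomology k \<Lambda> A r)"
      unfolding X by (rule hom_in_carrier[OF uct_alpha_hom[OF A] W])
    ultimately show "X \<in> kernel (cohomology k \<Lambda> A r) (hom_group (homology k \<Lambda> r) A) (uct_beta k \<Lambda> A r)"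
      by (simp add: kernel_def)
  qed
  show "kernel (cohomology k \<Lambda> A r) (hom_group (homology k \<Lambda> r) A) (uct_beta k \<Lambda> A r) \<subseteq>
      uct_alpha k \<Lambda> A r ` carrier (Ext ?H A)"
  proof
    fix X assume "X \<in> kernel (cohomology k \<Lambda> A r) (hom_group (homology k \<Lambda> r) A) (uct_beta k \<Lambda> A r)"
    then have X: "X \<in> carrier (cohomology k \<Lambda> A r)"
      and one: "uct_beta k \<Lambda> A r X = \<one>\<^bsub>hom_group (homology k \<Lambda> r) A\<^esub>" by (simp_all add: kernel_def)
    obtain f where f: "f \<in> carrier (cocycle_group k \<Lambda> A r)"
      and Xf: "X = coboundaries k \<Lambda> A r #>\<^bsub>cocycle_group k \<Lambda> A r\<^esub> f" by (rule cohomology_cases[OF X])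
    have "lin_ext A f z = \<one>\<^bsub>A\<^esub>" if z: "z \<in> carrier (cycle_group k \<Lambda> r)" for z
      using uct_beta_r_coset[OF A f z] fun_cong[OF one, of "hclass r z"] hom_in_carrier[OF hclass_hom z]
      by (simp add: Xf)
    then obtain g n where g: "g \<in> carrier (hom_group (res_ker ?H) A)" and n: "n \<in> coboundaries k \<Lambda> A r"
      and fn: "f = n \<otimes>\<^bsub>cocycle_group k \<Lambda> A r\<^esub> alpha_cocycle A r g"
      using cocycle_vanishing_on_cycles_decomposes[OF A f] by blast
    have "X = coboundaries k \<Lambda> A r #>\<^bsub>cocycle_group k \<Lambda> A r\<^esub> alpha_cocycle A r g"
      unfolding Xf fn
      by (rule r_coset_eqI[OF comm_group.axioms(2)[OF comm_group_cocycle_group[OF A]] subgroup_coboundaries[OF A] n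
            hom_in_carrier[OF alpha_cocycle_hom[OF A] g]])
    also have "\<dots> = uct_alpha k \<Lambda> A r (ext_restr ?H A #>\<^bsub>hom_group (res_ker ?H) A\<^esub> g)"
      by (rule uct_alpha_r_coset[OF A g, symmetric])
    finally have "X = uct_alpha k \<Lambda> A r (ext_restr ?H A #>\<^bsub>hom_group (res_ker ?H) A\<^esub> g)" .
    moreover have "ext_restr ?H A #>\<^bsub>hom_group (res_ker ?H) A\<^esub> g \<in> carrier (Ext ?H A)"
      using g unfolding Ext_def carrier_FactGroup by (rule imageI)
    ultimately show "X \<in> uct_alpha k \<Lambda> A r ` carrier (Ext ?H A)" by (rule image_eqI)
  qed
qed

theorem uct_short_exact:
  assumes A: "comm_group A"
  shows "short_exact (Ext (homology k \<Lambda> (r - 1)) A) (cohomology k \<Lambda> A r) (hom_group (homology k \<Lambda> r) A)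
     (uct_alpha k \<Lambda> A r) (uct_beta k \<Lambda> A r)"
  unfolding short_exact_def
  using comm_group_Ext[OF comm_group_homology A] comm_group_cohomology[OF A]
    comm_group_hom_group[OF group_homology A] uct_alpha_mon[OF A] uct_beta_epi[OF A] uct_exact_middle[OF A]
  by blast

end

section \<open>Naturality\<close>

context k_graph
begin

lemma cohomology_post_r_coset:
  assumes A: "comm_group A" and B: "comm_group B" and \<psi>: "\<psi> \<in> hom A B"
    and f: "f \<in> carrier (cocycle_group k \<Lambda> A r)"
  shows "(\<lambda>\<rho>\<in>cubes k \<Lambda> r. \<psi> (f \<rho>)) \<in> carrier (cocycle_group k \<Lambda> B r)"
    and "cohomology_post k \<Lambda> B r \<psi> (coboundaries k \<Lambda> A r #>\<^bsub>cocycle_group k \<Lambda> A r\<^esub> f) =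
      coboundaries k \<Lambda> B r #>\<^bsub>cocycle_group k \<Lambda> B r\<^esub> (\<lambda>\<rho>\<in>cubes k \<Lambda> r. \<psi> (f \<rho>))"
proof -
  let ?p = "\<lambda>f. \<lambda>\<rho>\<in>cubes k \<Lambda> r. \<psi> (f \<rho>)"
  have p: "?p f \<in> carrier (cocycle_group k \<Lambda> B r)" if f: "f \<in> carrier (cocycle_group k \<Lambda> A r)" for f
  proof -
    have fA: "f \<rho> \<in> carrier A" if "\<rho> \<in> cubes k \<Lambda> r" for \<rho>
      using f that by (auto simp: in_cocycle_group_iff[OF A])
    have "lin_ext B (?p f) b = \<one>\<^bsub>B\<^esub>" if b: "b \<in> boundaries k \<Lambda> r" for b
    proof -
      have bC: "Poly_Mapping.keys b \<subseteq> cubes k \<Lambda> r"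
        using boundaries_subset[OF b] by (simp add: in_cycle_group_iff)
      have "lin_ext B (?p f) b = lin_ext B (\<lambda>\<rho>. \<psi> (f \<rho>)) b"
        by (rule lin_ext_cong[OF B _ _ bC]) (simp_all add: hom_in_carrier[OF \<psi> fA])
      also have "\<dots> = \<psi> (lin_ext A f b)" by (rule lin_ext_hom_image[OF A B \<psi> fA bC, symmetric])
      also have "\<dots> = \<one>\<^bsub>B\<^esub>"
        using f b hom_one[OF \<psi> comm_group.axioms(2)[OF A] comm_group.axioms(2)[OF B]]
        by (simp add: in_cocycle_group_iff[OF A])
      finally show ?thesis .
    qed
    then show ?thesis using hom_in_carrier[OF \<psi> fA] by (simp add: in_cocycle_group_iff[OF B])
  qed
  show "?p f \<in> carrier (cocycle_group k \<Lambda> B r)" by (rule p[OF f])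
  have hom: "?p \<in> hom (cocycle_group k \<Lambda> A r) (cocycle_group k \<Lambda> B r)"
  proof (rule homI)
    fix f g assume "f \<in> carrier (cocycle_group k \<Lambda> A r)" "g \<in> carrier (cocycle_group k \<Lambda> A r)"
    then have "f \<rho> \<in> carrier A" "g \<rho> \<in> carrier A" if "\<rho> \<in> cubes k \<Lambda> r" for \<rho>
      using that by (auto simp: in_cocycle_group_iff[OF A])
    then show "?p (f \<otimes>\<^bsub>cocycle_group k \<Lambda> A r\<^esub> g) = ?p f \<otimes>\<^bsub>cocycle_group k \<Lambda> B r\<^esub> ?p g"
      unfolding mult_cocycle_group by (intro restrict_ext) (simp add: hom_mult[OF \<psi>])
  qed (rule p)
  have cob: "?p n \<in> coboundaries k \<Lambda> B r" if n: "n \<in> coboundaries k \<Lambda> A r" for n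
  proof -
    obtain h where h: "h \<in> hom (chains k \<Lambda> (r - 1)) A"
      and nh: "n = (\<lambda>\<rho>\<in>cubes k \<Lambda> r. h (bd k \<Lambda> r (frag_of \<rho>)))"
      using n by (auto simp: in_coboundaries_iff[OF A])
    have "?p n = (\<lambda>\<rho>\<in>cubes k \<Lambda> r. (\<psi> \<circ> h) (bd k \<Lambda> r (frag_of \<rho>)))"
      unfolding nh by (rule restrict_ext) simp
    then show ?thesis using hom_compose[OF h \<psi>] unfolding in_coboundaries_iff[OF B] by blast
  qed
  show "cohomology_post k \<Lambda> B r \<psi> (coboundaries k \<Lambda> A r #>\<^bsub>cocycle_group k \<Lambda> A r\<^esub> f) =
      coboundaries k \<Lambda> B r #>\<^bsub>cocycle_group k \<Lambda> B r\<^esub> ?p f"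
    unfolding cohomology_post_def
    by (rule quot_map_r_coset[OF comm_group.axioms(2)[OF comm_group_cocycle_group[OF A]]
          comm_group.axioms(2)[OF comm_group_cocycle_group[OF B]]
          subgroup_coboundaries[OF A] subgroup_coboundaries[OF B] hom cob f])
qed

theorem uct_alpha_natural_coefficients:
  assumes A: "comm_group A" and B: "comm_group B" and \<psi>: "\<psi> \<in> hom A B"
    and X: "X \<in> carrier (Ext (homology k \<Lambda> (r - 1)) A)"
  shows "cohomology_post k \<Lambda> B r \<psi> (uct_alpha k \<Lambda> A r X) =
    uct_alpha k \<Lambda> B r (Ext_post (homology k \<Lambda> (r - 1)) B \<psi> X)"
proof -
  let ?H = "homology k \<Lambda> (r - 1)"
  obtain g where g: "g \<in> carrier (hom_group (res_ker ?H) A)"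
    and Xg: "X = ext_restr ?H A #>\<^bsub>hom_group (res_ker ?H) A\<^esub> g" by (rule Ext_cases[OF X])
  have pg: "hom_post (res_ker ?H) \<psi> g \<in> carrier (hom_group (res_ker ?H) B)"
    by (rule hom_in_carrier[OF hom_post_hom[OF group_res_ker_homology \<psi>] g])
  have "(\<lambda>\<rho>\<in>cubes k \<Lambda> r. \<psi> (alpha_cocycle A r g \<rho>)) = alpha_cocycle B r (hom_post (res_ker ?H) \<psi> g)"
    unfolding alpha_cocycle_def hom_post_def
    by (rule restrict_ext) (simp add: uct_lift_in_res_ker[OF bd_in_boundaries])
  then show ?thesis
    unfolding Xg uct_alpha_r_coset[OF A g] Ext_post_r_coset[OF comm_group_homology A B \<psi> g]
      uct_alpha_r_coset[OF B pg] cohomology_post_r_coset(2)[OF A B \<psi> hom_in_carrier[OF alpha_cocycle_hom[OF A] g]]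
    by simp
qed

theorem uct_beta_natural_coefficients:
  assumes A: "comm_group A" and B: "comm_group B" and \<psi>: "\<psi> \<in> hom A B"
    and X: "X \<in> carrier (cohomology k \<Lambda> A r)"
  shows "hom_post (homology k \<Lambda> r) \<psi> (uct_beta k \<Lambda> A r X) = uct_beta k \<Lambda> B r (cohomology_post k \<Lambda> B r \<psi> X)"
proof -
  obtain f where f: "f \<in> carrier (cocycle_group k \<Lambda> A r)"
    and Xf: "X = coboundaries k \<Lambda> A r #>\<^bsub>cocycle_group k \<Lambda> A r\<^esub> f" by (rule cohomology_cases[OF X])
  have fA: "f \<rho> \<in> carrier A" if "\<rho> \<in> cubes k \<Lambda> r" for \<rho>
    using f that by (auto simp: in_cocycle_group_iff[OF A])
  note p = cohomology_post_r_coset[OF A B \<psi> f]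
  show ?thesis
    unfolding Xf p(2)
  proof (rule extensionalityI[of _ "carrier (homology k \<Lambda> r)"])
    fix Y assume Y: "Y \<in> carrier (homology k \<Lambda> r)"
    then obtain z where z: "z \<in> carrier (cycle_group k \<Lambda> r)" "Y = hclass r z" by (rule homology_cases)
    have zC: "Poly_Mapping.keys z \<subseteq> cubes k \<Lambda> r" using z by (simp add: in_cycle_group_iff)
    have "\<psi> (lin_ext A f z) = lin_ext B (\<lambda>\<rho>. \<psi> (f \<rho>)) z" by (rule lin_ext_hom_image[OF A B \<psi> fA zC])
    also have "\<dots> = lin_ext B (\<lambda>\<rho>\<in>cubes k \<Lambda> r. \<psi> (f \<rho>)) z"
      by (rule lin_ext_cong[OF B _ _ zC]) (simp_all add: hom_in_carrier[OF \<psi> fA])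
    finally show "hom_post (homology k \<Lambda> r) \<psi> (uct_beta k \<Lambda> A r (coboundaries k \<Lambda> A r #>\<^bsub>cocycle_group k \<Lambda> A r\<^esub> f)) Y =
      uct_beta k \<Lambda> B r (coboundaries k \<Lambda> B r #>\<^bsub>cocycle_group k \<Lambda> B r\<^esub> (\<lambda>\<rho>\<in>cubes k \<Lambda> r. \<psi> (f \<rho>))) Y"
      unfolding hom_post_def restrict_apply'[OF Y]
      unfolding z(2) uct_beta_r_coset[OF A f z(1)] uct_beta_r_coset[OF B p(1) z(1)] .
  qed (simp_all add: uct_beta_def hom_post_def)
qed

end

context k_graph_morphism
begin

lemma free_map_chain_hom: "free_map F \<in> hom (chains k \<Lambda> r) (chains k \<Gamma> r)"
  unfolding chains_def using cubes_image by (rule free_map_hom)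

lemma free_map_cycle_hom: "free_map F \<in> hom (cycle_group k \<Lambda> r) (cycle_group k \<Gamma> r)"
proof (rule homI)
  fix z assume "z \<in> carrier (cycle_group k \<Lambda> r)"
  then have z: "Poly_Mapping.keys z \<subseteq> cubes k \<Lambda> r" "bd k \<Lambda> r z = 0" by (simp_all add: in_cycle_group_iff)
  show "free_map F z \<in> carrier (cycle_group k \<Gamma> r)"
    using hom_in_carrier[OF free_map_chain_hom, of z] z bd_free_map[OF z(1)]
    by (simp add: in_cycle_group_iff free_map_def)
qed (simp add: free_map_def frag_extend_add)

lemma free_map_boundaries:
  assumes "b \<in> boundaries k \<Lambda> r" shows "free_map F b \<in> boundaries k \<Gamma> r"
proof -
  obtain c where c: "Poly_Mapping.keys c \<subseteq> cubes k \<Lambda> (r + 1)" "b = bd k \<Lambda> (r + 1) c"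
    using assms by (auto simp: boundaries_def)
  have "free_map F c \<in> carrier (chains k \<Gamma> (r + 1))"
    using hom_in_carrier[OF free_map_chain_hom, of c] c(1) by simp
  then show ?thesis unfolding boundaries_def c(2) bd_free_map[OF c(1), symmetric] by (rule imageI)
qed

lemma homology_map_hclass:
  "z \<in> carrier (cycle_group k \<Lambda> r) \<Longrightarrow> homology_map k \<Gamma> r F (dom.hclass r z) = cod.hclass r (free_map F z)"
  unfolding homology_map_def
  by (rule quot_map_r_coset[OF dom.group_cycle_group cod.group_cycle_group dom.subgroup_boundaries
        cod.subgroup_boundaries free_map_cycle_hom free_map_boundaries])

lemma homology_map_hom: "homology_map k \<Gamma> r F \<in> hom (homology k \<Lambda> r) (homology k \<Gamma> r)"
  unfolding homology_map_def homology_def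
  by (rule quot_map_hom[OF dom.comm_group_cycle_group cod.comm_group_cycle_group dom.subgroup_boundaries
        cod.subgroup_boundaries free_map_cycle_hom free_map_boundaries])

text \<open>The chain map \<open>F\<^sub>#\<close> commutes with \<open>\<partial>\<close>, so pulling back along \<open>F\<close> preserves cocycles and
  coboundaries.\<close>

lemma cohomology_pre_r_coset:
  assumes A: "comm_group A" and f: "f \<in> carrier (cocycle_group k \<Gamma> A r)"
  shows "(\<lambda>\<rho>\<in>cubes k \<Lambda> r. f (F \<rho>)) \<in> carrier (cocycle_group k \<Lambda> A r)"
    and "cohomology_pre k \<Lambda> A r F (coboundaries k \<Gamma> A r #>\<^bsub>cocycle_group k \<Gamma> A r\<^esub> f) =
      coboundaries k \<Lambda> A r #>\<^bsub>cocycle_group k \<Lambda> A r\<^esub> (\<lambda>\<rho>\<in>cubes k \<Lambda> r. f (F \<rho>))"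
    and "Poly_Mapping.keys c \<subseteq> cubes k \<Lambda> r \<Longrightarrow>
      lin_ext A (\<lambda>\<rho>\<in>cubes k \<Lambda> r. f (F \<rho>)) c = lin_ext A f (free_map F c)"
proof -
  let ?p = "\<lambda>f. \<lambda>\<rho>\<in>cubes k \<Lambda> r. f (F \<rho>)"
  have lin: "lin_ext A (?p f) c = lin_ext A f (free_map F c)"
    if f: "f \<in> carrier (cocycle_group k \<Gamma> A r)" and c: "Poly_Mapping.keys c \<subseteq> cubes k \<Lambda> r" for f c
  proof -
    have fA: "f \<rho> \<in> carrier A" if "\<rho> \<in> cubes k \<Gamma> r" for \<rho>
      using f that by (auto simp: cod.in_cocycle_group_iff[OF A])
    have "lin_ext A (?p f) c = lin_ext A (\<lambda>\<rho>. f (F \<rho>)) c"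
      by (rule lin_ext_cong[OF A _ _ c]) (simp_all add: fA cubes_image)
    also have "\<dots> = lin_ext A f (free_map F c)"
      by (rule lin_ext_free_map[OF A fA cubes_image c, symmetric])
    finally show ?thesis .
  qed
  show "Poly_Mapping.keys c \<subseteq> cubes k \<Lambda> r \<Longrightarrow> lin_ext A (?p f) c = lin_ext A f (free_map F c)"
    by (rule lin[OF f])
  have p: "?p f \<in> carrier (cocycle_group k \<Lambda> A r)" if f: "f \<in> carrier (cocycle_group k \<Gamma> A r)" for f
  proof -
    have fA: "f \<rho> \<in> carrier A" if "\<rho> \<in> cubes k \<Gamma> r" for \<rho>
      using f that by (auto simp: cod.in_cocycle_group_iff[OF A])
    have "lin_ext A (?p f) b = \<one>\<^bsub>A\<^esub>" if b: "b \<in> boundaries k \<Lambda> r" for b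
      using lin[OF f, of b] dom.boundaries_subset[OF b] free_map_boundaries[OF b] f
      by (simp add: in_cycle_group_iff cod.in_cocycle_group_iff[OF A])
    then show ?thesis using fA cubes_image by (simp add: dom.in_cocycle_group_iff[OF A])
  qed
  show "?p f \<in> carrier (cocycle_group k \<Lambda> A r)" by (rule p[OF f])
  have hom: "?p \<in> hom (cocycle_group k \<Gamma> A r) (cocycle_group k \<Lambda> A r)"
  proof (rule homI)
    fix f g
    show "?p (f \<otimes>\<^bsub>cocycle_group k \<Gamma> A r\<^esub> g) = ?p f \<otimes>\<^bsub>cocycle_group k \<Lambda> A r\<^esub> ?p g"
      unfolding mult_cocycle_group by (intro restrict_ext) (simp add: cubes_image)
  qed (rule p)
  have cob: "?p n \<in> coboundaries k \<Lambda> A r" if n: "n \<in> coboundaries k \<Gamma> A r" for n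
  proof -
    obtain h where h: "h \<in> hom (chains k \<Gamma> (r - 1)) A"
      and nh: "n = (\<lambda>\<rho>\<in>cubes k \<Gamma> r. h (bd k \<Gamma> r (frag_of \<rho>)))"
      using n by (auto simp: cod.in_coboundaries_iff[OF A])
    have hF: "h \<circ> free_map F \<in> hom (chains k \<Lambda> (r - 1)) A"
      by (rule hom_compose[OF free_map_chain_hom h])
    have "?p n = (\<lambda>\<rho>\<in>cubes k \<Lambda> r. (h \<circ> free_map F) (bd k \<Lambda> r (frag_of \<rho>)))"
      unfolding nh by (rule restrict_ext) (simp add: cubes_image bd_free_map[symmetric])
    with hF show ?thesis unfolding dom.in_coboundaries_iff[OF A] by blast
  qed
  show "cohomology_pre k \<Lambda> A r F (coboundaries k \<Gamma> A r #>\<^bsub>cocycle_group k \<Gamma> A r\<^esub> f) =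
      coboundaries k \<Lambda> A r #>\<^bsub>cocycle_group k \<Lambda> A r\<^esub> ?p f"
    unfolding cohomology_pre_def
    by (rule quot_map_r_coset[OF comm_group.axioms(2)[OF cod.comm_group_cocycle_group[OF A]]
          comm_group.axioms(2)[OF dom.comm_group_cocycle_group[OF A]]
          cod.subgroup_coboundaries[OF A] dom.subgroup_coboundaries[OF A] hom cob f])
qed

text \<open>The lifts \<open>\<sigma>\<close> for \<open>\<Lambda>\<close> and \<open>\<sigma>'\<close> for \<open>\<Gamma>\<close> are unrelated choices.  The map \<open>\<theta> = \<sigma>' F\<^sub># - \<int>[F\<^sub>*] \<sigma>\<close> measures
  the failure of the square to commute.  As both terms lift \<open>z \<mapsto> [F\<^sub># z]\<close>, it takes values in the
  kernel \<open>K\<close> of the augmentation, so \<open>g \<circ> \<theta>\<close> is a homomorphism on all cycles and changes the cocycle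
  only by a coboundary.\<close>

theorem uct_alpha_natural_graph:
  assumes A: "comm_group A" and X: "X \<in> carrier (Ext (homology k \<Gamma> (r - 1)) A)"
  shows "cohomology_pre k \<Lambda> A r F (uct_alpha k \<Gamma> A r X) =
    uct_alpha k \<Lambda> A r (Ext_pre (homology k \<Lambda> (r - 1)) A (homology_map k \<Gamma> (r - 1) F) X)"
proof -
  let ?H = "homology k \<Lambda> (r - 1)" and ?G = "homology k \<Gamma> (r - 1)"
  let ?Z = "cycle_group k \<Lambda> (r - 1)"
  let ?\<sigma> = "uct_lift k \<Lambda> (r - 1)" and ?\<sigma>' = "uct_lift k \<Gamma> (r - 1)"
  let ?m = "free_map (homology_map k \<Gamma> (r - 1) F)"
  interpret A: comm_group A by fact
  obtain g where g: "g \<in> carrier (hom_group (res_ker ?G) A)"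
    and Xg: "X = ext_restr ?G A #>\<^bsub>hom_group (res_ker ?G) A\<^esub> g" by (rule Ext_cases[OF X])
  then have g': "g \<in> hom (res_ker ?G) A" by simp
  note mK = free_map_hom_res_ker[OF dom.comm_group_homology cod.comm_group_homology homology_map_hom[of "r - 1"]]
  have pg: "hom_pre (res_ker ?H) ?m g \<in> carrier (hom_group (res_ker ?H) A)"
    by (rule hom_in_carrier[OF hom_pre_hom[OF dom.group_res_ker_homology mK] g])
  have mG: "?m \<in> hom (free_Abelian_group (carrier ?H)) (free_Abelian_group (carrier ?G))"
    using hom_in_carrier[OF homology_map_hom] by (rule free_map_hom)
  define \<theta> where "\<theta> z = ?\<sigma>' (free_map F z) - ?m (?\<sigma> z)" for z
  have \<sigma>Z: "Poly_Mapping.keys (?\<sigma> z) \<subseteq> carrier ?H" if "z \<in> carrier ?Z" for z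
    using hom_in_carrier[OF dom.uct_lift_hom that] by simp
  have FZ: "free_map F z \<in> carrier (cycle_group k \<Gamma> (r - 1))" if "z \<in> carrier ?Z" for z
    using hom_in_carrier[OF free_map_cycle_hom that] .
  have m\<sigma>: "Poly_Mapping.keys (?m (?\<sigma> z)) \<subseteq> carrier ?G" if "z \<in> carrier ?Z" for z
    using hom_in_carrier[OF mG, of "?\<sigma> z"] \<sigma>Z[OF that] by simp
  have \<sigma>F: "Poly_Mapping.keys (?\<sigma>' (free_map F z)) \<subseteq> carrier ?G" if "z \<in> carrier ?Z" for z
    using hom_in_carrier[OF cod.uct_lift_hom FZ[OF that]] by simp
  have \<theta>: "\<theta> \<in> hom ?Z (res_ker ?G)"
  proof (rule hom_res_kerI)
    show "\<theta> \<in> hom ?Z (free_Abelian_group (carrier ?G))"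
    proof (rule homI)
      fix x y assume xy: "x \<in> carrier ?Z" "y \<in> carrier ?Z"
      have "?\<sigma> (x + y) = ?\<sigma> x + ?\<sigma> y" using hom_mult[OF dom.uct_lift_hom xy] by simp
      moreover have "?\<sigma>' (free_map F x + free_map F y) = ?\<sigma>' (free_map F x) + ?\<sigma>' (free_map F y)"
        using hom_mult[OF cod.uct_lift_hom FZ[OF xy(1)] FZ[OF xy(2)]] by simp
      moreover have "free_map F (x + y) = free_map F x + free_map F y"
        "?m (?\<sigma> x + ?\<sigma> y) = ?m (?\<sigma> x) + ?m (?\<sigma> y)" by (simp_all add: free_map_def frag_extend_add)
      ultimately show "\<theta> (x \<otimes>\<^bsub>?Z\<^esub> y) = \<theta> x \<otimes>\<^bsub>free_Abelian_group (carrier ?G)\<^esub> \<theta> y"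
        by (simp add: \<theta>_def)
    qed (simp add: \<theta>_def keys_minus_subset m\<sigma> \<sigma>F)
    fix z assume z: "z \<in> carrier ?Z"
    have t: "Poly_Mapping.keys (\<theta> z) \<subseteq> carrier ?G"
      unfolding \<theta>_def by (rule keys_minus_subset[OF \<sigma>F[OF z] m\<sigma>[OF z]])
    have 1: "res_aug ?G (?\<sigma>' (free_map F z)) = cod.hclass (r - 1) (free_map F z)"
      by (rule cod.res_aug_uct_lift[OF FZ[OF z]])
    have 2: "res_aug ?G (?m (?\<sigma> z)) = cod.hclass (r - 1) (free_map F z)"
      using res_aug_free_map[OF dom.comm_group_homology cod.comm_group_homology homology_map_hom \<sigma>Z[OF z]]
        dom.res_aug_uct_lift[OF z] homology_map_hclass[OF z] by simp
    have "res_aug ?G (?\<sigma>' (free_map F z)) = res_aug ?G (\<theta> z) \<otimes>\<^bsub>?G\<^esub> res_aug ?G (?m (?\<sigma> z))"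
      using hom_mult[OF res_aug_hom[OF cod.comm_group_homology], of "\<theta> z" "r - 1" "?m (?\<sigma> z)"] t m\<sigma>[OF z]
      by (simp add: \<theta>_def)
    then show "res_aug ?G (\<theta> z) = \<one>\<^bsub>?G\<^esub>"
      using group.r_cancel_one'[OF cod.group_homology hom_in_carrier[OF cod.hclass_hom FZ[OF z]]]
        hom_in_carrier[OF res_aug_hom[OF cod.comm_group_homology], of "\<theta> z"] t
      by (simp add: 1 2)
  qed
  define n where "n = (\<lambda>\<rho>\<in>cubes k \<Lambda> r. (g \<circ> \<theta>) (bd k \<Lambda> r (frag_of \<rho>)))"
  have n: "n \<in> coboundaries k \<Lambda> A r"
    unfolding n_def by (rule dom.coboundary_of_hom_cycle_group[OF A hom_compose[OF \<theta> g']])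
  have eq: "(\<lambda>\<rho>\<in>cubes k \<Lambda> r. cod.alpha_cocycle A r g (F \<rho>)) =
      n \<otimes>\<^bsub>cocycle_group k \<Lambda> A r\<^esub> dom.alpha_cocycle A r (hom_pre (res_ker ?H) ?m g)"
    unfolding mult_cocycle_group
  proof (rule restrict_ext)
    fix \<rho> assume \<rho>: "\<rho> \<in> cubes k \<Lambda> r"
    let ?b = "bd k \<Lambda> r (frag_of \<rho>)"
    have b: "?b \<in> boundaries k \<Lambda> (r - 1)" using \<rho> by (intro dom.bd_in_boundaries) simp
    have z: "?b \<in> carrier ?Z" by (rule dom.boundaries_subset[OF b])
    have s: "?\<sigma> ?b \<in> carrier (res_ker ?H)" by (rule dom.uct_lift_in_res_ker[OF b])
    have "bd k \<Gamma> r (frag_of (F \<rho>)) = free_map F ?b" using bd_free_map[of "frag_of \<rho>" r] \<rho> by simp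
    then have "cod.alpha_cocycle A r g (F \<rho>) = g (?\<sigma>' (free_map F ?b))"
      using cubes_image[OF \<rho>] by (simp add: cod.alpha_cocycle_def)
    also have "\<dots> = g (\<theta> ?b + ?m (?\<sigma> ?b))" by (simp add: \<theta>_def)
    also have "\<dots> = g (\<theta> ?b) \<otimes>\<^bsub>A\<^esub> g (?m (?\<sigma> ?b))"
      using hom_mult[OF g' hom_in_carrier[OF \<theta> z] hom_in_carrier[OF mK s]] by simp
    also have "\<dots> = n \<rho> \<otimes>\<^bsub>A\<^esub> dom.alpha_cocycle A r (hom_pre (res_ker ?H) ?m g) \<rho>"
      using \<rho> s by (simp add: n_def dom.alpha_cocycle_def hom_pre_def)
    finally show "cod.alpha_cocycle A r g (F \<rho>) = n \<rho> \<otimes>\<^bsub>A\<^esub> dom.alpha_cocycle A r (hom_pre (res_ker ?H) ?m g) \<rho>" .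
  qed
  have "coboundaries k \<Lambda> A r #>\<^bsub>cocycle_group k \<Lambda> A r\<^esub> (n \<otimes>\<^bsub>cocycle_group k \<Lambda> A r\<^esub> dom.alpha_cocycle A r (hom_pre (res_ker ?H) ?m g)) =
      coboundaries k \<Lambda> A r #>\<^bsub>cocycle_group k \<Lambda> A r\<^esub> dom.alpha_cocycle A r (hom_pre (res_ker ?H) ?m g)"
    by (rule r_coset_eqI[OF comm_group.axioms(2)[OF dom.comm_group_cocycle_group[OF A]]
          dom.subgroup_coboundaries[OF A] n hom_in_carrier[OF dom.alpha_cocycle_hom[OF A] pg]])
  then show ?thesis
    unfolding Xg cod.uct_alpha_r_coset[OF A g]
      Ext_pre_r_coset[OF dom.comm_group_homology cod.comm_group_homology A homology_map_hom g]
      dom.uct_alpha_r_coset[OF A pg]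
      cohomology_pre_r_coset(2)[OF A hom_in_carrier[OF cod.alpha_cocycle_hom[OF A] g]] eq .
qed

theorem uct_beta_natural_graph:
  assumes A: "comm_group A" and X: "X \<in> carrier (cohomology k \<Gamma> A r)"
  shows "hom_pre (homology k \<Lambda> r) (homology_map k \<Gamma> r F) (uct_beta k \<Gamma> A r X) =
    uct_beta k \<Lambda> A r (cohomology_pre k \<Lambda> A r F X)"
proof -
  obtain f where f: "f \<in> carrier (cocycle_group k \<Gamma> A r)"
    and Xf: "X = coboundaries k \<Gamma> A r #>\<^bsub>cocycle_group k \<Gamma> A r\<^esub> f" by (rule cod.cohomology_cases[OF X])
  note p = cohomology_pre_r_coset[OF A f]
  show ?thesis
    unfolding Xf p(2)
  proof (rule extensionalityI[of _ "carrier (homology k \<Lambda> r)"])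
    fix Y assume Y: "Y \<in> carrier (homology k \<Lambda> r)"
    then obtain z where z: "z \<in> carrier (cycle_group k \<Lambda> r)" "Y = dom.hclass r z" by (rule dom.homology_cases)
    have "lin_ext A f (free_map F z) = lin_ext A (\<lambda>\<rho>\<in>cubes k \<Lambda> r. f (F \<rho>)) z"
      using p(3)[of z] z by (simp add: in_cycle_group_iff)
    then show "hom_pre (homology k \<Lambda> r) (homology_map k \<Gamma> r F)
         (uct_beta k \<Gamma> A r (coboundaries k \<Gamma> A r #>\<^bsub>cocycle_group k \<Gamma> A r\<^esub> f)) Y =
      uct_beta k \<Lambda> A r (coboundaries k \<Lambda> A r #>\<^bsub>cocycle_group k \<Lambda> A r\<^esub> (\<lambda>\<rho>\<in>cubes k \<Lambda> r. f (F \<rho>))) Y"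
      unfolding hom_pre_def restrict_apply'[OF Y]
      unfolding z(2) homology_map_hclass[OF z(1)] cod.uct_beta_r_coset[OF A f hom_in_carrier[OF free_map_cycle_hom z(1)]]
        dom.uct_beta_r_coset[OF A p(1) z(1)] .
  qed (simp_all add: uct_beta_def hom_pre_def)
qed

end

theorem theorem7p3:
  fixes k :: nat and r :: int
    and \<Lambda> :: "('o, 'm) graded_category" and A :: "('a, 'y) monoid_scheme"
  assumes "k_graph k \<Lambda>" and "comm_group A" and "0 \<le> r"
  shows
    "short_exact (Ext (homology k \<Lambda> (r - 1)) A) (cohomology k \<Lambda> A r) (hom_group (homology k \<Lambda> r) A)
       (uct_alpha k \<Lambda> A r) (uct_beta k \<Lambda> A r)
     \<and>
     (\<forall>(B :: ('b, 'z) monoid_scheme) \<psi>. comm_group B \<and> \<psi> \<in> hom A B \<longrightarrow>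
       (\<forall>X \<in> carrier (Ext (homology k \<Lambda> (r - 1)) A).
          cohomology_post k \<Lambda> B r \<psi> (uct_alpha k \<Lambda> A r X)
          = uct_alpha k \<Lambda> B r (Ext_post (homology k \<Lambda> (r - 1)) B \<psi> X)) \<and>
       (\<forall>X \<in> carrier (cohomology k \<Lambda> A r).
          hom_post (homology k \<Lambda> r) \<psi> (uct_beta k \<Lambda> A r X)
          = uct_beta k \<Lambda> B r (cohomology_post k \<Lambda> B r \<psi> X)))
     \<and>
     (\<forall>(\<Gamma> :: ('p, 'n) graded_category) Fo F. k_graph_morphism k \<Lambda> \<Gamma> Fo F \<longrightarrow>
       (\<forall>X \<in> carrier (Ext (homology k \<Gamma> (r - 1)) A).
          cohomology_pre k \<Lambda> A r F (uct_alpha k \<Gamma> A r X)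
          = uct_alpha k \<Lambda> A r
              (Ext_pre (homology k \<Lambda> (r - 1)) A (homology_map k \<Gamma> (r - 1) F) X)) \<and>
       (\<forall>X \<in> carrier (cohomology k \<Gamma> A r).
          hom_pre (homology k \<Lambda> r) (homology_map k \<Gamma> r F) (uct_beta k \<Gamma> A r X)
          = uct_beta k \<Lambda> A r (cohomology_pre k \<Lambda> A r F X)))"
proof (intro conjI allI impI ballI)
  show "short_exact (Ext (homology k \<Lambda> (r - 1)) A) (cohomology k \<Lambda> A r) (hom_group (homology k \<Lambda> r) A)
      (uct_alpha k \<Lambda> A r) (uct_beta k \<Lambda> A r)"
    by (rule k_graph.uct_short_exact[OF assms(1,2)])
qed ((elim conjE)?, (rule k_graph.uct_alpha_natural_coefficients[OF assms(1,2)]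
    k_graph.uct_beta_natural_coefficients[OF assms(1,2)]
    k_graph_morphism.uct_alpha_natural_graph[OF _ assms(2)]
    k_graph_morphism.uct_beta_natural_graph[OF _ assms(2)]), assumption+)+

end
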